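(* There is a commutative family $(H_n)_{n\ge1}$ of derivations of the algebra $\mathbb C[H_-\backslash B_-]_q$ (that is, $H_nH_p=H_pH_n$ for all $n,p$), defined by the formulas $$H_\mu(u(\lambda))=\frac{1}{\lambda^{-1}-\mu^{-1}}\bigl(\lambda^{-1}u(\lambda)-\mu^{-1}u(\mu)\bigr)v(\mu)u(\lambda)-\frac{\mu^{-1}}{\lambda^{-1}-\mu^{-1}}\bigl(u(\lambda)-u(\mu)\bigr)\bigl(1+v(\mu)u(\mu)\bigr),$$ $$H_\mu(m(\lambda))=\frac{\mu^{-1}}{\lambda^{-1}-\mu^{-1}}\bigl(1+m(\mu)w(\mu)\bigr)\bigl(m(\lambda)-m(\mu)\bigr)-\frac{1}{\lambda^{-1}-\mu^{-1}}m(\lambda)w(\mu)\bigl(\lambda^{-1}m(\lambda)-\mu^{-1}m(\mu)\bigr),$$ where $H_\mu=\sum_{k\ge1}(-1)^kH_k\mu^{-k}$, $v(\mu)=-\bigl(u(\mu)+\mu\,m(\mu)^{-1}\bigr)^{-1}$ and $w(\mu)=-\bigl(m(\mu)+\mu\,u(\mu)^{-1}\bigr)^{-1}$. Moreover this family deforms the classical action by vector fields of the Abelian Lie algebra $\mathfrak h_+$ on $H_-\backslash B_-$: modulo $q-1$, $H_\mu$ becomes the derivation $\frac12\sum_{n\ge1}\mu^{-n}h_n$ of $\mathbb C[H_-\backslash B_-]$, where $h_n=\mathrm{diag}(\lambda^n,-\lambda^n)$ acts by left translation.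
   Context: $\mathbb C[H_-\backslash B_-]_q$ is the algebra over $\mathbb C[q,q^{-1}]$ with generators $u_i,m_i$ ($i>0$) and relations (coefficientwise in commuting central formal variables $\lambda,\mu$) $$\bigl(\lambda^{-1}u(\lambda)-\mu^{-1}u(\mu)\bigr)\bigl(u(\lambda)-u(\mu)\bigr)=q\bigl(u(\lambda)-u(\mu)\bigr)\bigl(\lambda^{-1}u(\lambda)-\mu^{-1}u(\mu)\bigr),$$ $$\bigl(\lambda^{-1}m(\lambda)-\mu^{-1}m(\mu)\bigr)\bigl(m(\lambda)-m(\mu)\bigr)=q^{-1}\bigl(m(\lambda)-m(\mu)\bigr)\bigl(\lambda^{-1}m(\lambda)-\mu^{-1}m(\mu)\bigr),$$ $$u(\lambda)m(\mu)=q^{-1}m(\mu)u(\lambda),$$ with $u(\lambda)=\sum_{i\ge0}(-1)^iu_{i+1}\lambda^{-i}$, $m(\lambda)=\sum_{i\ge0}(-1)^im_{i+1}\lambda^{-i}$. The series $v,w$ are understood as $v(\mu)=-\mu^{-1}m(\mu)\bigl(1+\mu^{-1}u(\mu)m(\mu)\bigr)^{-1}$ and $w(\mu)=-\mu^{-1}u(\mu)\bigl(1+\mu^{-1}m(\mu)u(\mu)\bigr)^{-1}$, power series in $\mu^{-1}$. Division by $\lambda^{-1}-\mu^{-1}$ is exact division of power series in $\lambda^{-1},\mu^{-1}$. $H_\mu$ is applied coefficientwise to series in $\lambda$. Classical objects. $G=SL_2(\mathbb C((\lambda^{-1})))$; $B_-\subset SL_2(\mathbb C[[\lambda^{-1}]])$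 is the subgroup of matrices lower triangular at $\lambda^{-1}=0$; $N_+\subset SL_2(\mathbb C[\lambda])$ is the subgroup of matrices upper unipotent at $\lambda=0$; $H_-=\{\mathrm{diag}(a,a^{-1}):a\in\mathbb C[[\lambda^{-1}]]^*\}$. $H_-\backslash B_-$ is embedded in $H_-\backslash G/N_+$, and $\mathfrak h_+=\{\mathrm{diag}(a,-a):a\in\lambda\mathbb C[\lambda]\}$ acts on it by left translation vector fields, $X\cdot\varphi(x)=\frac{d}{dt}|_{t=0}\varphi(\exp(tX)x)$. Each point of $H_-\backslash B_-$ is uniquely the class of $\begin{pmatrix}1&v_{\mathrm{cl}}\\ 0&1\end{pmatrix}\begin{pmatrix}1&0\\ u_{\mathrm{cl}}&1\end{pmatrix}$ with $u_{\mathrm{cl}}\in\mathbb C[[\lambda^{-1}]]$, $v_{\mathrm{cl}}\in\lambda^{-1}\mathbb C[[\lambda^{-1}]]$; with $m_{\mathrm{cl}}=-\lambda v_{\mathrm{cl}}(1+u_{\mathrm{cl}}v_{\mathrm{cl}})^{-1}$, $u_{\mathrm{cl}}=\sum_{i\ge0}(-1)^iu_{i+1,\mathrm{cl}}\lambda^{-i}$, $m_{\mathrm{cl}}=\sum_{i\ge0}(-1)^im_{i+1,\mathrm{cl}}\lambda^{-i}$, one has $\mathbb C[H_-\backslash B_-]=\mathbb C[u_{i,\mathrm{cl}},m_{i,\mathrm{cl}}]$, identified with $\mathbb C[H_-\backslash B_-]_q/(q-1)$ via $u_i\mapsto u_{i,\mathrm{cl}}$, $m_i\mapsto m_{i,\mathrm{cl}}$.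 *)

theory Defs
  imports
    "HOL-Library.Poly_Mapping"
    "HOL-Complex_Analysis.Complex_Analysis"
begin

section \<open>Free algebras and evaluation\<close>

instantiation list :: (type) monoid_add
begin
definition zero_list :: "'a list" where "zero_list = []"
definition plus_list :: "'a list \<Rightarrow> 'a list \<Rightarrow> 'a list" where "plus_list xs ys = xs @ ys"
instance by standard (simp_all add: zero_list_def plus_list_def)
end

text \<open>The index is shifted: \<open>GenU i\<close> stands for $u_{i+1}$ and \<open>GenM i\<close> for $m_{i+1}$.\<close>

datatype gen = GenU nat | GenM nat

text \<open>Laurent polynomials in $q$, and the free algebra over them; multiplication is convolution.\<close>

type_synonym laurent = "int \<Rightarrow>\<^sub>0 complex"
type_synonym free_alg = "gen list \<Rightarrow>\<^sub>0 laurent"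

definition free_scalar :: "laurent \<Rightarrow> free_alg" where
  "free_scalar c = Poly_Mapping.single [] c"

definition free_gen :: "gen \<Rightarrow> free_alg" where
  "free_gen g = Poly_Mapping.single [g] 1"

definition q_pow :: "int \<Rightarrow> laurent" where
  "q_pow k = Poly_Mapping.single k 1"

text \<open>The linear extension of \<open>f\<close> along the coefficient map \<open>\<phi>\<close>.\<close>

definition extend :: "('b::zero \<Rightarrow> 'c::comm_ring_1) \<Rightarrow> ('a \<Rightarrow> 'c) \<Rightarrow> ('a \<Rightarrow>\<^sub>0 'b) \<Rightarrow> 'c" where
  "extend \<phi> f p = (\<Sum>w\<in>Poly_Mapping.keys p. \<phi> (Poly_Mapping.lookup p w) * f w)"

definition ring_map :: "('a::ring_1 \<Rightarrow> 'b::ring_1) \<Rightarrow> bool" where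
  "ring_map h \<longleftrightarrow> h 1 = 1 \<and> (\<forall>a b. h (a + b) = h a + h b) \<and> (\<forall>a b. h (a * b) = h a * h b)"

lemma ring_mapD:
  assumes "ring_map h"
  shows "h 1 = 1" "h (a + b) = h a + h b" "h (a * b) = h a * h b"
    "h 0 = 0" "h (- a) = - h a" "h (a - b) = h a - h b" "h (sum F S) = (\<Sum>s\<in>S. h (F s))"
proof -
  show *: "h 1 = 1" "h (a + b) = h a + h b" "h (a * b) = h a * h b" for a b
    using assms by (auto simp: ring_map_def)
  show 0: "h 0 = 0" using *(2)[of 0 0] by simp
  show m: "h (- a) = - h a" for a using *(2)[of a "- a"] 0 by (simp add: eq_neg_iff_add_eq_0 add.commute)
  show "h (a - b) = h a - h b" using *(2)[of a "- b"] m by simp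
  show "h (sum F S) = (\<Sum>s\<in>S. h (F s))"
    by (induction S rule: infinite_finite_induct) (simp_all add: 0 *)
qed

lemma extend_eq:
  assumes "\<phi> 0 = 0" "finite S" "Poly_Mapping.keys p \<subseteq> S"
  shows "extend \<phi> f p = (\<Sum>w\<in>S. \<phi> (Poly_Mapping.lookup p w) * f w)"
  unfolding extend_def using assms
  by (intro sum.mono_neutral_left) (auto simp: in_keys_iff)

lemma extend_single:
  assumes "\<phi> 0 = 0"
  shows "extend \<phi> f (Poly_Mapping.single w c) = \<phi> c * f w"
  using extend_eq[of \<phi> "{w}" "Poly_Mapping.single w c" f] assms by simp

lemma extend_add:
  fixes \<phi> :: "'b::ring_1 \<Rightarrow> 'c::comm_ring_1"
  assumes "ring_map \<phi>"
  shows "extend \<phi> f (p + r) = extend \<phi> f p + extend \<phi> f r"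
proof -
  let ?S = "Poly_Mapping.keys p \<union> Poly_Mapping.keys r"
  note e = extend_eq[of \<phi> ?S, OF ring_mapD(4)[OF assms]]
  show ?thesis
    using Poly_Mapping.keys_add[of p r]
    by (simp add: e lookup_add ring_mapD[OF assms] distrib_right sum.distrib)
qed

lemma poly_mapping_expand:
  fixes p :: "'a \<Rightarrow>\<^sub>0 'b::comm_monoid_add"
  shows "p = (\<Sum>w\<in>Poly_Mapping.keys p. Poly_Mapping.single w (Poly_Mapping.lookup p w))"
  by (rule poly_mapping_eqI) (auto simp: lookup_sum lookup_single when_def in_keys_iff)

lemma extend_sum:
  fixes \<phi> :: "'b::ring_1 \<Rightarrow> 'c::comm_ring_1"
  assumes "ring_map \<phi>"
  shows "extend \<phi> f (sum F S) = (\<Sum>s\<in>S. extend \<phi> f (F s))"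
  by (induction S rule: infinite_finite_induct)
    (simp_all add: extend_add[OF assms], simp_all add: extend_def)

lemma ring_map_extend:
  fixes \<phi> :: "'b::ring_1 \<Rightarrow> 'c::comm_ring_1" and f :: "'a::monoid_add \<Rightarrow> 'c"
  assumes \<phi>: "ring_map \<phi>" and f: "f 0 = 1" "\<And>a b. f (a + b) = f a * f b"
  shows "ring_map (extend \<phi> f)"
proof -
  note z = ring_mapD(4)[OF \<phi>] and single = extend_single[of \<phi> f, OF ring_mapD(4)[OF \<phi>]]
  have "extend \<phi> f (p * r) = extend \<phi> f p * extend \<phi> f r" for p r
  proof -
    let ?K = "Poly_Mapping.keys p" and ?L = "Poly_Mapping.keys r"
    let ?a = "Poly_Mapping.lookup p" and ?b = "Poly_Mapping.lookup r"
    have "p * r = (\<Sum>w\<in>?K. \<Sum>x\<in>?L. Poly_Mapping.single (w + x) (?a w * ?b x))"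
      by (subst (1) poly_mapping_expand[of p], subst (1) poly_mapping_expand[of r])
        (simp add: sum_product mult_single)
    then have "extend \<phi> f (p * r) = (\<Sum>w\<in>?K. \<Sum>x\<in>?L. \<phi> (?a w * ?b x) * f (w + x))"
      by (simp add: extend_sum[OF \<phi>] single)
    also have "\<dots> = extend \<phi> f p * extend \<phi> f r"
      by (simp add: extend_def sum_product f ring_mapD[OF \<phi>] mult_ac)
    finally show ?thesis .
  qed
  moreover have "extend \<phi> f 1 = 1"
    by (simp add: single_one[symmetric] single f ring_mapD[OF \<phi>] del: single_one)
  ultimately show ?thesis
    by (auto simp: ring_map_def extend_add[OF \<phi>])
qed


section \<open>Series in two central variables\<close>

text \<open>
  Series in $\lambda^{-1}$ and $\mu^{-1}$ are modelled as \<open>'a fps fps\<close>; the outer variable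
  is $\lambda^{-1}$, the inner one is $\mu^{-1}$. The coefficient ring need not be commutative,
  but both variables are central.
\<close>

definition at_lambda :: "'a::ring_1 fps \<Rightarrow> 'a fps fps" where
  "at_lambda f = Abs_fps (\<lambda>i. fps_const (fps_nth f i))"

definition at_mu :: "'a::ring_1 fps \<Rightarrow> 'a fps fps" where
  "at_mu f = fps_const f"

definition lambda_inv :: "'a::ring_1 fps fps" where
  "lambda_inv = fps_X"

definition mu_inv :: "'a::ring_1 fps fps" where
  "mu_inv = at_mu fps_X"

definition coeffs2 :: "'a::ring_1 fps fps \<Rightarrow> 'a set" where
  "coeffs2 F = {fps_nth (fps_nth F i) j | i j. True}"

text \<open>Exact division by $\lambda^{-1}-\mu^{-1}$, justified by the lemmas below.\<close>

definition div_diff :: "'a::ring_1 fps fps \<Rightarrow> 'a fps fps" where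
  "div_diff F = (THE Q. (lambda_inv - mu_inv) * Q = F)"

lemma fps_X_mult_eq_0: "fps_X * (f :: 'a::ring_1 fps) = 0 \<Longrightarrow> f = 0"
  by (metis fps_X_mult_nth fps_ext fps_zero_nth diff_Suc_1 nat.distinct(1))

lemma diff_mult_nth:
  "fps_nth ((lambda_inv - mu_inv) * Q) n
     = (if n = 0 then 0 else fps_nth Q (n - 1)) - fps_X * fps_nth Q n"
  by (simp add: lambda_inv_def mu_inv_def at_mu_def left_diff_distrib)

lemma diff_mult_cancel:
  fixes Q R :: "'a::ring_1 fps fps"
  assumes "(lambda_inv - mu_inv) * Q = (lambda_inv - mu_inv) * R"
  shows "Q = R"
proof -
  have "(lambda_inv - mu_inv) * (Q - R) = 0"
    using assms by (simp add: right_diff_distrib)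
  then have eq: "(if n = 0 then 0 else fps_nth (Q - R) (n - 1)) - fps_X * fps_nth (Q - R) n = 0" for n
    by (metis diff_mult_nth fps_zero_nth)
  have "fps_nth (Q - R) n = 0" for n
  proof (induction n)
    case 0
    then show ?case using eq[of 0] fps_X_mult_eq_0 by fastforce
  next
    case (Suc n)
    then show ?case using eq[of "Suc n"] fps_X_mult_eq_0 by fastforce
  qed
  then show ?thesis by (metis eq_iff_diff_eq_0 fps_ext fps_zero_nth)
qed

lemma div_diff_eqI:
  "(lambda_inv - mu_inv) * Q = F \<Longrightarrow> div_diff F = Q"
  unfolding div_diff_def by (blast intro: the_equality diff_mult_cancel)

lemma diff_dvd_at_lambda_minus_at_mu:
  fixes f :: "'a::ring_1 fps"
  shows "(lambda_inv - mu_inv) * Abs_fps (\<lambda>i. Abs_fps (\<lambda>j. fps_nth f (Suc (i + j))))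
    = at_lambda f - at_mu f"
proof (intro fps_ext)
  fix i j
  show "fps_nth (fps_nth ((lambda_inv - mu_inv) * Abs_fps (\<lambda>i. Abs_fps (\<lambda>j. fps_nth f (Suc (i + j))))) i) j
    = fps_nth (fps_nth (at_lambda f - at_mu f) i) j"
    unfolding diff_mult_nth by (cases i; cases j) (simp_all add: at_lambda_def at_mu_def)
qed

lemma diff_dvd_shifted:
  fixes f :: "'a::ring_1 fps"
  shows "(lambda_inv - mu_inv) * Abs_fps (\<lambda>i. Abs_fps (\<lambda>j. fps_nth f (i + j)))
    = lambda_inv * at_lambda f - mu_inv * at_mu f"
proof (intro fps_ext)
  fix i j
  show "fps_nth (fps_nth ((lambda_inv - mu_inv) * Abs_fps (\<lambda>i. Abs_fps (\<lambda>j. fps_nth f (i + j)))) i) j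
    = fps_nth (fps_nth (lambda_inv * at_lambda f - mu_inv * at_mu f) i) j"
    unfolding diff_mult_nth
    by (cases i; cases j) (simp_all add: at_lambda_def at_mu_def lambda_inv_def mu_inv_def)
qed


section \<open>The quantum algebra\<close>

definition exchange_relation :: "'a::ring_1 \<Rightarrow> 'a fps \<Rightarrow> 'a fps fps" where
  "exchange_relation c f =
     (lambda_inv * at_lambda f - mu_inv * at_mu f) * (at_lambda f - at_mu f)
     - fps_const (fps_const c) *
       ((at_lambda f - at_mu f) * (lambda_inv * at_lambda f - mu_inv * at_mu f))"

definition mixed_relation :: "'a::ring_1 \<Rightarrow> 'a fps \<Rightarrow> 'a fps \<Rightarrow> 'a fps fps" where
  "mixed_relation c f g =
     at_lambda f * at_mu g - fps_const (fps_const c) * (at_mu g * at_lambda f)"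

definition free_u :: "free_alg fps" where
  "free_u = Abs_fps (\<lambda>i. (-1) ^ i * free_gen (GenU i))"

definition free_m :: "free_alg fps" where
  "free_m = Abs_fps (\<lambda>i. (-1) ^ i * free_gen (GenM i))"

definition relators :: "free_alg set" where
  "relators =
     coeffs2 (exchange_relation (free_scalar (q_pow 1)) free_u) \<union>
     coeffs2 (exchange_relation (free_scalar (q_pow (-1))) free_m) \<union>
     coeffs2 (mixed_relation (free_scalar (q_pow (-1))) free_u free_m)"

inductive_set rel_ideal :: "free_alg set" where
  zero: "0 \<in> rel_ideal"
| add: "a * r * b + x \<in> rel_ideal" if "r \<in> relators" "x \<in> rel_ideal"

lemma rel_ideal_add: "x \<in> rel_ideal \<Longrightarrow> y \<in> rel_ideal \<Longrightarrow> x + y \<in> rel_ideal"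
  by (induction rule: rel_ideal.induct) (auto simp: add.assoc intro: rel_ideal.add)

lemma rel_ideal_mult: "x \<in> rel_ideal \<Longrightarrow> a * x * b \<in> rel_ideal"
proof (induction rule: rel_ideal.induct)
  case (add r x a' b')
  have "(a * a') * r * (b' * b) + a * x * b \<in> rel_ideal"
    by (rule rel_ideal.add[OF add(1,3)])
  then show ?case by (simp add: algebra_simps)
qed (simp add: rel_ideal.zero)

lemma rel_ideal_uminus: "x \<in> rel_ideal \<Longrightarrow> - x \<in> rel_ideal"
  using rel_ideal_mult[of x "- 1" 1] by simp

definition rel_equiv :: "free_alg \<Rightarrow> free_alg \<Rightarrow> bool" where
  "rel_equiv a b \<longleftrightarrow> a - b \<in> rel_ideal"

lemma equivp_rel_equiv: "equivp rel_equiv"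
proof (rule equivpI)
  show "reflp rel_equiv" by (simp add: reflp_def rel_equiv_def rel_ideal.zero)
  show "symp rel_equiv"
  proof (rule sympI)
    fix a b assume "rel_equiv a b"
    then have "- (a - b) \<in> rel_ideal" unfolding rel_equiv_def by (rule rel_ideal_uminus)
    then show "rel_equiv b a" unfolding rel_equiv_def minus_diff_eq .
  qed
  show "transp rel_equiv"
  proof (rule transpI)
    fix a b c assume "rel_equiv a b" "rel_equiv b c"
    then have "(a - b) + (b - c) \<in> rel_ideal" unfolding rel_equiv_def by (rule rel_ideal_add)
    moreover have "(a - b) + (b - c) = a - c" by simp
    ultimately show "rel_equiv a c" unfolding rel_equiv_def by metis
  qed
qed

lemma rel_equiv_add:
  assumes "rel_equiv a b" "rel_equiv c d"
  shows "rel_equiv (a + c) (b + d)"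
proof -
  have "(a - b) + (c - d) \<in> rel_ideal"
    using assms unfolding rel_equiv_def by (rule rel_ideal_add)
  moreover have "(a - b) + (c - d) = (a + c) - (b + d)" by simp
  ultimately show ?thesis unfolding rel_equiv_def by metis
qed

lemma rel_equiv_uminus:
  assumes "rel_equiv a b"
  shows "rel_equiv (- a) (- b)"
proof -
  have "- (a - b) \<in> rel_ideal"
    using assms unfolding rel_equiv_def by (rule rel_ideal_uminus)
  moreover have "- (a - b) = - a - - b" by simp
  ultimately show ?thesis unfolding rel_equiv_def by metis
qed

lemma rel_equiv_mult:
  assumes "rel_equiv a b" "rel_equiv c d"
  shows "rel_equiv (a * c) (b * d)"
proof -
  have "1 * (a - b) * c + b * (c - d) * 1 \<in> rel_ideal"
    using assms unfolding rel_equiv_def by (intro rel_ideal_add rel_ideal_mult)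
  moreover have "1 * (a - b) * c + b * (c - d) * 1 = a * c - b * d"
    by (simp add: algebra_simps)
  ultimately show ?thesis unfolding rel_equiv_def by metis
qed


subsection \<open>The classical limit of the free algebra\<close>

text \<open>
  The polynomial ring over the complex numbers in the coordinates $u_{i,\mathrm{cl}}$,
  $m_{i,\mathrm{cl}}$, as the monoid algebra of the free commutative monoid on the generators.
\<close>

type_synonym reg_fun = "(gen \<Rightarrow>\<^sub>0 nat) \<Rightarrow>\<^sub>0 complex"

definition cl_gen :: "gen \<Rightarrow> reg_fun" where
  "cl_gen g = Poly_Mapping.single (Poly_Mapping.single g 1) 1"

definition at_q_1 :: "laurent \<Rightarrow> complex" where
  "at_q_1 = extend (\<lambda>c. c) (\<lambda>_. 1)"

definition free_classical_limit :: "free_alg \<Rightarrow> reg_fun" where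
  "free_classical_limit =
     extend (\<lambda>c. Poly_Mapping.single 0 (at_q_1 c)) (\<lambda>w. prod_list (map cl_gen w))"

lemma ring_map_at_q_1: "ring_map at_q_1"
  unfolding at_q_1_def by (rule ring_map_extend) (auto simp: ring_map_def)

lemma ring_map_coefficient: "ring_map (\<lambda>c. Poly_Mapping.single 0 (at_q_1 c) :: reg_fun)"
  using ring_map_at_q_1 by (simp add: ring_map_def single_add mult_single)

lemma ring_map_free_classical_limit: "ring_map free_classical_limit"
  unfolding free_classical_limit_def
  by (rule ring_map_extend[OF ring_map_coefficient]) (simp_all add: zero_list_def plus_list_def)

lemma free_classical_limit_gen: "free_classical_limit (free_gen g) = cl_gen g"
  unfolding free_classical_limit_def free_gen_def
  by (subst extend_single)
    (simp_all add: ring_mapD[OF ring_map_at_q_1])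

lemma free_classical_limit_scalar:
  "free_classical_limit (free_scalar c) = Poly_Mapping.single 0 (at_q_1 c)"
  unfolding free_classical_limit_def free_scalar_def
  by (subst extend_single) (simp_all add: ring_mapD[OF ring_map_at_q_1])

lemma at_q_1_q_pow: "at_q_1 (q_pow k) = 1"
  unfolding at_q_1_def q_pow_def by (subst extend_single) simp_all

definition map_coeffs :: "('a \<Rightarrow> 'b) \<Rightarrow> 'a fps \<Rightarrow> 'b fps" where
  "map_coeffs h f = Abs_fps (\<lambda>i. h (fps_nth f i))"

lemma ring_map_map_coeffs:
  assumes "ring_map h"
  shows "ring_map (map_coeffs h)"
  unfolding ring_map_def map_coeffs_def
  by (auto simp: fps_eq_iff fps_mult_nth ring_mapD[OF assms])

lemma map_coeffs_const: "ring_map h \<Longrightarrow> map_coeffs h (fps_const c) = fps_const (h c)"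
  by (simp add: fps_eq_iff map_coeffs_def ring_mapD)

lemma map_coeffs_X: "ring_map h \<Longrightarrow> map_coeffs h fps_X = fps_X"
  by (simp add: fps_eq_iff map_coeffs_def ring_mapD fps_X_def)

lemma map_coeffs2_series:
  fixes h :: "'a::ring_1 \<Rightarrow> 'b::ring_1"
  assumes "ring_map h"
  defines "h2 \<equiv> map_coeffs (map_coeffs h)"
  shows "h2 (at_lambda f) = at_lambda (map_coeffs h f)" "h2 (at_mu f) = at_mu (map_coeffs h f)"
    "h2 lambda_inv = lambda_inv" "h2 mu_inv = mu_inv"
    "h2 (fps_const (fps_const c)) = fps_const (fps_const (h c))"
proof -
  note r = ring_map_map_coeffs[OF assms(1)]
  show m: "h2 (at_mu f) = at_mu (map_coeffs h f)" for f
    by (simp add: h2_def at_mu_def map_coeffs_const[OF r])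
  show "h2 (at_lambda f) = at_lambda (map_coeffs h f)"
    by (simp add: h2_def at_lambda_def map_coeffs_def[of "map_coeffs h"]
        map_coeffs_const[OF assms(1)]) (simp add: map_coeffs_def)
  show "h2 lambda_inv = lambda_inv"
    by (simp add: h2_def lambda_inv_def map_coeffs_X[OF r])
  show "h2 mu_inv = mu_inv"
    by (simp add: mu_inv_def m map_coeffs_X[OF assms(1)])
  show "h2 (fps_const (fps_const c)) = fps_const (fps_const (h c))"
    by (simp add: h2_def map_coeffs_const[OF r] map_coeffs_const[OF assms(1)])
qed

lemma coeffs2_kernel:
  assumes "map_coeffs (map_coeffs h) F = 0" "r \<in> coeffs2 F"
  shows "h r = 0"
proof -
  obtain i j where "r = fps_nth (fps_nth F i) j" using assms(2) by (auto simp: coeffs2_def)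
  moreover have "fps_nth (fps_nth (map_coeffs (map_coeffs h) F) i) j = 0"
    using assms(1) by simp
  ultimately show ?thesis by (simp add: map_coeffs_def)
qed

lemma map_coeffs_relations:
  fixes h :: "'a::ring_1 \<Rightarrow> 'b::comm_ring_1"
  assumes "ring_map h" "h c = 1"
  shows "map_coeffs (map_coeffs h) (exchange_relation c f) = 0"
    "map_coeffs (map_coeffs h) (mixed_relation c f g) = 0"
proof -
  note r2 = ring_map_map_coeffs[OF ring_map_map_coeffs[OF assms(1)]]
  show "map_coeffs (map_coeffs h) (exchange_relation c f) = 0"
    by (simp add: exchange_relation_def ring_mapD[OF r2] map_coeffs2_series[OF assms(1)] assms(2)
        mult.commute)
  show "map_coeffs (map_coeffs h) (mixed_relation c f g) = 0"
    by (simp add: mixed_relation_def ring_mapD[OF r2] map_coeffs2_series[OF assms(1)] assms(2)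
        mult.commute)
qed

lemma free_classical_limit_rel_ideal:
  assumes "x \<in> rel_ideal"
  shows "free_classical_limit x = 0"
  using assms
proof (induction rule: rel_ideal.induct)
  case zero
  show ?case by (simp add: ring_mapD[OF ring_map_free_classical_limit])
next
  case (add r x a b)
  have "free_classical_limit (free_scalar (q_pow k)) = 1" for k
    by (simp add: free_classical_limit_scalar at_q_1_q_pow)
  from map_coeffs_relations[OF ring_map_free_classical_limit this] have "free_classical_limit r = 0"
    using add(1) unfolding relators_def by (blast intro: coeffs2_kernel)
  then show ?case by (simp add: ring_mapD[OF ring_map_free_classical_limit] add)
qed


subsection \<open>The quotient algebra\<close>

quotient_type qalg = free_alg / rel_equiv
  by (rule equivp_rel_equiv)

instantiation qalg :: ring_1
begin
lift_definition zero_qalg :: qalg is 0 .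
lift_definition one_qalg :: qalg is 1 .
lift_definition plus_qalg :: "qalg \<Rightarrow> qalg \<Rightarrow> qalg" is "(+)" by (rule rel_equiv_add)
lift_definition uminus_qalg :: "qalg \<Rightarrow> qalg" is uminus by (rule rel_equiv_uminus)
lift_definition minus_qalg :: "qalg \<Rightarrow> qalg \<Rightarrow> qalg" is "(-)"
  unfolding diff_conv_add_uminus by (intro rel_equiv_add rel_equiv_uminus)
lift_definition times_qalg :: "qalg \<Rightarrow> qalg \<Rightarrow> qalg" is "(*)" by (rule rel_equiv_mult)
instance
proof
  show "(0::qalg) \<noteq> 1"
  proof (transfer, rule notI)
    assume "rel_equiv 0 1"
    from free_classical_limit_rel_ideal[OF this[unfolded rel_equiv_def]] show False
      by (simp add: ring_mapD[OF ring_map_free_classical_limit])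
  qed
qed (transfer, simp add: algebra_simps rel_equiv_def rel_ideal.zero)+
end

lift_definition scalar :: "laurent \<Rightarrow> qalg" is free_scalar .
lift_definition generator :: "gen \<Rightarrow> qalg" is free_gen .

lift_definition classical_limit :: "qalg \<Rightarrow> reg_fun" is free_classical_limit
  unfolding rel_equiv_def
  by (drule free_classical_limit_rel_ideal) (simp add: ring_mapD[OF ring_map_free_classical_limit])

lemma ring_map_classical_limit: "ring_map classical_limit"
  unfolding ring_map_def by transfer (simp add: ring_mapD[OF ring_map_free_classical_limit])

lemma classical_limit_generator: "classical_limit (generator g) = cl_gen g"
  by transfer (rule free_classical_limit_gen)

lemma classical_limit_scalar: "classical_limit (scalar c) = Poly_Mapping.single 0 (at_q_1 c)"
  by transfer (rule free_classical_limit_scalar)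

definition u_series :: "qalg fps" where
  "u_series = Abs_fps (\<lambda>i. (-1) ^ i * generator (GenU i))"

definition m_series :: "qalg fps" where
  "m_series = Abs_fps (\<lambda>i. (-1) ^ i * generator (GenM i))"

text \<open>
  \<^term>\<open>fps_right_inverse f 1\<close> is the two-sided inverse of a series \<open>f\<close> with constant term 1;
  the generic \<^const>\<open>inverse\<close> on series is not available over a ring that has no inverse operation.
\<close>

definition v_series :: "qalg fps" where
  "v_series = - (fps_X * m_series * fps_right_inverse (1 + fps_X * u_series * m_series) 1)"

definition w_series :: "qalg fps" where
  "w_series = - (fps_X * u_series * fps_right_inverse (1 + fps_X * m_series * u_series) 1)"

definition derivation :: "(qalg \<Rightarrow> qalg) \<Rightarrow> bool" where
  "derivation D \<longleftrightarrow>
     (\<forall>a b. D (a + b) = D a + D b) \<and>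
     (\<forall>c a. D (scalar c * a) = scalar c * D a) \<and>
     (\<forall>a b. D (a * b) = D a * b + a * D b)"

text \<open>$H_\mu=\sum_{k\ge1}(-1)^kH_k\mu^{-k}$ applied coefficientwise to a series in $\lambda^{-1}$.\<close>

definition H_mu :: "(nat \<Rightarrow> qalg \<Rightarrow> qalg) \<Rightarrow> qalg fps \<Rightarrow> qalg fps fps" where
  "H_mu H f =
     Abs_fps (\<lambda>i. Abs_fps (\<lambda>k. if k = 0 then 0 else (-1) ^ k * H k (fps_nth f i)))"


section \<open>The classical action\<close>

text \<open>
  For \<open>n > 0\<close> the series $\exp(t\lambda^n)$ does not lie in $\mathbb C((\lambda^{-1}))$, so the
  derivative at $t=0$ along $\exp(tX)x$ is taken over the dual numbers
  $\mathbb C[\varepsilon]/(\varepsilon^2)$, where $\exp(\varepsilon X)=1+\varepsilon X$.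
  The groups below are therefore defined over an arbitrary commutative ring of coefficients.
\<close>

datatype dual = Dual (body: complex) (tangent: complex)

instantiation dual :: comm_ring_1
begin
definition "0 = Dual 0 0"
definition "1 = Dual 1 0"
definition "a + b = Dual (body a + body b) (tangent a + tangent b)"
definition "a - b = Dual (body a - body b) (tangent a - tangent b)"
definition "- a = Dual (- body a) (- tangent a)"
definition "a * b = Dual (body a * body b) (body a * tangent b + tangent a * body b)"
instance
  by standard
    (simp_all add: zero_dual_def one_dual_def plus_dual_def minus_dual_def uminus_dual_def
      times_dual_def algebra_simps)
end

definition dual_of :: "complex \<Rightarrow> dual" where
  "dual_of c = Dual c 0"

definition eps :: dual where
  "eps = Dual 0 1"

text \<open>
  In \<open>'r fls\<close> the variable \<^const>\<open>fls_X\<close> is $\lambda^{-1}$: the coefficient of index \<open>k\<close>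
  belongs to $\lambda^{-k}$, and $\lambda$ is \<^const>\<open>fls_X_inv\<close>.
\<close>

type_synonym 'r loop_matrix = "'r fls ^ 2 ^ 2"

definition mat2 :: "'r fls \<Rightarrow> 'r fls \<Rightarrow> 'r fls \<Rightarrow> 'r fls \<Rightarrow> 'r::comm_ring_1 loop_matrix" where
  "mat2 a b c d = vector [vector [a, b], vector [c, d]]"

definition B_minus :: "'r::comm_ring_1 loop_matrix set" where
  "B_minus = {x. det x = 1 \<and> (\<forall>i j. vec_nth (vec_nth x i) j \<in> range fps_to_fls) \<and>
     fls_nth (vec_nth (vec_nth x 1) 2) 0 = 0}"

definition N_plus :: "'r::comm_ring_1 loop_matrix set" where
  "N_plus = {x. det x = 1 \<and> (\<forall>i j. \<forall>k>0. fls_nth (vec_nth (vec_nth x i) j) k = 0) \<and>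
     fls_nth (vec_nth (vec_nth x 1) 1) 0 = 1 \<and> fls_nth (vec_nth (vec_nth x 2) 2) 0 = 1 \<and>
     fls_nth (vec_nth (vec_nth x 2) 1) 0 = 0}"

definition H_minus :: "'r::comm_ring_1 loop_matrix set" where
  "H_minus = {mat2 (fps_to_fls a) 0 0 (fps_to_fls b) | a b. a * b = 1}"

text \<open>The pair $(u_{\mathrm{cl}},v_{\mathrm{cl}})$ of the class $H_-x$, for \<open>x\<close> in \<^const>\<open>B_minus\<close>.\<close>

definition uv_cl :: "'r::comm_ring_1 loop_matrix \<Rightarrow> 'r fps \<times> 'r fps" where
  "uv_cl x = (THE (u, v). fps_nth v 0 = 0 \<and>
     (\<exists>h\<in>H_minus. x = h ** mat2 1 (fps_to_fls v) 0 1 ** mat2 1 0 (fps_to_fls u) 1))"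

definition u_cl :: "'r::comm_ring_1 loop_matrix \<Rightarrow> 'r fps" where
  "u_cl x = fst (uv_cl x)"

definition v_cl :: "'r::comm_ring_1 loop_matrix \<Rightarrow> 'r fps" where
  "v_cl x = snd (uv_cl x)"

text \<open>Multiplication of \<open>v_cl x\<close> by $\lambda$ is \<^term>\<open>fps_shift 1\<close>, as its constant term is 0.\<close>

definition m_cl :: "'r::comm_ring_1 loop_matrix \<Rightarrow> 'r fps" where
  "m_cl x = - (fps_shift 1 (v_cl x) * fps_right_inverse (1 + u_cl x * v_cl x) 1)"

fun coordinate :: "'r::comm_ring_1 loop_matrix \<Rightarrow> gen \<Rightarrow> 'r" where
  "coordinate x (GenU i) = (-1) ^ i * fps_nth (u_cl x) i"
| "coordinate x (GenM i) = (-1) ^ i * fps_nth (m_cl x) i"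

text \<open>
  The value of a regular function at the class $H_-x$; \<open>\<iota>\<close> embeds the complex numbers into the
  coefficient ring.
\<close>

definition value_at :: "(complex \<Rightarrow> 'r::comm_ring_1) \<Rightarrow> reg_fun \<Rightarrow> 'r loop_matrix \<Rightarrow> 'r" where
  "value_at \<iota> p x =
     extend \<iota> (\<lambda>\<alpha>. \<Prod>g\<in>Poly_Mapping.keys \<alpha>. coordinate x g ^ Poly_Mapping.lookup \<alpha> g) p"

definition fls_dual_of :: "complex fls \<Rightarrow> dual fls" where
  "fls_dual_of f = Abs_fls (\<lambda>k. dual_of (fls_nth f k))"

definition matrix_dual_of :: "complex loop_matrix \<Rightarrow> dual loop_matrix" where
  "matrix_dual_of x = (\<chi> i j. fls_dual_of (vec_nth (vec_nth x i) j))"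

definition exp_eps :: "complex loop_matrix \<Rightarrow> dual loop_matrix" where
  "exp_eps X = mat 1 + (\<chi> i j. fls_const eps * fls_dual_of (vec_nth (vec_nth X i) j))"

lemma fls_nth_fls_dual_of: "fls_nth (fls_dual_of f) k = dual_of (fls_nth f k)"
proof -
  have "\<forall>\<^sub>\<infinity>n. dual_of (fls_nth f (- int n)) = 0"
    using MOST_fls_neg_nth_eq_0[of f]
    by (rule MOST_mono) (simp add: dual_of_def zero_dual_def)
  then show ?thesis by (simp add: fls_dual_of_def)
qed

text \<open>
  $(X\cdot\varphi)(x)$ is the \<open>eps\<close>-part of $\varphi(\exp(\varepsilon X)x)$. Here $\varphi$ is evaluated
  at the class in $H_-\backslash B_-$ that represents the double coset of $\exp(\varepsilon X)x$
  in $H_-\backslash G/N_+$.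
\<close>

definition left_action :: "complex loop_matrix \<Rightarrow> reg_fun \<Rightarrow> complex loop_matrix \<Rightarrow> complex" where
  "left_action X \<phi> x = (THE d. \<exists>b\<in>B_minus. \<exists>h\<in>H_minus. \<exists>n\<in>N_plus.
     exp_eps X ** matrix_dual_of x = h ** b ** n \<and> d = tangent (value_at dual_of \<phi> b))"

definition h_elem :: "nat \<Rightarrow> complex loop_matrix" where
  "h_elem n = mat2 (fls_X_inv ^ n) 0 0 (- (fls_X_inv ^ n))"

end

theory Submission
  imports Defs
begin

text \<open>
  Put $r=(u(\lambda)-u(\mu))/(\lambda^{-1}-\mu^{-1})$ and $p=u(\mu)+\lambda^{-1}r$. The exchange relation
  of $u$ says $pr=q\,rp$, and the prescribed value of $H_\mu$ at $u(\lambda)$ is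
  $p\,v(\mu)u(\lambda)-\mu^{-1}r(1+v(\mu)u(\mu))$. As $m$ also $q$-commutes with $p$ and $r$, these can be
  moved through the inverse of $1+\mu^{-1}um$, and this gives the linearized relations that the values
  at $u$ and $m$ have to satisfy; the universal property of the quotient, applied to dual numbers over
  the algebra, then produces the derivations. The relation of $m$ is the one of $u$ in the opposite ring.

  The flow of $u$, and of $\lambda^{-1}m$, at the parameter $\mu$ is a Riccati equation in which the
  coefficients are the entries of an idempotent $2\times2$ matrix built from $u(\mu)$ and $m(\mu)$. The
  flows move these entries in turn by a Lax equation, so that the flows commute by a zero curvature
  computation, which is an identity in any ring.

  At $q=1$ the idempotent is $x^{-1}\,\mathrm{diag}(1,0)\,x$. The factorization of
  $\exp(\varepsilon h_k)x$ into an element of $B_-$ and one of $N_+$ splits $\lambda^k$ times this matrix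
  into its polynomial part and the rest, and leads to the same Riccati equation.
\<close>


section \<open>Exchange relations in an arbitrary ring\<close>

text \<open>The obstacle is the inverse hidden in \<open>v\<close>. A letter carried across
  \<open>(1 + z u m)^-1\<close>, with \<open>z\<close> the inverse of mu, changes the weights of the
  letters inside and produces the inverse of another factor; the exchange lemmas say that different
  ways of doing this meet. The new factors differ from 1 by a multiple of \<open>z\<close> and are
  invertible. Clearing the denominator \<open>x - y\<close> leads instead to \<open>x - y\<close>
  plus a multiple of \<open>z\<close>, which is only cancellable, by induction on the power of
  \<open>z\<close>. The idempotent is the column \<open>(1, -u)\<close> times \<open>K\<close> times
  the row \<open>(1, -z m)\<close>, where \<open>K\<close> inverts the product
  \<open>1 + z m u\<close> of the row and the column. A value of one flow contains \<open>u\<close>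
  and \<open>m\<close> at its own parameter, and the other flow acts on these too. So both flows are
  extended to one ring of series in three variables before they are compared. The factor 1/2 comes
  from \<open>diag(1, -1) = 2 diag(1, 0) - 1\<close>.\<close>

definition central :: "'a::ring_1 \<Rightarrow> bool" where
  "central c \<longleftrightarrow> (\<forall>w. c * w = w * c)"

lemma central_swap: "central c \<Longrightarrow> w * c = c * w"
  and central_left_swap: "central c \<Longrightarrow> w * (c * v) = c * (w * v)"
  unfolding central_def by (metis mult.assoc)+

lemma central_closed:
  "central a \<Longrightarrow> central b \<Longrightarrow> central (a + b)"
  "central a \<Longrightarrow> central b \<Longrightarrow> central (a - b)"
  "central a \<Longrightarrow> central b \<Longrightarrow> central (a * b)"
  "central a \<Longrightarrow> central (- a)"
proof -
  show "central (a + b)" "central (a - b)" "central (a * b)" if "central a" "central b"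
    using that unfolding central_def
    by (metis distrib_left distrib_right, metis left_diff_distrib right_diff_distrib, metis mult.assoc)
  show "central a \<Longrightarrow> central (- a)"
    unfolding central_def by (metis mult_minus_left mult_minus_right)
qed

lemma central_inverse: "central q \<Longrightarrow> q * qi = 1 \<Longrightarrow> qi * q = 1 \<Longrightarrow> central qi"
  unfolding central_def by (metis mult.assoc mult_1_left mult_1_right)

lemma sign_cancel: "(- 1) ^ i * ((- 1) ^ i * w) = (w :: 'a::ring_1)"
  by (simp add: mult.assoc[symmetric] power_add[symmetric])

lemma left_extend: "a * b = c \<Longrightarrow> a * (b * w) = c * (w :: 'a::ring_1)"
  by (metis mult.assoc)

text \<open>Carrying \<open>r\<close> to the left across \<open>1 + U * m\<close> and
  \<open>p\<close> to the left across \<open>1 + m * U\<close> turns both into the same factor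
  \<open>1 + q * ((q * p - s) * m)\<close>, with inverse \<open>E\<close>. This reduces the last
  equation to \<open>p * r = q * (r * p)\<close>.\<close>

lemma one_point_exchange:
  fixes q p r s m :: "'a::ring_1"
  assumes q: "central q"
    and pr: "p * r = q * (r * p)" and ps: "p * s = q * (s * p)" and sr: "s * r = r * s"
    and mp: "m * p = q * (p * m)" and mr: "m * r = q * (r * m)" and ms: "m * s = q * (s * m)"
  defines "U \<equiv> p - s"
  assumes Q: "Q * (1 + U * m) = 1" and Q': "Q' * (1 + m * U) = 1"
    and E: "(1 + q * ((q * p - s) * m)) * E = 1"
  shows "Q * r = r * E" "Q' * p = p * E" "q * (r * Q' * p) = p * Q * r"
proof -
  let ?E = "1 + q * ((q * p - s) * m)"
  note rel = pr ps sr mp mr ms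
  note rules = rel rel[THEN left_extend] central_swap[OF q, of p] central_left_swap[OF q, of p]
     central_swap[OF q, of r] central_left_swap[OF q, of r]
     central_swap[OF q, of s] central_left_swap[OF q, of s]
     central_swap[OF q, of m] central_left_swap[OF q, of m]
  have "(1 + U * m) * r = r * ?E" unfolding U_def by (simp add: algebra_simps rules)
  then have "Q * r * (?E * E) = Q * (1 + U * m) * r * E"
    by (metis Q Q' E mult.assoc mult_1_left mult_1_right)
  then show 1: "Q * r = r * E" using Q E by simp
  have "(1 + m * U) * p = p * ?E" unfolding U_def by (simp add: algebra_simps rules)
  then have "Q' * p * (?E * E) = Q' * (1 + m * U) * p * E"
    by (metis Q Q' E mult.assoc mult_1_left mult_1_right)
  then show 2: "Q' * p = p * E" using Q' E by simp
  show "q * (r * Q' * p) = p * Q * r" using 1 2 pr by (metis mult.assoc)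
qed

text \<open>Abstracts the series divisible by the parameter of the flow: in effect a two-sided ideal
  inside the Jacobson radical. It guarantees that the factors with changed weights are again
  invertible.\<close>

definition small_ideal :: "'a::ring_1 set \<Rightarrow> bool" where
  "small_ideal J \<longleftrightarrow>
     (\<forall>v\<in>J. \<forall>w\<in>J. v + w \<in> J) \<and> (\<forall>v\<in>J. \<forall>w. v * w \<in> J \<and> w * v \<in> J) \<and>
     (\<forall>v\<in>J. \<exists>w. (1 + v) * w = 1 \<and> w * (1 + v) = 1)"

lemma small_ideal_closed:
  assumes "small_ideal J"
  shows "v \<in> J \<Longrightarrow> w \<in> J \<Longrightarrow> v + w \<in> J" "v \<in> J \<Longrightarrow> v * w \<in> J" "v \<in> J \<Longrightarrow> w * v \<in> J"
    "v \<in> J \<Longrightarrow> - v \<in> J" "v \<in> J \<Longrightarrow> w \<in> J \<Longrightarrow> v - w \<in> J"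
proof -
  show 1: "v \<in> J \<Longrightarrow> w \<in> J \<Longrightarrow> v + w \<in> J" "v \<in> J \<Longrightarrow> v * w \<in> J" "v \<in> J \<Longrightarrow> w * v \<in> J" for v w
    using assms unfolding small_ideal_def by blast+
  show 2: "v \<in> J \<Longrightarrow> - v \<in> J" for v using 1(2)[of v "- 1"] by simp
  show "v \<in> J \<Longrightarrow> w \<in> J \<Longrightarrow> v - w \<in> J" using 1(1)[of v "- w"] 2[of w] by simp
qed

lemma small_ideal_inverse:
  assumes "small_ideal J" "v \<in> J"
  obtains w where "(1 + v) * w = 1" "w * (1 + v) = 1"
  using assms unfolding small_ideal_def by blast

lemma inverse_intertwine:
  assumes "k * r = r * e" "k' * k = 1" "e * e' = (1::'a::ring_1)"
  shows "k' * r = r * e'"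
  by (metis assms mult.assoc mult_1_left mult_1_right)

text \<open>Carrying \<open>r * b\<close> past all inverses leaves \<open>key\<close>, an identity
  between inverses at shifted weights. Its two differences are evaluated by resolvent identities,
  and they agree because two products of factors coincide although the factors do not.\<close>

lemma two_sided_exchange:
  fixes q p r s a b t :: "'a::ring_1"
  assumes q: "central q" and qi: "q * qi = 1" "qi * q = 1"
    and pr: "p * r = q * (r * p)" and ps: "p * s = q * (s * p)" and sr: "s * r = r * s"
    and ba: "b * a = q * (a * b)" and ta: "t * a = q * (a * t)" and tb: "t * b = b * t"
    and X: "a * p = q * (p * a)" "a * r = q * (r * a)" "a * s = q * (s * a)"
      "b * p = q * (p * b)" "b * r = q * (r * b)" "b * s = q * (s * b)"
      "t * p = q * (p * t)" "t * r = q * (r * t)" "t * s = q * (s * t)"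
    and J: "small_ideal J" "a \<in> J" "t \<in> J"
  defines "U \<equiv> p - s" and "m \<equiv> a - t"
  assumes Q: "(1 + U * m) * Q = 1" "Q * (1 + U * m) = 1"
    and Q': "(1 + m * U) * Q' = 1" "Q' * (1 + m * U) = 1"
  shows "p * Q' * m * r * b + a * Q * U * r * b = r * b * (m * Q * p + U * Q' * a)"
proof -
  have cqi: "central qi" by (rule central_inverse[OF q qi])
  note swap = central_swap central_left_swap
  note rel = pr ps sr ba ta tb X
  have qq: "q * (qi * w) = w" "qi * (q * w) = w" for w by (metis qi mult.assoc mult_1_left)+
  note rules = rel rel[THEN left_extend] qi qq swap[OF q, of p] swap[OF q, of r] swap[OF q, of s]
    swap[OF q, of a] swap[OF q, of b] swap[OF q, of t]
    swap[OF cqi, of p] swap[OF cqi, of r] swap[OF cqi, of s]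
    swap[OF cqi, of a] swap[OF cqi, of b] swap[OF cqi, of t]
  \<comment> \<open>\<open>U * (r * b) = r * b * (qi * P)\<close> and
    \<open>m * (r * b) = r * b * (q * T)\<close>. The scalars cancel in \<open>U * m\<close> and
    \<open>m * U\<close>, so \<open>Q\<close> becomes \<open>G\<close> and \<open>Q'\<close> becomes
    \<open>G'\<close>.\<close>
  define P where "P = q * p - s"
  define T where "T = qi * a - t"
  have mJ: "m \<in> J" "T \<in> J" unfolding m_def T_def by (intro small_ideal_closed[OF J(1)] J)+
  obtain G where G: "(1 + P * T) * G = 1" "G * (1 + P * T) = 1"
    by (rule small_ideal_inverse[OF J(1), of "P * T"]) (auto intro: small_ideal_closed[OF J(1)] mJ)
  obtain G' where G': "(1 + T * P) * G' = 1" "G' * (1 + T * P) = 1"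
    by (rule small_ideal_inverse[OF J(1), of "T * P"]) (auto intro: small_ideal_closed[OF J(1)] mJ)
  obtain E where E: "(1 + P * m) * E = 1" "E * (1 + P * m) = 1"
    by (rule small_ideal_inverse[OF J(1), of "P * m"]) (auto intro: small_ideal_closed[OF J(1)] mJ)
  obtain H where H: "(1 + T * U) * H = 1" "H * (1 + T * U) = 1"
    by (rule small_ideal_inverse[OF J(1), of "T * U"]) (auto intro: small_ideal_closed[OF J(1)] mJ)
  obtain Ga where Ga: "(1 + P * (qi * a - q * t)) * Ga = 1" "Ga * (1 + P * (qi * a - q * t)) = 1"
    by (rule small_ideal_inverse[OF J(1), of "P * (qi * a - q * t)"]) (auto intro!: small_ideal_closed[OF J(1)] J)
  obtain Gp where Gp: "(1 + (q * (q * p) - s) * T) * Gp = 1" "Gp * (1 + (q * (q * p) - s) * T) = 1"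
    by (rule small_ideal_inverse[OF J(1), of "(q * (q * p) - s) * T"]) (auto intro!: small_ideal_closed[OF J(1)] mJ)
  have Qrb: "Q * (r * b) = r * b * G"
    by (rule inverse_intertwine[OF _ Q(2) G(1)])
      (simp add: U_def m_def P_def T_def algebra_simps rules)
  have Q'rb: "Q' * (r * b) = r * b * G'"
    by (rule inverse_intertwine[OF _ Q'(2) G'(1)])
      (simp add: U_def m_def P_def T_def algebra_simps rules)
  have Qp: "Q * p = p * E"
    by (rule inverse_intertwine[OF _ Q(2) E(1)])
      (simp add: U_def m_def P_def T_def algebra_simps rules)
  have Q'a: "Q' * a = a * H"
    by (rule inverse_intertwine[OF _ Q'(2) H(1)])
      (simp add: U_def m_def P_def T_def algebra_simps rules)
  have G'a: "G' * a = a * Ga"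
    by (rule inverse_intertwine[OF _ G'(2) Ga(1)])
      (simp add: U_def m_def P_def T_def algebra_simps rules)
  have Gp': "G * p = p * Gp"
    by (rule inverse_intertwine[OF _ G(2) Gp(1)])
      (simp add: U_def m_def P_def T_def algebra_simps rules)
  have Q'm: "Q' * m = m * Q" by (rule inverse_intertwine[OF _ Q'(2) Q(1)]) (simp add: algebra_simps)
  have QU: "Q * U = U * Q'" by (rule inverse_intertwine[OF _ Q(2) Q'(1)]) (simp add: algebra_simps)
  have TG: "G' * T = T * G" by (rule inverse_intertwine[OF _ G'(2) G(1)]) (simp add: algebra_simps)
  have PG: "G * P = P * G'" by (rule inverse_intertwine[OF _ G(2) G'(1)]) (simp add: algebra_simps)
  \<comment> \<open>The weights can be redistributed between the two factors. The left product is
    inverted by \<open>Ga * E\<close>, the right one by \<open>Gp * H\<close>.\<close>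
  have EH: "(1 + P * m) * (1 + P * (qi * a - q * t)) = (1 + T * U) * (1 + (q * (q * p) - s) * T)"
    by (simp add: U_def m_def P_def T_def algebra_simps rules)
  have GaE: "Ga * E = Gp * H"
  proof -
    have "Ga * E * ((1 + P * m) * (1 + P * (qi * a - q * t))) = 1"
      by (metis E(2) Ga(2) mult.assoc mult_1_left)
    then have "Ga * E * (1 + T * U) * (1 + (q * (q * p) - s) * T) * Gp * H = Gp * H"
      using EH by (simp add: mult.assoc)
    then show ?thesis by (metis Gp(1) H(1) mult.assoc mult_1_right)
  qed
  \<comment> \<open>As \<open>T * G = G' * T\<close>, the difference is
    \<open>G' * (T - m) * E\<close>, and \<open>T - m = (qi - 1) * a\<close>. In \<open>m2\<close>
    the same is done with \<open>U - P = (1 - q) * p\<close>.\<close>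
  have m1: "T * G - m * E = (qi - 1) * (G' * a * E)"
  proof -
    have "T * G - m * E = G' * (T * (1 + P * m) - (1 + T * P) * m) * E"
      using E(1) G'(2) TG by (simp add: left_diff_distrib right_diff_distrib mult.assoc)
        (metis mult.assoc mult_1_left)
    also have "T * (1 + P * m) - (1 + T * P) * m = (qi - 1) * a"
      by (simp add: U_def m_def P_def T_def algebra_simps rules)
    finally show ?thesis by (simp add: algebra_simps central_swap[OF cqi] central_left_swap[OF cqi])
  qed
  have m2: "U * H - P * G' = (1 - q) * (G * p * H)"
  proof -
    have "U * H - P * G' = G * ((1 + P * T) * U - P * (1 + T * U)) * H"
      using H(1) G(2) PG by (simp add: left_diff_distrib right_diff_distrib mult.assoc)
        (metis mult.assoc mult_1_left)
    also have "(1 + P * T) * U - P * (1 + T * U) = (1 - q) * p"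
      by (simp add: U_def m_def P_def T_def algebra_simps rules)
    finally show ?thesis by (simp add: algebra_simps central_swap[OF q] central_left_swap[OF q])
  qed
  have "q * (p * (T * G - m * E)) = (1 - q) * (p * a * Ga * E)"
    unfolding m1 G'a by (simp add: algebra_simps rules)
  also have "\<dots> = (1 - q) * (p * a * Gp * H)" using GaE by (simp add: mult.assoc)
  also have "\<dots> = qi * (a * (U * H - P * G'))"
    unfolding m2 Gp' by (simp add: algebra_simps rules)
  finally have key: "q * (p * (T * G)) + qi * (a * (P * G')) = q * (p * (m * E)) + qi * (a * (U * H))"
    by (simp add: algebra_simps)
  have "p * Q' * m * r * b = p * m * (Q * (r * b))" using Q'm by (metis mult.assoc)
  also have "\<dots> = r * b * (q * (p * (T * G)))"
    unfolding Qrb by (simp add: m_def T_def algebra_simps rules)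
  finally have l1: "p * Q' * m * r * b = r * b * (q * (p * (T * G)))" .
  have "a * Q * U * r * b = a * U * (Q' * (r * b))" using QU by (metis mult.assoc)
  also have "\<dots> = r * b * (qi * (a * (P * G')))"
    unfolding Q'rb by (simp add: U_def P_def algebra_simps rules)
  finally have l2: "a * Q * U * r * b = r * b * (qi * (a * (P * G')))" .
  have l3: "m * Q * p = q * (p * (m * E))"
    unfolding mult.assoc Qp by (simp add: m_def algebra_simps rules)
  have l4: "U * Q' * a = qi * (a * (U * H))"
    unfolding mult.assoc Q'a by (simp add: U_def algebra_simps rules)
  show ?thesis unfolding l1 l2 l3 l4 distrib_left[symmetric] key ..
qed

section \<open>The opposite ring and the exchange identities with one family of increments\<close>

datatype 'a opp = Opp (unopp: 'a)

instantiation opp :: (ring_1) ring_1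
begin
definition "0 = Opp 0"
definition "1 = Opp 1"
definition "a + b = Opp (unopp a + unopp b)"
definition "a - b = Opp (unopp a - unopp b)"
definition "- a = Opp (- unopp a)"
definition "a * b = Opp (unopp b * unopp a)"
instance
  by standard
    (simp_all add: zero_opp_def one_opp_def plus_opp_def minus_opp_def uminus_opp_def
      times_opp_def algebra_simps)
end

lemmas opp_defs = zero_opp_def one_opp_def plus_opp_def minus_opp_def uminus_opp_def times_opp_def

lemma central_Opp: "central q \<Longrightarrow> central (Opp q)"
  unfolding central_def by (metis opp.collapse times_opp_def opp.sel)

lemma small_ideal_Opp:
  assumes "small_ideal J"
  shows "small_ideal (Opp ` J)"
  using assms unfolding small_ideal_def opp_defs
  by (simp add: image_iff) (metis opp.collapse opp.sel)

text \<open>By resolvent identities both parts are multiples of \<open>q - 1\<close>, and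
  \<open>main\<close> identifies the remaining factors. Smallness is asked only of products with
  \<open>m\<close>, since in the opposite ring the small letters are those in the roles of
  \<open>p\<close> and \<open>s\<close>.\<close>

lemma one_sided_exchange:
  fixes q p r s m :: "'a::ring_1"
  assumes q: "central q" and qi: "q * qi = 1" "qi * q = 1"
    and pr: "p * r = q * (r * p)" and ps: "p * s = q * (s * p)" and sr: "s * r = r * s"
    and X: "m * p = q * (p * m)" "m * r = q * (r * m)" "m * s = q * (s * m)"
    and J: "small_ideal J" "p * m \<in> J" "s * m \<in> J"
  defines "U \<equiv> p - s"
  assumes Q: "(1 + U * m) * Q = 1" "Q * (1 + U * m) = 1"
    and Q': "(1 + m * U) * Q' = 1" "Q' * (1 + m * U) = 1"
  shows "r * m * Q' - Q * r * m + s * m * (qi * Q * m - m * Q) * r = 0"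
proof -
  have cqi: "central qi" by (rule central_inverse[OF q qi])
  note swap = central_swap central_left_swap
  note rel = pr ps sr X
  have qq: "q * (qi * w) = w" "qi * (q * w) = w" for w by (metis qi mult.assoc mult_1_left)+
  note rules = rel rel[THEN left_extend] qi qq swap[OF q, of p] swap[OF q, of r] swap[OF q, of s]
    swap[OF q, of m] swap[OF cqi, of p] swap[OF cqi, of r] swap[OF cqi, of s] swap[OF cqi, of m]
  have Jm: "(q * p - s) * m \<in> J" "(q * (q * p) - s) * m \<in> J"
    using J by (auto simp: left_diff_distrib mult.assoc intro!: small_ideal_closed[OF J(1)])
  obtain E where E: "(1 + q * ((q * p - s) * m)) * E = 1"
    by (rule small_ideal_inverse[OF J(1), of "q * ((q * p - s) * m)"])
      (auto intro: small_ideal_closed[OF J(1)] Jm)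
  obtain E2 where E2: "(1 + q * (q * ((q * (q * p) - s) * m))) * E2 = 1"
    by (rule small_ideal_inverse[OF J(1), of "q * (q * ((q * (q * p) - s) * m))"])
      (auto intro: small_ideal_closed[OF J(1)] Jm)
  obtain G where G: "(1 + q * ((q * (q * p) - s) * m)) * G = 1" "G * (1 + q * ((q * (q * p) - s) * m)) = 1"
    by (rule small_ideal_inverse[OF J(1), of "q * ((q * (q * p) - s) * m)"])
      (auto intro: small_ideal_closed[OF J(1)] Jm)
  obtain E'' where "E'' * (1 + q * ((q * p - s) * m)) = 1"
    by (rule small_ideal_inverse[OF J(1), of "q * ((q * p - s) * m)"])
      (auto intro: small_ideal_closed[OF J(1)] Jm)
  then have E': "E * (1 + q * ((q * p - s) * m)) = 1" using E by (metis mult.assoc mult_1_left mult_1_right)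
  obtain E2'' where "E2'' * (1 + q * (q * ((q * (q * p) - s) * m))) = 1"
    by (rule small_ideal_inverse[OF J(1), of "q * (q * ((q * (q * p) - s) * m))"])
      (auto intro: small_ideal_closed[OF J(1)] Jm)
  then have E2': "E2 * (1 + q * (q * ((q * (q * p) - s) * m))) = 1"
    using E2 by (metis mult.assoc mult_1_left mult_1_right)
  have Qr: "Q * r = r * E" and Q'p: "Q' * p = p * E"
    using one_point_exchange[OF q pr ps sr X, of Q Q' E] Q Q' E unfolding U_def by auto
  have Es: "E * s = s * E2"
    by (rule inverse_intertwine[OF _ E' E2]) (simp add: algebra_simps rules)
  have E2m: "E2 * m = m * G"
    by (rule inverse_intertwine[OF _ E2' G(1)]) (simp add: algebra_simps rules)
  have e1: "(1 + q * ((q * (q * p) - s) * m)) * E = 1 + (q - 1) * (q * (q * (p * (m * E))))"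
  proof -
    have "(1 + q * ((q * (q * p) - s) * m)) * E
        = (1 + q * ((q * p - s) * m)) * E + (q - 1) * (q * (q * (p * (m * E))))"
      by (simp add: algebra_simps rules)
    then show ?thesis using E by simp
  qed
  have e2: "Q' * (1 + q * ((q * p - s) * m)) = 1 + (q - 1) * (q * (p * (E * m)))"
  proof -
    have "Q' * (1 + q * ((q * p - s) * m)) = Q' * (1 + m * U) + (q - 1) * (q * (Q' * p * m))"
      by (simp add: U_def algebra_simps rules swap[OF q, of Q'])
    then show ?thesis using Q'(2) Q'p by (simp add: mult.assoc)
  qed
  \<comment> \<open>\<open>e1\<close> times \<open>m\<close> and \<open>m\<close> times
    \<open>e2\<close> have the same correction term because \<open>m * p = q * (p * m)\<close>. This
    trades the inverse \<open>E\<close> on the right for \<open>Q'\<close>.\<close>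
  have "(1 + q * ((q * (q * p) - s) * m)) * E * m = m * Q' * (1 + q * ((q * p - s) * m))"
    unfolding e1 mult.assoc[of m] e2 by (simp add: algebra_simps rules)
  then have "G * ((1 + q * ((q * (q * p) - s) * m)) * E * m) * E
      = G * (m * Q' * (1 + q * ((q * p - s) * m))) * E" by simp
  then have EmE: "E * m * E = G * m * Q'"
    using E G(2) by (metis mult.assoc mult_1_left mult_1_right)
  have "s * m * Q * m * Q * r = q * (q * (s * r * m * (E * m * E)))"
  proof -
    have "s * m * Q * m * Q * r = s * m * Q * (m * r) * E" by (simp add: mult.assoc Qr)
    also have "\<dots> = q * (s * m * (Q * r) * m * E)"
      by (simp add: rules mult.assoc swap[OF q, of Q])
    also have "\<dots> = q * (q * (s * r * m * (E * m * E)))"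
      unfolding Qr by (simp add: rules mult.assoc)
    finally show ?thesis .
  qed
  also have "\<dots> = q * (q * (s * r * (E2 * m) * m * Q'))"
    unfolding EmE E2m by (simp add: mult.assoc)
  also have "\<dots> = q * (q * (Q * s * r * m * m * Q'))"
  proof -
    have "Q * s * r = s * r * E2" using Qr Es sr by (metis mult.assoc)
    then show ?thesis by (simp add: mult.assoc)
  qed
  finally have main: "s * m * Q * m * Q * r = q * (q * (Q * s * r * m * m * Q'))" .
  have "r * m * Q' - Q * r * m = Q * ((1 + U * m) * (r * m) - r * m * (1 + m * U)) * Q'"
    using Q(2) Q'(1) by (simp add: left_diff_distrib right_diff_distrib mult.assoc)
      (metis mult.assoc mult_1_left)
  also have "(1 + U * m) * (r * m) - r * m * (1 + m * U) = (q - 1) * (q * (s * r * m * m))"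
    by (simp add: U_def algebra_simps rules)
  finally have a: "r * m * Q' - Q * r * m = (q - 1) * (q * (Q * s * r * m * m * Q'))"
    by (simp add: algebra_simps rules swap[OF q, of Q])
  have "qi * Q * m - m * Q = Q * (qi * (m * (1 + U * m)) - (1 + U * m) * m) * Q"
    using Q by (simp add: left_diff_distrib right_diff_distrib mult.assoc swap[OF cqi, of Q])
      (metis mult.assoc mult_1_left mult_1_right)
  also have "qi * (m * (1 + U * m)) - (1 + U * m) * m = (qi - 1) * m"
    by (simp add: U_def algebra_simps rules)
  finally have b: "qi * Q * m - m * Q = (qi - 1) * (Q * m * Q)"
    by (simp add: algebra_simps swap[OF cqi, of Q])
  have "s * m * (qi * Q * m - m * Q) * r = (qi - 1) * (s * m * Q * m * Q * r)"
    unfolding b by (simp add: algebra_simps rules)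
  then show ?thesis unfolding main a by (simp add: algebra_simps rules)
qed

text \<open>In the opposite ring \<open>a\<close>, \<open>b\<close>, \<open>t\<close>,
  \<open>U\<close> take the roles of \<open>p\<close>, \<open>r\<close>, \<open>s\<close>,
  \<open>m\<close>.\<close>

lemma one_sided_exchange_mirror:
  fixes q a b t U :: "'a::ring_1"
  assumes q: "central q" and qi: "q * qi = 1" "qi * q = 1"
    and ba: "b * a = q * (a * b)" and ta: "t * a = q * (a * t)" and tb: "t * b = b * t"
    and X: "a * U = q * (U * a)" "b * U = q * (U * b)" "t * U = q * (U * t)"
    and J: "small_ideal J" "a \<in> J" "t \<in> J"
  defines "m \<equiv> a - t"
  assumes Q: "(1 + U * m) * Q = 1" "Q * (1 + U * m) = 1"
    and Q': "(1 + m * U) * Q' = 1" "Q' * (1 + m * U) = 1"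
  shows "Q' * U * b - U * b * Q + b * (U * Q * qi - Q * U) * U * t = 0"
proof -
  have swap: "q * w = w * q" for w using q by (simp add: central_def)
  have "Opp b * Opp U * Opp Q' - Opp Q * Opp b * Opp U
      + Opp t * Opp U * (Opp qi * Opp Q * Opp U - Opp U * Opp Q) * Opp b = 0"
    by (rule one_sided_exchange[where q = "Opp q" and p = "Opp a" and J = "Opp ` J"])
      (use assms central_Opp[OF q] small_ideal_Opp[OF J(1)] in
        \<open>auto simp: opp_defs swap mult.assoc intro: small_ideal_closed[OF J(1)]\<close>)
  then show ?thesis by (simp add: opp_defs mult.assoc)
qed

section \<open>The linearized relations\<close>

text \<open>
  In this and the next two lemmas \<open>x\<close> and \<open>y\<close> stand for the inverse variables of the relation and \<open>z\<close> for
  that of the flow; \<open>U\<close> and \<open>m\<close> are the values of the two series at \<open>z\<close> (with the factor \<open>z\<close> in \<open>m\<close>),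
  and \<open>r\<close>, \<open>r1\<close>, \<open>r2\<close>, \<open>b\<close> are their difference quotients.
\<close>

lemma mixed_relation_preserved:
  fixes q x y z r b :: "'a::ring_1"
  assumes c: "central q" "central x" "central y" "central z"
    and qi: "q * qi = 1" "qi * q = 1"
    and J: "small_ideal J" "m \<in> J" "b \<in> J"
    and X: "m * U = q * (U * m)" "m * r = q * (r * m)" "b * U = q * (U * b)" "b * r = q * (r * b)"
  defines "p \<equiv> U + x * r" and "a \<equiv> m + y * b"
  assumes pr: "p * r = q * (r * p)" and ba: "b * a = q * (a * b)"
    and Q: "(1 + U * m) * Q = 1" "Q * (1 + U * m) = 1"
    and Q': "(1 + m * U) * Q' = 1" "Q' * (1 + m * U) = 1"
  defines "dX \<equiv> p * m * Q * (p - z * r) + z * r * Q'"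
    and "dY \<equiv> - ((a - z * b) * U * Q' * a + z * Q' * b)"
  shows "dX * (a - z * b) + (p - z * r) * dY = qi * (dY * (p - z * r) + (a - z * b) * dX)"
proof -
  note q = c(1)
  have cqi: "central qi" by (rule central_inverse[OF q qi])
  note swap = central_swap central_left_swap
  have qq: "q * (qi * w) = w" "qi * (q * w) = w" for w by (metis qi mult.assoc mult_1_left)+
  \<comment> \<open>The two series at \<open>x\<close> and \<open>y\<close> are \<open>U + v\<close>
    and \<open>m + w\<close>; the increments from \<open>z\<close> are
    \<open>v = (x - z) * r\<close> and \<open>w = (y - z) * b\<close>.\<close>
  define s where "s = x * r"
  define t where "t = y * b"
  define v where "v = s - z * r"
  define w where "w = t - z * b"
  have v: "p - z * r = U + v" and zr: "z * r = s - v" unfolding v_def p_def s_def by simp_all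
  have w: "a - z * b = m + w" and zb: "z * b = t - w" unfolding w_def a_def t_def by simp_all
  have p: "p = U + s" and a: "a = m + t" by (simp_all add: p_def s_def a_def t_def)
  note cc = swap[OF c(1), of x] swap[OF c(1), of y] swap[OF c(1), of z]
    swap[OF c(2), of y] swap[OF c(2), of z] swap[OF c(2), of U] swap[OF c(2), of m]
    swap[OF c(3), of z] swap[OF c(3), of U] swap[OF c(3), of m]
    swap[OF c(4), of U] swap[OF c(4), of m]
    swap[OF c(2), of r] swap[OF c(2), of b] swap[OF c(3), of r] swap[OF c(3), of b]
    swap[OF c(4), of r] swap[OF c(4), of b]
    swap[OF c(2), of Q] swap[OF c(2), of Q'] swap[OF c(3), of Q] swap[OF c(3), of Q']
    swap[OF c(4), of Q] swap[OF c(4), of Q']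
  have XX: "m * U = q * (U * m)" "m * s = q * (s * m)" "m * v = q * (v * m)" "m * r = q * (r * m)"
    "t * U = q * (U * t)" "t * s = q * (s * t)" "t * v = q * (v * t)" "t * r = q * (r * t)"
    "w * U = q * (U * w)" "w * s = q * (s * w)" "w * v = q * (v * w)" "w * r = q * (r * w)"
    "b * U = q * (U * b)" "b * s = q * (s * b)" "b * v = q * (v * b)" "b * r = q * (r * b)"
    unfolding s_def t_def v_def w_def by (simp_all add: algebra_simps cc X X[THEN left_extend])
  have J': "t \<in> J" "w \<in> J" "a \<in> J"
    unfolding w_def t_def a_def by (intro small_ideal_closed[OF J(1)] J)+
  have UmQ: "U * m * Q = 1 - Q" using Q(1) by (simp add: algebra_simps)
  have mUQ': "m * U * Q' = 1 - Q'" using Q'(1) by (simp add: algebra_simps)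
  have Q'm: "Q' * m = m * Q" by (rule inverse_intertwine[OF _ Q'(2) Q(1)]) (simp add: algebra_simps)
  have QU: "Q * U = U * Q'" by (rule inverse_intertwine[OF _ Q(2) Q'(1)]) (simp add: algebra_simps)
  have dX: "dX = U + v + s - Q * (U + v) - v * Q' + s * m * Q * v"
  proof -
    have "dX = U * m * Q * (U + v) + s * (m * (Q * U)) + s * m * Q * v + (s - v) * Q'"
      unfolding dX_def v zr unfolding p by (simp add: algebra_simps)
    also have "m * (Q * U) = 1 - Q'" using QU mUQ' by (simp add: mult.assoc)
    finally show ?thesis unfolding UmQ by (simp add: algebra_simps)
  qed
  have dY: "dY = - (m + w + t - (m + w) * Q - Q' * w + w * U * Q' * t)"
  proof -
    have "z * Q' * b = Q' * (t - w)" unfolding zb[symmetric] by (simp add: mult.assoc swap[OF c(4), of Q'])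
    then have "dY = - ((m + w) * (U * (Q' * m)) + m * U * Q' * t + w * U * Q' * t + Q' * (t - w))"
      unfolding dY_def w unfolding a by (simp add: algebra_simps)
    also have "U * (Q' * m) = 1 - Q" using Q'm UmQ by (simp add: mult.assoc)
    finally show ?thesis unfolding mUQ' by (simp add: algebra_simps)
  qed
  \<comment> \<open>\<open>s\<close> and \<open>v\<close> are central multiples of the same
    \<open>r\<close>, so they change places around any factor; likewise \<open>t\<close> and
    \<open>w\<close>, which are multiples of \<open>b\<close>.\<close>
  have sv: "s * (A * v) = v * (A * s)" for A
    unfolding s_def v_def by (simp add: algebra_simps swap[OF c(2), of A] swap[OF c(4), of A] cc)
  have tw: "t * (A * w) = w * (A * t)" for A
    unfolding t_def w_def by (simp add: algebra_simps swap[OF c(3), of A] swap[OF c(4), of A] cc)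
  have pv: "p * v = q * (v * p)" and ps: "p * s = q * (s * p)" and s_v: "s * v = v * s"
  proof -
    have px: "p * (x * r) = q * (x * (r * p))" "p * (z * r) = q * (z * (r * p))"
      by (metis c pr central_def mult.assoc)+
    show "p * s = q * (s * p)" unfolding s_def px by (simp add: mult.assoc)
    show "p * v = q * (v * p)" unfolding v_def s_def right_diff_distrib px
      by (simp add: left_diff_distrib right_diff_distrib mult.assoc)
    show "s * v = v * s" using sv[of 1] by simp
  qed
  have wa: "w * a = q * (a * w)" and ta: "t * a = q * (a * t)" and t_w: "t * w = w * t"
  proof -
    have ay: "(y * b) * a = q * (a * (y * b))" "(z * b) * a = q * (a * (z * b))"
      by (metis c ba central_def mult.assoc)+
    show "t * a = q * (a * t)" unfolding t_def ay ..
    show "w * a = q * (a * w)" unfolding w_def t_def left_diff_distrib ay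
      by (simp add: right_diff_distrib)
    show "t * w = w * t" using tw[of 1] by simp
  qed
  have U': "p - s = U" "a - t = m" using p a by simp_all
  have mp: "m * p = q * (p * m)" and aU: "a * U = q * (U * a)"
    unfolding p a by (simp_all add: algebra_simps XX)
  note XX' = XX XX[THEN left_extend]
  \<comment> \<open>The defect of the relation splits by the increments it contains:
    \<open>P1\<close> has only \<open>v\<close>, \<open>P2\<close> only \<open>w\<close>,
    \<open>P3'\<close> both. The exchange identities are applied with \<open>v\<close> and
    \<open>w\<close> in the roles of \<open>r\<close> and \<open>b\<close>.\<close>
  have P1: "v * m * Q' - Q * v * m + s * m * (qi * Q * m - m * Q) * v = 0"
    by (rule one_sided_exchange[where p = p and q = q and J = J, unfolded U'])
      (unfold U', (rule q qi pv ps s_v XX mp J Q Q' small_ideal_closed(3)[OF J(1)])+)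
  have P2: "Q' * U * w - U * w * Q + w * (U * Q * qi - Q * U) * U * t = 0"
    by (rule one_sided_exchange_mirror[where a = a and q = q and J = J, unfolded U'])
      (unfold U', (rule q qi wa ta t_w XX aU J J' Q Q')+)
  have P3: "p * Q' * m * v * w + a * Q * U * v * w = v * w * (m * Q * p + U * Q' * a)"
  proof (rule two_sided_exchange[where p = p and a = a and s = s and t = t and q = q and qi = qi and J = J, unfolded U'])
    show "a * p = q * (p * a)" "a * v = q * (v * a)" "a * s = q * (s * a)"
      "w * p = q * (p * w)" "t * p = q * (p * t)"
      unfolding p a by (simp_all add: algebra_simps XX swap[OF q, of U] swap[OF q, of s])
  qed (rule q qi pv ps s_v wa ta t_w XX J J' Q Q')+
  have P3': "s * m * Q * v * w + t * U * Q' * v * w - (Q + Q') * v * w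
      = v * w * m * Q * s + v * w * U * Q' * t - v * w * (Q + Q')"
  proof -
    have 1: "p * Q' * m * v * w = (1 - Q) * v * w + s * m * Q * v * w"
      unfolding p UmQ[symmetric] by (simp add: algebra_simps Q'm Q'm[THEN left_extend])
    have 2: "a * Q * U * v * w = (1 - Q') * v * w + t * U * Q' * v * w"
      unfolding a mUQ'[symmetric] by (simp add: algebra_simps QU QU[THEN left_extend])
    have 3: "m * Q * p = 1 - Q' + m * Q * s"
      unfolding p mUQ'[symmetric] by (simp add: algebra_simps QU)
    have 4: "U * Q' * a = 1 - Q + U * Q' * t"
      unfolding a UmQ[symmetric] by (simp add: algebra_simps Q'm)
    show ?thesis using P3 unfolding 1 2 3 4 by (simp add: algebra_simps)
  qed
  have s1: "s * (w * (m * (Q * v))) = v * (w * (m * (Q * s)))" using sv[of "w * m * Q"] by (simp add: mult.assoc)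
  have t1: "t * (Q' * (v * w)) = w * (Q' * (v * t))" using tw[of "Q' * v"] by (simp add: mult.assoc)
  have "dX * (m + w) + (U + v) * dY - qi * (dY * (U + v) + (m + w) * dX)
      = (v * m * Q' - Q * v * m + s * m * (qi * Q * m - m * Q) * v)
        - (Q' * U * w - U * w * Q + w * (U * Q * qi - Q * U) * U * t)
        + ((s * m * Q * v * w + t * U * Q' * v * w - (Q + Q') * v * w)
           - (v * w * m * Q * s + v * w * U * Q' * t - v * w * (Q + Q')))"
    unfolding dX dY
    by (simp add: algebra_simps XX' qi qq s1 t1 swap[OF cqi, of m] swap[OF cqi, of w]
      swap[OF cqi, of Q] swap[OF cqi, of Q'] swap[OF cqi, of t] swap[OF q, of m] swap[OF q, of w]
      swap[OF q, of Q] swap[OF q, of Q'] swap[OF q, of t] swap[OF q, of U] swap[OF q, of v] swap[OF q, of s]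
      swap[OF cqi, of U] swap[OF cqi, of v] swap[OF cqi, of s] Q'm QU Q'm[THEN left_extend] QU[THEN left_extend])
  then have "dX * (m + w) + (U + v) * dY = qi * (dY * (U + v) + (m + w) * dX)"
    unfolding P1 P2 P3' by simp
  then show ?thesis unfolding v w by simp
qed

lemma exchange_relation_preserved:
  fixes q x y z U r1 r2 m Q Q' :: "'a::ring_1"
  assumes c: "central q" "central x" "central y" "central z"
    and qi: "q * qi = 1" "qi * q = 1"
    and xy: "\<And>w. (x - y) * w = 0 \<Longrightarrow> w = 0" and xz: "\<And>w. (x - z) * w = 0 \<Longrightarrow> w = 0"
    and yz: "\<And>w. (y - z) * w = 0 \<Longrightarrow> w = 0"
    and x0: "\<And>w. x * w = 0 \<Longrightarrow> w = 0" and y0: "\<And>w. y * w = 0 \<Longrightarrow> w = 0"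
    and J: "small_ideal J" "m \<in> J"
    and xyJ: "\<And>v w. v \<in> J \<Longrightarrow> (x - y + v) * w = 0 \<Longrightarrow> w = 0"
  defines "p1 \<equiv> U + x * r1" and "p2 \<equiv> U + y * r2"
  defines "X1 \<equiv> p1 - z * r1" and "X2 \<equiv> p2 - z * r2"
  assumes pr: "p1 * r1 = q * (r1 * p1)" "p2 * r2 = q * (r2 * p2)"
    and X12: "(x * X1 - y * X2) * (X1 - X2) = q * ((X1 - X2) * (x * X1 - y * X2))"
    and m: "m * U = q * (U * m)" "m * r1 = q * (r1 * m)" "m * r2 = q * (r2 * m)"
    and Q: "(1 + U * m) * Q = 1" "Q * (1 + U * m) = 1"
    and Q': "(1 + m * U) * Q' = 1" "Q' * (1 + m * U) = 1"
  defines "d1 \<equiv> p1 * m * Q * X1 + z * r1 * Q'" and "d2 \<equiv> p2 * m * Q * X2 + z * r2 * Q'"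
  shows "(x * d1 - y * d2) * (X1 - X2) + (x * X1 - y * X2) * (d1 - d2)
    = q * ((d1 - d2) * (x * X1 - y * X2) + (X1 - X2) * (x * d1 - y * d2))"
proof -
  note q = c(1)
  have cqi: "central qi" by (rule central_inverse[OF q qi])
  note swap = central_swap central_left_swap
  have qq: "q * (qi * w) = w" "qi * (q * w) = w" for w by (metis qi mult.assoc mult_1_left)+
  note sc = swap[OF c(1), of x] swap[OF c(1), of y] swap[OF c(1), of z] swap[OF c(1), of qi]
    swap[OF cqi, of x] swap[OF cqi, of y] swap[OF cqi, of z]
    swap[OF c(2), of y] swap[OF c(2), of z] swap[OF c(3), of z]
  note scal = swap[OF c(1)] swap[OF c(2)] swap[OF c(3)] swap[OF c(4)] swap[OF cqi]
  \<comment> \<open>Interpolation: \<open>g - c * b\<close> and \<open>b - c * e\<close> are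
    \<open>D * p1\<close> and \<open>D * r1\<close> at \<open>c = y\<close>, \<open>D * p2\<close>
    and \<open>D * r2\<close> at \<open>c = x\<close>, and \<open>x * X1 - y * X2\<close> and
    \<open>X1 - X2\<close> at \<open>c = z\<close>. So three letters replace the data at both
    points.\<close>
  define e where "e = r1 - r2"
  define b where "b = p1 - p2"
  define g where "g = x * p1 - y * p2"
  define D where "D = x - y"
  have cD: "central D" unfolding D_def by (intro central_closed c)
  have b: "b = x * r1 - y * r2" unfolding b_def p1_def p2_def by simp
  note sr1 = scal[of r1] and sr2 = scal[of r2] and sp1 = scal[of p1]
    and sp2 = scal[of p2] and sm = scal[of m] and sQ = scal[of Q] and sQ' = scal[of Q']
    and sg = scal[of g] and sb = scal[of b] and se = scal[of e]
  have X: "X1 - X2 = b - z * e" "x * X1 - y * X2 = g - z * b"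
    unfolding X1_def X2_def b e_def g_def
    by (simp_all add: algebra_simps sc p1_def p2_def)
  have Dp: "D * p1 = g - y * b" "D * p2 = g - x * b"
    unfolding D_def g_def b_def by (simp_all add: algebra_simps sc)
  have Dr: "D * r1 = b - y * e" "D * r2 = b - x * e"
    unfolding D_def b e_def by (simp_all add: algebra_simps sc)
  have DU: "D * U = g - (x + y) * b + x * (y * e)"
  proof -
    have "D * U = D * p1 - x * (D * r1)" unfolding p1_def D_def by (simp add: algebra_simps sc)
    then show ?thesis unfolding Dp Dr by (simp add: algebra_simps sc)
  qed
  \<comment> \<open>The three relations at \<open>x\<close>, \<open>y\<close>, \<open>z\<close> are the values of one quadratic polynomial at three points.\<close>
  have "g * b = q * (b * g) \<and> b * e = q * (e * b) \<and> g * e = q * (e * g) + (q - 1) * (b * b)"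
  proof -
    define A where "A = g * b - q * (b * g)"
    define B where "B = g * e - q * (e * g) - (q - 1) * (b * b)"
    define C where "C = b * e - q * (e * b)"
    have "D * p1 * (D * r1) - q * (D * r1 * (D * p1)) = D * (D * (p1 * r1 - q * (r1 * p1)))"
      by (simp add: algebra_simps swap[OF cD, of r1] swap[OF cD, of p1] swap[OF q, of D])
    then have 1: "A - y * B + y * (y * C) = 0"
      unfolding Dp Dr using pr(1) unfolding A_def B_def C_def
      by (simp add: algebra_simps sc sg sb se)
    have "D * p2 * (D * r2) - q * (D * r2 * (D * p2)) = D * (D * (p2 * r2 - q * (r2 * p2)))"
      by (simp add: algebra_simps swap[OF cD, of r2] swap[OF cD, of p2] swap[OF q, of D])
    then have 2: "A - x * B + x * (x * C) = 0"
      unfolding Dp Dr using pr(2) unfolding A_def B_def C_def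
      by (simp add: algebra_simps sc sg sb se)
    have 3: "A - z * B + z * (z * C) = 0"
      using X12 unfolding X A_def B_def C_def by (simp add: algebra_simps sc sg sb se)
    have "(x - y) * (B - (x + y) * C) = (A - y * B + y * (y * C)) - (A - x * B + x * (x * C))"
      by (simp add: algebra_simps sc)
    then have 4: "B - (x + y) * C = 0" unfolding 1 2 diff_self by (rule xy)
    have "(x - z) * (B - (x + z) * C) = (A - z * B + z * (z * C)) - (A - x * B + x * (x * C))"
      by (simp add: algebra_simps sc)
    then have 5: "B - (x + z) * C = 0" unfolding 2 3 diff_self by (rule xz)
    have "(y - z) * C = (B - (x + z) * C) - (B - (x + y) * C)" by (simp add: algebra_simps)
    then have C: "C = 0" unfolding 4 5 diff_self by (rule yz)
    with 4 have B: "B = 0" by simp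
    with 1 C have "A = 0" by simp
    with B C show ?thesis unfolding A_def B_def C_def by (simp add: algebra_simps)
  qed
  then have rel: "g * b = q * (b * g)" "b * e = q * (e * b)" "g * e = q * (e * g) + (q - 1) * (b * b)"
    by blast+
  have mp: "m * p1 = q * (p1 * m)" "m * p2 = q * (p2 * m)"
    unfolding p1_def p2_def by (simp_all add: algebra_simps sc sm m m[THEN left_extend])
  have mg: "m * g = q * (g * m)" "m * b = q * (b * m)" "m * e = q * (e * m)"
    unfolding g_def b_def e_def by (simp_all add: algebra_simps sc sm m mp m[THEN left_extend] mp[THEN left_extend])
  note rules = rel rel[THEN left_extend] mg mg[THEN left_extend] sc sg sb se sm qi qq
  \<comment> \<open>The defect in \<open>one_point_exchange\<close>. It is bilinear, so
    \<open>W (b - c * e) (g - c * b)\<close> is quadratic in \<open>c\<close>; its zeros at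
    \<open>x\<close> and \<open>y\<close> make it \<open>(c - x) * (c - y)\<close> times
    \<open>W e b\<close>, which is the content of \<open>W1\<close> and \<open>W2\<close>.\<close>
  define W where "W = (\<lambda>v w. q * (v * Q' * w) - w * Q * v)"
  have W: "W r1 p1 = 0" "W r2 p2 = 0"
  proof -
    obtain E where E: "(1 + q * ((q * p1 - x * r1) * m)) * E = 1"
      by (rule small_ideal_inverse[OF J(1), of "q * ((q * p1 - x * r1) * m)"])
        (auto intro: small_ideal_closed[OF J(1)] J)
    have U1: "p1 - x * r1 = U" by (simp add: p1_def)
    have "q * (r1 * Q' * p1) = p1 * Q * r1"
      by (rule one_point_exchange(3)[OF q pr(1) _ _ mp(1) m(2) _ _ _ E, unfolded U1])
        (use pr(1) m(2) Q(2) Q'(2) in \<open>simp_all add: mult.assoc sc sr1 sp1 sm\<close>)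
    then show "W r1 p1 = 0" by (simp add: W_def)
    obtain E where E: "(1 + q * ((q * p2 - y * r2) * m)) * E = 1"
      by (rule small_ideal_inverse[OF J(1), of "q * ((q * p2 - y * r2) * m)"])
        (auto intro: small_ideal_closed[OF J(1)] J)
    have U2: "p2 - y * r2 = U" by (simp add: p2_def)
    have "q * (r2 * Q' * p2) = p2 * Q * r2"
      by (rule one_point_exchange(3)[OF q pr(2) _ _ mp(2) m(3) _ _ _ E, unfolded U2])
        (use pr(2) m(3) Q(2) Q'(2) in \<open>simp_all add: mult.assoc sc sr2 sp2 sm\<close>)
    then show "W r2 p2 = 0" by (simp add: W_def)
  qed
  have W2: "W e g + W b b = (x + y) * W e b" and W1: "W b g = x * (y * W e b)"
  proof -
    have "W (D * r1) (D * p1) = D * (D * W r1 p1)" "W (D * r2) (D * p2) = D * (D * W r2 p2)"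
      unfolding W_def
      by (simp_all add: algebra_simps swap[OF cD, of r1] swap[OF cD, of p1] swap[OF cD, of r2]
        swap[OF cD, of p2] swap[OF cD, of Q] swap[OF cD, of Q'] swap[OF q, of D])
    then have 1: "W b g - y * (W e g + W b b) + y * (y * W e b) = 0"
      and 2: "W b g - x * (W e g + W b b) + x * (x * W e b) = 0"
      unfolding W Dp Dr unfolding W_def by (simp_all add: algebra_simps sc sg sb se sQ sQ')
    have "(x - y) * ((W e g + W b b) - (x + y) * W e b)
        = (W b g - y * (W e g + W b b) + y * (y * W e b)) - (W b g - x * (W e g + W b b) + x * (x * W e b))"
      by (simp add: algebra_simps sc)
    then have "(W e g + W b b) - (x + y) * W e b = 0" unfolding 1 2 diff_self by (rule xy)
    then show "W e g + W b b = (x + y) * W e b" by simp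
    have "W b g = y * (W e g + W b b) - y * (y * W e b)" using 1 by (simp add: algebra_simps)
    then show "W b g = x * (y * W e b)"
      unfolding \<open>W e g + W b b = (x + y) * W e b\<close> by (simp add: algebra_simps sc)
  qed
  \<comment> \<open>A q-analogue of the determinant of the matrix with rows \<open>(g, b)\<close>
    and \<open>(b, e)\<close>; it commutes with \<open>b\<close>.\<close>
  define O' where "O' = e * g - qi * (b * b)"
  define A where "A = b * (Q' * m) * O' - O' * (m * Q) * b"
  have Q'm: "Q' * m = m * Q" by (rule inverse_intertwine[OF _ Q'(2) Q(1)]) (simp add: algebra_simps)
  have A: "x * (y * (q * A)) + D * W b g = 0"
  proof -
    \<comment> \<open>\<open>E\<close> is the factor \<open>D * (1 + m * U)\<close> carried across
      \<open>b\<close>. It need not be invertible, but it is \<open>D\<close> plus an element of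
      \<open>J\<close>, and this is what \<open>xyJ\<close> allows to cancel.\<close>
    define E where "E = D + (qi * g - (x + y) * b + q * (x * (y * e))) * m"
    note Drules = swap[OF cD, of g] swap[OF cD, of b] swap[OF cD, of e] swap[OF cD, of m]
      swap[OF q, of D] swap[OF cqi, of D] swap[OF c(2), of D] swap[OF c(3), of D]
    have DK: "D * (1 + m * U) = D + m * (D * U)" "D * (1 + U * m) = D + D * U * m"
      by (simp_all add: algebra_simps Drules)
    have "E * b = b * (D * (1 + m * U))"
      unfolding E_def DK DU by (simp add: algebra_simps rules Drules)
    then have 1: "E * (b * Q') = D * b"
      using Q'(1) by (metis (no_types) cD central_def mult.assoc mult_1_right)
    have "E * (x * (y * (q * (O' * m))) + D * g) = (x * (y * (m * O')) + D * g) * (D * (1 + U * m))"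
      unfolding E_def DK DU O'_def by (simp add: algebra_simps rules Drules)
    then have 2: "E * (x * (y * (q * (O' * m))) + D * g) * Q = (x * (y * (m * O')) + D * g) * D"
      using Q(1) by (metis (no_types) mult.assoc mult_1_right)
    have "E * (x * (y * (q * A)) + D * W b g) = x * (y * (q * (E * (b * Q') * m * O'))) + q * (D * (E * (b * Q') * g))
       - E * (x * (y * (q * (O' * m))) + D * g) * Q * b"
      unfolding A_def W_def
      by (simp add: algebra_simps swap[OF c(2), of E] swap[OF c(3), of E] swap[OF q, of E] swap[OF cD, of E]
        swap[OF q, of D] Drules sc)
    also have "\<dots> = 0" unfolding 1 2 unfolding O'_def by (simp add: algebra_simps rules Drules)
    finally show ?thesis unfolding E_def D_def
      by (rule xyJ[rotated]) (auto intro: small_ideal_closed[OF J(1)] J)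
  qed
  have qA: "q * A = - (D * W e b)"
  proof -
    have "x * (y * (q * A + D * W e b)) = x * (y * (q * A)) + D * W b g"
      unfolding W1 by (simp add: algebra_simps swap[OF c(2), of D] swap[OF c(3), of D])
    then have "q * A + D * W e b = 0" unfolding A by (blast intro: x0 y0)
    then show ?thesis by (simp add: eq_neg_iff_add_eq_0)
  qed
  \<comment> \<open>After multiplication by \<open>D\<close> the inverses occur only through
    \<open>I\<close>, which is \<open>m * Q\<close> and also \<open>Q' * m\<close>:
    \<open>V\<close>, \<open>K\<close>, \<open>K'\<close> are \<open>D * U\<close>,
    \<open>D * Q\<close>, \<open>D * Q'\<close>.\<close>
  define I where "I = m * Q"
  define V where "V = g - (x + y) * b + x * (y * e)"
  define K where "K = D - V * I"
  define K' where "K' = D - I * V"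
  have I: "Q' * m = I" "m * Q = I" using Q'm by (simp_all add: I_def)
  have DQ: "D * Q = K"
  proof -
    have "Q = 1 - U * I" using Q(1) by (simp add: I_def algebra_simps)
    then have "D * Q = D * (1 - U * I)" by simp
    then have "D * Q = D - D * U * I" by (simp add: right_diff_distrib mult.assoc)
    then show ?thesis unfolding K_def V_def DU .
  qed
  have DQ': "D * Q' = K'"
  proof -
    have "Q' = 1 - I * U" using Q'(2) by (simp add: I(1)[symmetric] algebra_simps)
    then have "D * Q' = D * (1 - I * U)" by simp
    then have "D * Q' = D - I * (D * U)" by (simp add: right_diff_distrib swap[OF cD, of I])
    then show ?thesis unfolding K'_def V_def DU .
  qed
  have DX: "D * X1 = g - y * b - z * (b - y * e)" "D * X2 = g - x * b - z * (b - x * e)"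
    unfolding X1_def X2_def by (simp_all add: right_diff_distrib swap[OF c(4), of D] Dp[symmetric] Dr[symmetric])
  have Dd: "D * (D * d1) = (g - y * b) * I * (g - y * b - z * (b - y * e)) + z * (b - y * e) * K'"
    "D * (D * d2) = (g - x * b) * I * (g - x * b - z * (b - x * e)) + z * (b - x * e) * K'"
    unfolding d1_def d2_def DX[symmetric] unfolding Dp[symmetric] Dr[symmetric] DQ'[symmetric] I_def
    by (simp_all add: algebra_simps swap[OF cD, of p1] swap[OF cD, of p2] swap[OF cD, of r1]
        swap[OF cD, of r2] swap[OF cD, of m] swap[OF cD, of Q] swap[OF cD, of z])
  have DW: "D * W v w = q * (v * K' * w) - w * K * v" for v w
    unfolding W_def DQ[symmetric] DQ'[symmetric]
    by (simp add: algebra_simps swap[OF cD, of v] swap[OF cD, of w] swap[OF cD, of q])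
  note sI = scal[of I]
  define T where "T = (x * d1 - y * d2) * (X1 - X2) + (x * X1 - y * X2) * (d1 - d2)
    - q * ((d1 - d2) * (x * X1 - y * X2) + (X1 - X2) * (x * d1 - y * d2))"
  have DDT: "D * (D * T) = (x * (D * (D * d1)) - y * (D * (D * d2))) * (b - z * e)
       + (g - z * b) * (D * (D * d1) - D * (D * d2))
       - q * ((D * (D * d1) - D * (D * d2)) * (g - z * b) + (b - z * e) * (x * (D * (D * d1)) - y * (D * (D * d2))))"
    unfolding T_def X
    by (simp add: algebra_simps swap[OF cD, of x] swap[OF cD, of y] swap[OF cD, of q] swap[OF cD, of z]
      swap[OF cD, of g] swap[OF cD, of b] swap[OF cD, of e])
  \<comment> \<open>By \<open>W1\<close> and \<open>W2\<close> the terms with \<open>W\<close> in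
    the bracket add up to \<open>(z - x) * (z - y)\<close> times \<open>D * W e b\<close>; by
    \<open>qA\<close> the term with \<open>A\<close> is the negative of this.\<close>
  have "\<dots> = D * (D * W b g - z * (D * (W e g + W b b)) + z * (z * (D * W e b))
      - ((x + y) * z - z * z - x * y) * (q * A))"
    unfolding Dd A_def O'_def I distrib_left[of D] DW
    unfolding K_def K'_def V_def D_def
    by (simp add: algebra_simps rules sI qi qq)
  also have "\<dots> = 0"
    unfolding W1 W2 qA
    by (simp add: algebra_simps sc swap[OF cD, of x] swap[OF cD, of y] swap[OF cD, of z])
  finally have "D * (D * T) = 0" using DDT by simp
  then have "T = 0" unfolding D_def by (blast intro: xy)
  then show ?thesis unfolding T_def by simp
qed

lemma exchange_relation_preserved_mirror:
  fixes q x y z U r1 r2 m Q Q' :: "'a::ring_1"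
  assumes c: "central q" "central x" "central y" "central z"
    and qi: "q * qi = 1" "qi * q = 1"
    and xy: "\<And>w. (x - y) * w = 0 \<Longrightarrow> w = 0" and xz: "\<And>w. (x - z) * w = 0 \<Longrightarrow> w = 0"
    and yz: "\<And>w. (y - z) * w = 0 \<Longrightarrow> w = 0"
    and x0: "\<And>w. x * w = 0 \<Longrightarrow> w = 0" and y0: "\<And>w. y * w = 0 \<Longrightarrow> w = 0"
    and J: "small_ideal J" "m \<in> J"
    and xyJ: "\<And>v w. v \<in> J \<Longrightarrow> w * (x - y + v) = 0 \<Longrightarrow> w = 0"
  defines "p1 \<equiv> U + x * r1" and "p2 \<equiv> U + y * r2"
  defines "X1 \<equiv> p1 - z * r1" and "X2 \<equiv> p2 - z * r2"
  assumes pr: "r1 * p1 = q * (p1 * r1)" "r2 * p2 = q * (p2 * r2)"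
    and X12: "(x * X1 - y * X2) * (X1 - X2) = qi * ((X1 - X2) * (x * X1 - y * X2))"
    and m: "U * m = q * (m * U)" "r1 * m = q * (m * r1)" "r2 * m = q * (m * r2)"
    and Q: "(1 + U * m) * Q' = 1" "Q' * (1 + U * m) = 1"
    and Q': "(1 + m * U) * Q = 1" "Q * (1 + m * U) = 1"
  defines "d1 \<equiv> X1 * Q * m * p1 + z * Q' * r1" and "d2 \<equiv> X2 * Q * m * p2 + z * Q' * r2"
  shows "(x * d1 - y * d2) * (X1 - X2) + (x * X1 - y * X2) * (d1 - d2)
    = qi * ((d1 - d2) * (x * X1 - y * X2) + (X1 - X2) * (x * d1 - y * d2))"
proof -
  have comm: "w * q = q * w" "w * x = x * w" "w * y = y * w" "w * z = z * w" for w
    using c by (simp_all add: central_def)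
  have left: "w * (z * v) = z * (w * v)" for w v using c(4) by (rule central_left_swap)
  have cl: "w * (x - y) = (x - y) * w" "w * (x - z) = (x - z) * w" "w * (y - z) = (y - z) * w" for w
    by (simp_all add: left_diff_distrib right_diff_distrib comm)
  have X21: "(X1 - X2) * (x * X1 - y * X2) = q * ((x * X1 - y * X2) * (X1 - X2))"
    unfolding X12 by (metis qi(1) mult.assoc mult_1_left)
  have o: "Opp p1 = Opp U + Opp x * Opp r1" "Opp p2 = Opp U + Opp y * Opp r2"
    "Opp X1 = Opp U + Opp x * Opp r1 - Opp z * Opp r1" "Opp X2 = Opp U + Opp y * Opp r2 - Opp z * Opp r2"
    by (simp_all add: opp_defs comm p1_def p2_def X1_def X2_def)
  have "(Opp x * Opp d1 - Opp y * Opp d2) * (Opp X1 - Opp X2) + (Opp x * Opp X1 - Opp y * Opp X2) * (Opp d1 - Opp d2)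
    = Opp q * ((Opp d1 - Opp d2) * (Opp x * Opp X1 - Opp y * Opp X2) + (Opp X1 - Opp X2) * (Opp x * Opp d1 - Opp y * Opp d2))"
  proof -
    have d: "Opp d1 = Opp p1 * Opp m * Opp Q * Opp X1 + Opp z * Opp r1 * Opp Q'"
      "Opp d2 = Opp p2 * Opp m * Opp Q * Opp X2 + Opp z * Opp r2 * Opp Q'"
      unfolding d1_def d2_def by (simp_all add: opp_defs mult.assoc comm left)
    show ?thesis unfolding d unfolding o
    proof (rule exchange_relation_preserved[where q = "Opp q" and qi = "Opp qi" and J = "Opp ` J"])
      show "central (Opp q)" "central (Opp x)" "central (Opp y)" "central (Opp z)"
        using c by (simp_all add: central_Opp)
      show "small_ideal (Opp ` J)" by (rule small_ideal_Opp[OF J(1)])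
      show "(Opp x - Opp y) * w = 0 \<Longrightarrow> w = 0" "(Opp x - Opp z) * w = 0 \<Longrightarrow> w = 0"
        "(Opp y - Opp z) * w = 0 \<Longrightarrow> w = 0" "Opp x * w = 0 \<Longrightarrow> w = 0" "Opp y * w = 0 \<Longrightarrow> w = 0" for w
        using xy[of "unopp w"] xz[of "unopp w"] yz[of "unopp w"] x0[of "unopp w"] y0[of "unopp w"]
        by (simp_all add: opp_defs cl comm opp.expand)
      show "w = 0" if "v \<in> Opp ` J" "(Opp x - Opp y + v) * w = 0" for v w
        using that xyJ[of "unopp v" "unopp w"] by (auto simp: opp_defs opp.expand)
      show "(Opp U + Opp x * Opp r1) * Opp r1 = Opp q * (Opp r1 * (Opp U + Opp x * Opp r1))"
        "(Opp U + Opp y * Opp r2) * Opp r2 = Opp q * (Opp r2 * (Opp U + Opp y * Opp r2))"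
        unfolding o[symmetric] using pr by (simp_all add: opp_defs comm)
      show "(Opp x * (Opp U + Opp x * Opp r1 - Opp z * Opp r1) - Opp y * (Opp U + Opp y * Opp r2 - Opp z * Opp r2)) *
        ((Opp U + Opp x * Opp r1 - Opp z * Opp r1) - (Opp U + Opp y * Opp r2 - Opp z * Opp r2)) =
        Opp q * (((Opp U + Opp x * Opp r1 - Opp z * Opp r1) - (Opp U + Opp y * Opp r2 - Opp z * Opp r2)) *
        (Opp x * (Opp U + Opp x * Opp r1 - Opp z * Opp r1) - Opp y * (Opp U + Opp y * Opp r2 - Opp z * Opp r2)))"
        unfolding o(3,4)[symmetric] using X21 by (simp add: opp_defs comm)
    qed (use qi J(2) m Q Q' in \<open>simp_all add: opp_defs comm\<close>)
  qed
  then have "(X1 - X2) * (x * d1 - y * d2) + (d1 - d2) * (x * X1 - y * X2)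
      = q * ((x * X1 - y * X2) * (d1 - d2) + (x * d1 - y * d2) * (X1 - X2))"
    by (simp add: opp_defs comm)
  then have "qi * ((X1 - X2) * (x * d1 - y * d2) + (d1 - d2) * (x * X1 - y * X2))
      = (x * X1 - y * X2) * (d1 - d2) + (x * d1 - y * d2) * (X1 - X2)"
    using qi(2) by (metis mult.assoc mult_1_left)
  then show ?thesis by (simp add: add.commute)
qed

section \<open>Commuting Riccati flows\<close>

text \<open>\<open>h\<close> supplies the bimodule structure on the target. This generality is
  needed because the flow maps the algebra into series over it, and tangents map dual numbers to
  their base ring.\<close>

definition derivation_along :: "('a::ring_1 \<Rightarrow> 'b::ring_1) \<Rightarrow> ('a \<Rightarrow> 'b) \<Rightarrow> bool" where
  "derivation_along h D \<longleftrightarrow>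
     (\<forall>a b. D (a + b) = D a + D b) \<and> (\<forall>a b. D (a * b) = D a * h b + h a * D b)"

lemma derivation_alongD:
  assumes "derivation_along h D"
  shows "D (a + b) = D a + D b" "D (a * b) = D a * h b + h a * D b"
    "D 0 = 0" "D (- a) = - D a" "D (a - b) = D a - D b"
proof -
  show *: "D (a + b) = D a + D b" "D (a * b) = D a * h b + h a * D b" for a b
    using assms by (auto simp: derivation_along_def)
  show 0: "D 0 = 0" using *(1)[of 0 0] by simp
  show m: "D (- a) = - D a" for a using *(1)[of a "- a"] 0 by (simp add: eq_neg_iff_add_eq_0 add.commute)
  show "D (a - b) = D a - D b" using *(1)[of a "- b"] m by simp
qed

text \<open>
  The entries \<open>eij\<close> form the idempotent at \<open>w\<close> and the \<open>fij\<close> the one at \<open>z\<close>; the conclusion is a Lax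
  equation for the former.
\<close>

lemma idempotent_flow:
  fixes D :: "'a::ring_1 \<Rightarrow> 'a"
  assumes D: "derivation_along (\<lambda>a. a) D" "D 1 = 0" and c: "central w" "central z"
    and K: "(1 + m * U) * K = 1" "K * (1 + m * U) = 1"
    and U: "(w - z) * D U = - (w * (U * f12 * U)) + z * (U * f11 - f22 * U + f21)"
    and m: "(w - z) * D m = - (z * (f11 * m)) - w * f12 + z * (m * f21 * m + m * f22)"
  defines "e11 \<equiv> K" and "e12 \<equiv> - (K * m)" and "e21 \<equiv> - (U * K)" and "e22 \<equiv> U * K * m"
  shows "(w - z) * D e11 = z * (e11 * f11 + e12 * f21 - f11 * e11) - w * (f12 * e21)"
    "(w - z) * D e12 = w * (e11 * f12 - f12 * e22) + z * (e12 * f22 - f11 * e12)"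
    "(w - z) * D e21 = z * (e21 * f11 + e22 * f21 - f21 * e11 - f22 * e21)"
    "(w - z) * D e22 = w * (e21 * f12) + z * (e22 * f22 - f21 * e12 - f22 * e22)"
proof -
  note swap = central_swap central_left_swap
  note d = derivation_alongD[OF D(1)]
  define s where "s = w - z"
  have cs: "central s" unfolding s_def by (intro central_closed c)
  note cc = swap[OF cs, of K] swap[OF cs, of m] swap[OF cs, of U]
    swap[OF c(1), of U] swap[OF c(1), of m] swap[OF c(1), of K] swap[OF c(1), of f12]
    swap[OF c(2), of U] swap[OF c(2), of m] swap[OF c(2), of K] swap[OF c(2), of f11]
    swap[OF c(2), of f21] swap[OF c(2), of f22] swap[OF c(1), of z]
  have "D (K * (1 + m * U)) = 0" using K D by simp
  then have "D K * (1 + m * U) = - (K * D (m * U))" unfolding d using D(2) by (simp add: eq_neg_iff_add_eq_0)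
  then have DK: "D K = - (K * D (m * U) * K)"
    using K(1) by (metis mult.assoc mult_1_right mult_minus_left)
  have sDK: "s * D K = - (K * ((s * D m) * U + m * (s * D U)) * K)"
    unfolding DK d by (simp add: algebra_simps cc)
  have "(s * D m) * U + m * (s * D U) = z * ((1 + m * U) * f11 - f11 * (1 + m * U))
      - w * ((1 + m * U) * f12 * U) + z * (m * f21 * (1 + m * U))"
    unfolding U[folded s_def] m[folded s_def] by (simp add: algebra_simps cc)
  \<comment> \<open>\<open>f11'\<close> and \<open>f11''\<close> stand for \<open>K * f11\<close>
    and \<open>f11 * K\<close> with a trivial factor inserted; the trivial factors are cancelled
    only in \<open>K'\<close>.\<close>
  then have "s * D K = z * (f11' - f11'' - K * m * f21 * ((1 + m * U) * K))
      + w * ((K * (1 + m * U)) * f12 * U * K)"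
    if "f11' = K * f11 * ((1 + m * U) * K)" "f11'' = (K * (1 + m * U)) * f11 * K" for f11' f11''
    unfolding sDK that by (simp only:) (simp add: algebra_simps cc)
  from this[OF refl refl] have K': "s * D K = z * (K * f11 - K * m * f21 - f11 * K) + w * (f12 * U * K)"
    unfolding K by (simp add: algebra_simps)
  show "(w - z) * D e11 = z * (e11 * f11 + e12 * f21 - f11 * e11) - w * (f12 * e21)"
    using K' unfolding e11_def e12_def e21_def s_def by (simp add: algebra_simps)
  have "s * D e12 = - (s * D K * m + K * (s * D m))"
    unfolding e12_def d by (simp add: algebra_simps cc)
  then show "(w - z) * D e12 = w * (e11 * f12 - f12 * e22) + z * (e12 * f22 - f11 * e12)"
    unfolding K' m[folded s_def] unfolding e11_def e12_def e22_def s_def by (simp add: algebra_simps cc)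
  have e21: "s * D (U * K) = s * D U * K + U * (s * D K)"
    unfolding d by (simp add: algebra_simps cc)
  then show "(w - z) * D e21 = z * (e21 * f11 + e22 * f21 - f21 * e11 - f22 * e21)"
    unfolding K' U[folded s_def] unfolding e21_def e11_def e22_def d s_def by (simp add: algebra_simps cc)
  have "s * D (U * K * m) = s * D (U * K) * m + U * K * (s * D m)"
    unfolding d by (simp add: algebra_simps cc)
  then show "(w - z) * D e22 = w * (e21 * f12) + z * (e22 * f22 - f21 * e12 - f22 * e22)"
    unfolding e21 unfolding K' U[folded s_def] m[folded s_def]
    unfolding e12_def e21_def e22_def s_def by (simp add: algebra_simps cc)
qed

text \<open>Up to sign and central weights, the two Riccati equations are those of the slopes of a
  row \<open>(X, 1)\<close> and of a column \<open>(Y, 1)\<close> moved by the matrix of the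
  \<open>fij\<close> or \<open>eij\<close>. Multiplied by the three differences of variables, both
  iterated derivatives become polynomials in the unknown and the entries: derivatives of the unknown
  are replaced by Riccati equations, those of the entries by Lax equations. The polynomials agree,
  and the differences cancel.\<close>

lemma riccati_flows_commute:
  fixes D D' :: "'a::ring_1 \<Rightarrow> 'a"
  assumes D: "derivation_along (\<lambda>a. a) D" "derivation_along (\<lambda>a. a) D'"
    and c: "central x" "central w" "central z"
    and D0: "D x = 0" "D w = 0" "D z = 0" "D' x = 0" "D' w = 0" "D' z = 0"
    and xw: "\<And>v. (x - w) * v = 0 \<Longrightarrow> v = 0" and xz: "\<And>v. (x - z) * v = 0 \<Longrightarrow> v = 0"
    and wz: "\<And>v. (w - z) * v = 0 \<Longrightarrow> v = 0"
    and e: "(w - z) * D e11 = z * (e11 * f11 + e12 * f21 - f11 * e11) - w * (f12 * e21)"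
    "(w - z) * D e12 = w * (e11 * f12 - f12 * e22) + z * (e12 * f22 - f11 * e12)"
    "(w - z) * D e21 = z * (e21 * f11 + e22 * f21 - f21 * e11 - f22 * e21)"
    "(w - z) * D e22 = w * (e21 * f12) + z * (e22 * f22 - f21 * e12 - f22 * e22)"
    and f: "(z - w) * D' f11 = w * (f11 * e11 + f12 * e21 - e11 * f11) - z * (e12 * f21)"
    "(z - w) * D' f12 = z * (f11 * e12 - e12 * f22) + w * (f12 * e22 - e11 * f12)"
    "(z - w) * D' f21 = w * (f21 * e11 + f22 * e21 - e21 * f11 - e22 * f21)"
    "(z - w) * D' f22 = z * (f21 * e12) + w * (f22 * e22 - e21 * f12 - e22 * f22)"
  shows "(x - z) * D X = - (x * (X * f12 * X)) + z * (X * f11 - f22 * X + f21) \<Longrightarrow>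
      (x - w) * D' X = - (x * (X * e12 * X)) + w * (X * e11 - e22 * X + e21) \<Longrightarrow>
      D (D' X) = D' (D X)"
    and "(x - z) * D Y = - (z * (f11 * Y)) - x * f12 + z * (Y * f21 * Y + Y * f22) \<Longrightarrow>
      (x - w) * D' Y = - (w * (e11 * Y)) - x * e12 + w * (Y * e21 * Y + Y * e22) \<Longrightarrow>
      D (D' Y) = D' (D Y)"
proof -
  note swap = central_swap central_left_swap
  define p where "p = x - w"
  define r where "r = x - z"
  define s where "s = w - z"
  have cp: "central p" "central r" "central s" unfolding p_def r_def s_def by (intro central_closed c)+
  have D0': "D p = 0" "D r = 0" "D s = 0" "D' p = 0" "D' r = 0" "D' s = 0"
    unfolding p_def r_def s_def derivation_alongD(5)[OF D(1)] derivation_alongD(5)[OF D(2)] D0 by simp_all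
  have zw: "z - w = - s" by (simp add: s_def)
  have f': "s * D' f11 = - (w * (f11 * e11 + f12 * e21 - e11 * f11) - z * (e12 * f21))"
    "s * D' f12 = - (z * (f11 * e12 - e12 * f22) + w * (f12 * e22 - e11 * f12))"
    "s * D' f21 = - (w * (f21 * e11 + f22 * e21 - e21 * f11 - e22 * f21))"
    "s * D' f22 = - (z * (f21 * e12) + w * (f22 * e22 - e21 * f12 - e22 * f22))"
    using f[THEN arg_cong[of _ _ uminus]] unfolding zw by (simp_all only: mult_minus_left minus_minus)
  note sc = swap[OF c(1), of w] swap[OF c(1), of z] swap[OF c(2), of z]
  note e' = e[folded s_def]
  note d = derivation_alongD[OF D(1)] derivation_alongD[OF D(2)]
  note letters = swap[OF c(1)] swap[OF c(2)] swap[OF c(3)]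
  note e_swap = letters[of e11] letters[of e12] letters[of e21] letters[of e22]
    letters[of f11] letters[of f12] letters[of f21] letters[of f22]
  note prs = swap[OF cp(1), of x] swap[OF cp(1), of w] swap[OF cp(1), of z]
    swap[OF cp(2), of x] swap[OF cp(2), of w] swap[OF cp(2), of z]
    swap[OF cp(3), of x] swap[OF cp(3), of w] swap[OF cp(3), of z]
    swap[OF cp(1), of r] swap[OF cp(1), of s] swap[OF cp(2), of s]
  have out: "p * (r * (s * (D (D' X) - D' (D X)))) = 0 \<Longrightarrow> D (D' X) = D' (D X)" for X
    unfolding p_def r_def s_def using xw xz wz by (metis eq_iff_diff_eq_0)
  have pD: "p * D v = D (p * v)" "r * D' v = D' (r * v)" "r * D v = D (r * v)" "p * D' v = D' (p * v)" for v
    unfolding d D0' by simp_all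
  have split: "p * (r * (s * (D (D' X) - D' (D X)))) = r * (s * D (p * D' X)) - p * (s * D' (r * D X))" for X
    unfolding pD[symmetric] by (simp add: right_diff_distrib prs)
  {
    fix X
    assume z: "(x - z) * D X = - (x * (X * f12 * X)) + z * (X * f11 - f22 * X + f21)"
      and w: "(x - w) * D' X = - (x * (X * e12 * X)) + w * (X * e11 - e22 * X + e21)"
    note z' = z[folded r_def] and w' = w[folded p_def]
    note Xc = letters[of X] swap[OF cp(1), of X] swap[OF cp(2), of X] swap[OF cp(3), of X]
      swap[OF cp(2), of e12] swap[OF cp(2), of e11] swap[OF cp(2), of e22]
      swap[OF cp(3), of e12] swap[OF cp(3), of e11] swap[OF cp(3), of e22]
      swap[OF cp(1), of f12] swap[OF cp(1), of f11] swap[OF cp(1), of f22]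
      swap[OF cp(3), of f12] swap[OF cp(3), of f11] swap[OF cp(3), of f22]
    have 1: "r * (s * D (p * D' X)) =
       - (x * (s * (r * D X) * e12 * X + r * X * (s * D e12) * X + s * X * e12 * (r * D X)))
       + w * (s * (r * D X) * e11 + r * X * (s * D e11) - r * (s * D e22) * X - s * e22 * (r * D X) + r * (s * D e21))"
      unfolding w' d D0 by (simp add: algebra_simps prs Xc)
    have 2: "p * (s * D' (r * D X)) =
       - (x * (s * (p * D' X) * f12 * X + p * X * (s * D' f12) * X + s * X * f12 * (p * D' X)))
       + z * (s * (p * D' X) * f11 + p * X * (s * D' f11) - p * (s * D' f22) * X - s * f22 * (p * D' X) + p * (s * D' f21))"
      unfolding z' d D0 by (simp add: algebra_simps prs Xc)
    have "p * (r * (s * (D (D' X) - D' (D X)))) = 0"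
      unfolding split 1 2 unfolding z' w' e' f'
      by (simp add: algebra_simps p_def r_def s_def e_swap Xc sc)
    then show "D (D' X) = D' (D X)" by (rule out)
  next
    fix Y
    assume z: "(x - z) * D Y = - (z * (f11 * Y)) - x * f12 + z * (Y * f21 * Y + Y * f22)"
      and w: "(x - w) * D' Y = - (w * (e11 * Y)) - x * e12 + w * (Y * e21 * Y + Y * e22)"
    note z' = z[folded r_def] and w' = w[folded p_def]
    note Yc = letters[of Y] swap[OF cp(1), of Y] swap[OF cp(2), of Y] swap[OF cp(3), of Y]
      swap[OF cp(2), of e21] swap[OF cp(2), of e11] swap[OF cp(2), of e22]
      swap[OF cp(3), of e21] swap[OF cp(3), of e11] swap[OF cp(3), of e22]
      swap[OF cp(1), of f21] swap[OF cp(1), of f11] swap[OF cp(1), of f22]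
      swap[OF cp(3), of f21] swap[OF cp(3), of f11] swap[OF cp(3), of f22]
    have 1: "r * (s * D (p * D' Y)) =
       - (w * (r * (s * D e11) * Y + s * e11 * (r * D Y))) - x * (r * (s * D e12))
       + w * (s * (r * D Y) * e21 * Y + r * Y * (s * D e21) * Y + s * Y * e21 * (r * D Y)
           + s * (r * D Y) * e22 + r * Y * (s * D e22))"
      unfolding w' d D0 by (simp add: algebra_simps prs Yc)
    have 2: "p * (s * D' (r * D Y)) =
       - (z * (p * (s * D' f11) * Y + s * f11 * (p * D' Y))) - x * (p * (s * D' f12))
       + z * (s * (p * D' Y) * f21 * Y + p * Y * (s * D' f21) * Y + s * Y * f21 * (p * D' Y)
           + s * (p * D' Y) * f22 + p * Y * (s * D' f22))"
      unfolding z' d D0 by (simp add: algebra_simps prs Yc)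
    have "p * (r * (s * (D (D' Y) - D' (D Y)))) = 0"
      unfolding split 1 2 unfolding z' w' e' f'
      by (simp add: algebra_simps p_def r_def s_def e_swap Yc sc)
    then show "D (D' Y) = D' (D Y)" by (rule out)
  }
qed

section \<open>Maps out of the quantum algebra\<close>

lemma central_0_1: "central 0" "central 1" by (simp_all add: central_def)

text \<open>\<^const>\<open>extend\<close> with values in a noncommutative ring.\<close>

definition lin :: "('b::zero \<Rightarrow> 'c::ring_1) \<Rightarrow> ('a \<Rightarrow> 'c) \<Rightarrow> ('a \<Rightarrow>\<^sub>0 'b) \<Rightarrow> 'c" where
  "lin \<phi> f p = (\<Sum>w\<in>Poly_Mapping.keys p. \<phi> (Poly_Mapping.lookup p w) * f w)"

lemma lin_eq:
  assumes "\<phi> 0 = 0" "finite S" "Poly_Mapping.keys p \<subseteq> S"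
  shows "lin \<phi> f p = (\<Sum>w\<in>S. \<phi> (Poly_Mapping.lookup p w) * f w)"
  unfolding lin_def using assms
  by (intro sum.mono_neutral_left) (auto simp: in_keys_iff)

lemma lin_single: "\<phi> 0 = 0 \<Longrightarrow> lin \<phi> f (Poly_Mapping.single w c) = \<phi> c * f w"
  using lin_eq[of \<phi> "{w}" "Poly_Mapping.single w c" f] by simp

lemma lin_add:
  fixes \<phi> :: "'b::ring_1 \<Rightarrow> 'c::ring_1"
  assumes "ring_map \<phi>"
  shows "lin \<phi> f (p + r) = lin \<phi> f p + lin \<phi> f r"
proof -
  let ?S = "Poly_Mapping.keys p \<union> Poly_Mapping.keys r"
  note e = lin_eq[of \<phi> ?S, OF ring_mapD(4)[OF assms]]
  show ?thesis
    using Poly_Mapping.keys_add[of p r]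
    by (simp add: e lookup_add ring_mapD[OF assms] distrib_right sum.distrib)
qed

lemma lin_sum:
  fixes \<phi> :: "'b::ring_1 \<Rightarrow> 'c::ring_1"
  assumes "ring_map \<phi>"
  shows "lin \<phi> f (sum F S) = (\<Sum>s\<in>S. lin \<phi> f (F s))"
  by (induction S rule: infinite_finite_induct)
    (simp_all add: lin_add[OF assms], simp_all add: lin_def)

lemma ring_map_lin:
  fixes \<phi> :: "'b::ring_1 \<Rightarrow> 'c::ring_1" and f :: "'a::monoid_add \<Rightarrow> 'c"
  assumes \<phi>: "ring_map \<phi>" and c: "\<And>b. central (\<phi> b)" and f: "f 0 = 1" "\<And>a b. f (a + b) = f a * f b"
  shows "ring_map (lin \<phi> f)"
proof -
  note single = lin_single[of \<phi> f, OF ring_mapD(4)[OF \<phi>]]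
  have "lin \<phi> f (p * r) = lin \<phi> f p * lin \<phi> f r" for p r
  proof -
    let ?K = "Poly_Mapping.keys p" and ?L = "Poly_Mapping.keys r"
    let ?a = "Poly_Mapping.lookup p" and ?b = "Poly_Mapping.lookup r"
    have "p * r = (\<Sum>w\<in>?K. \<Sum>x\<in>?L. Poly_Mapping.single (w + x) (?a w * ?b x))"
      by (subst (1) poly_mapping_expand[of p], subst (1) poly_mapping_expand[of r])
        (simp add: sum_product mult_single)
    then have "lin \<phi> f (p * r) = (\<Sum>w\<in>?K. \<Sum>x\<in>?L. \<phi> (?a w * ?b x) * f (w + x))"
      by (simp add: lin_sum[OF \<phi>] single)
    also have "\<dots> = (\<Sum>w\<in>?K. \<Sum>x\<in>?L. (\<phi> (?a w) * f w) * (\<phi> (?b x) * f x))"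
    proof (intro sum.cong refl)
      fix w x
      have "f w * (\<phi> (?b x) * f x) = \<phi> (?b x) * (f w * f x)" by (rule central_left_swap[OF c])
      then show "\<phi> (?a w * ?b x) * f (w + x) = (\<phi> (?a w) * f w) * (\<phi> (?b x) * f x)"
        by (simp add: f ring_mapD[OF \<phi>] mult.assoc)
    qed
    also have "\<dots> = lin \<phi> f p * lin \<phi> f r"
      by (simp add: lin_def sum_product)
    finally show ?thesis .
  qed
  moreover have "lin \<phi> f 1 = 1"
    by (simp add: single_one[symmetric] single f ring_mapD[OF \<phi>] del: single_one)
  ultimately show ?thesis
    by (auto simp: ring_map_def lin_add[OF \<phi>])
qed

section \<open>The quotient algebra and its universal property\<close>

lemma abs_qalg_hom: "abs_qalg 1 = 1" "abs_qalg 0 = 0" "abs_qalg (a + b) = abs_qalg a + abs_qalg b"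
  "abs_qalg (a * b) = abs_qalg a * abs_qalg b" "abs_qalg (- a) = - abs_qalg a"
  "abs_qalg (a - b) = abs_qalg a - abs_qalg b"
  "abs_qalg (free_scalar c) = scalar c" "abs_qalg (free_gen g) = generator g"
  by (simp_all add: one_qalg_def zero_qalg_def plus_qalg.abs_eq times_qalg.abs_eq uminus_qalg.abs_eq
      minus_qalg.abs_eq scalar_def generator_def)

lemma ring_map_abs_qalg: "ring_map abs_qalg"
  by (simp add: ring_map_def abs_qalg_hom)

lemma abs_qalg_rel_ideal: "x \<in> rel_ideal \<Longrightarrow> abs_qalg x = 0"
  unfolding abs_qalg_hom(2)[symmetric] qalg.abs_eq_iff rel_equiv_def by simp

lemma free_alg_induct [case_names scalar gen add mult]:
  assumes "\<And>c. P (free_scalar c)" "\<And>g. P (free_gen g)"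
    "\<And>a b. P a \<Longrightarrow> P b \<Longrightarrow> P (a + b)" "\<And>a b. P a \<Longrightarrow> P b \<Longrightarrow> P (a * b)"
  shows "P p"
proof -
  have 1: "P (Poly_Mapping.single w 1)" for w
  proof (induction w)
    case Nil
    show ?case using assms(1)[of 1] by (simp add: free_scalar_def)
  next
    case (Cons g w)
    have "Poly_Mapping.single (g # w) 1 = free_gen g * Poly_Mapping.single w 1"
      by (simp add: free_gen_def mult_single plus_list_def)
    then show ?case using assms(2,4) Cons by simp
  qed
  have "P (Poly_Mapping.single w c)" for w c
  proof -
    have "Poly_Mapping.single w c = free_scalar c * Poly_Mapping.single w 1"
      by (simp add: free_scalar_def mult_single plus_list_def)
    then show ?thesis using assms(1,4) 1 by simp
  qed
  moreover have "P 0" using assms(1)[of 0] by (simp add: free_scalar_def)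
  ultimately have "P (\<Sum>w\<in>S. Poly_Mapping.single w (Poly_Mapping.lookup p w))" for S
    by (induction S rule: infinite_finite_induct) (simp_all add: assms(3))
  then show ?thesis using poly_mapping_expand[of p] by metis
qed

lemma qalg_induct [case_names scalar gen add mult]:
  assumes "\<And>c. P (scalar c)" "\<And>g. P (generator g)"
    "\<And>a b. P a \<Longrightarrow> P b \<Longrightarrow> P (a + b)" "\<And>a b. P a \<Longrightarrow> P b \<Longrightarrow> P (a * b)"
  shows "P a"
proof (induct a rule: qalg.abs_induct)
  fix p
  show "P (abs_qalg p)"
    by (induction p rule: free_alg_induct) (simp_all add: abs_qalg_hom assms)
qed

lemma scalar_hom: "scalar 1 = 1" "scalar (c * d) = scalar c * scalar d" "scalar (c + d) = scalar c + scalar d"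
  unfolding abs_qalg_hom[symmetric] free_scalar_def
  by (simp_all add: mult_single single_add zero_list_def[symmetric])

lemma central_scalar: "central (scalar c)"
proof -
  have "scalar c * a = a * scalar c" for a
  proof (induction a rule: qalg_induct)
    case (scalar d)
    show ?case by (simp add: scalar_hom(2)[symmetric] mult.commute)
  next
    case (gen g)
    show ?case unfolding abs_qalg_hom[symmetric] free_scalar_def free_gen_def
      by (simp add: mult_single plus_list_def)
  next
    case (mult a b)
    then show ?case by (metis mult.assoc)
  qed (simp_all add: algebra_simps)
  then show ?thesis by (simp add: central_def)
qed

lemma map_coeffs_exchange_relation:
  assumes "ring_map h"
  shows "map_coeffs (map_coeffs h) (exchange_relation c f) = exchange_relation (h c) (map_coeffs h f)"
    "map_coeffs (map_coeffs h) (mixed_relation c f g) = mixed_relation (h c) (map_coeffs h f) (map_coeffs h g)"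
  by (simp_all add: exchange_relation_def mixed_relation_def map_coeffs2_series[OF assms]
      ring_mapD[OF ring_map_map_coeffs[OF ring_map_map_coeffs[OF assms]]])

lemma ring_map_power_sign: "ring_map h \<Longrightarrow> h ((- 1) ^ i) = (- 1) ^ i"
  by (induction i) (simp_all add: ring_mapD)

lemma qalg_universal:
  fixes \<phi> :: "laurent \<Rightarrow> 'r::ring_1" and g :: "gen \<Rightarrow> 'r"
  assumes \<phi>: "ring_map \<phi>" "\<And>c. central (\<phi> c)"
  defines "us \<equiv> Abs_fps (\<lambda>i. (- 1) ^ i * g (GenU i))" and "ms \<equiv> Abs_fps (\<lambda>i. (- 1) ^ i * g (GenM i))"
  assumes rel: "exchange_relation (\<phi> (q_pow 1)) us = 0" "exchange_relation (\<phi> (q_pow (- 1))) ms = 0"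
    "mixed_relation (\<phi> (q_pow (- 1))) us ms = 0"
  obtains h where "ring_map h" "\<And>c. h (scalar c) = \<phi> c" "\<And>a. h (generator a) = g a"
proof -
  define F where "F = lin \<phi> (\<lambda>w. prod_list (map g w))"
  have F: "ring_map F"
    unfolding F_def by (rule ring_map_lin[OF \<phi>]) (simp_all add: zero_list_def plus_list_def)
  have Fs: "F (free_scalar c) = \<phi> c" and Fg: "F (free_gen a) = g a" for c a
    unfolding F_def free_scalar_def free_gen_def
    by (simp_all add: lin_single ring_mapD[OF \<phi>(1)])
  have us: "map_coeffs F free_u = us" and ms: "map_coeffs F free_m = ms"
    by (simp_all add: map_coeffs_def free_u_def free_m_def us_def ms_def ring_mapD[OF F] Fg
        ring_map_power_sign[OF F])
  have "map_coeffs (map_coeffs F) (exchange_relation (free_scalar (q_pow 1)) free_u) = 0"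
    "map_coeffs (map_coeffs F) (exchange_relation (free_scalar (q_pow (- 1))) free_m) = 0"
    "map_coeffs (map_coeffs F) (mixed_relation (free_scalar (q_pow (- 1))) free_u free_m) = 0"
    by (simp_all add: map_coeffs_exchange_relation[OF F] us ms Fs rel)
  then have relators: "F r = 0" if "r \<in> relators" for r
    using that unfolding relators_def by (blast intro: coeffs2_kernel)
  have ideal: "F x = 0" if "x \<in> rel_ideal" for x
    using that by (induction rule: rel_ideal.induct) (simp_all add: ring_mapD[OF F] relators)
  define h where "h = F \<circ> rep_qalg"
  have h: "h (abs_qalg p) = F p" for p
  proof -
    have "rel_equiv (rep_qalg (abs_qalg p)) p"
      using Quotient3_qalg equivp_rel_equiv by (metis Quotient3_def equivp_def rep_abs_rsp qalg.abs_eq_iff)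
    then have "F (rep_qalg (abs_qalg p) - p) = 0" unfolding rel_equiv_def by (rule ideal)
    then show ?thesis by (simp add: h_def ring_mapD[OF F])
  qed
  have "h (a + b) = h a + h b \<and> h (a * b) = h a * h b" for a b
    by (induct a rule: qalg.abs_induct, induct b rule: qalg.abs_induct)
      (simp add: h abs_qalg_hom(3,4)[symmetric] ring_mapD[OF F])
  moreover have "h 1 = 1" using h[of 1] by (simp add: abs_qalg_hom ring_mapD[OF F])
  ultimately have "ring_map h" by (simp add: ring_map_def)
  moreover have "h (scalar c) = \<phi> c" "h (generator a) = g a" for c a
    using h[of "free_scalar c"] h[of "free_gen a"] by (simp_all add: abs_qalg_hom Fs Fg)
  ultimately show ?thesis using that by blast
qed

section \<open>Derivations as homomorphisms into dual numbers\<close>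

text \<open>
  Dual numbers over a noncommutative ring: a ring homomorphism into them is a homomorphism together with
  a derivation along it.
\<close>

datatype 'a jet = Jet (jet_body: 'a) (jet_tangent: 'a)

instantiation jet :: (ring_1) ring_1
begin
definition "0 = Jet 0 0"
definition "1 = Jet 1 0"
definition "a + b = Jet (jet_body a + jet_body b) (jet_tangent a + jet_tangent b)"
definition "a - b = Jet (jet_body a - jet_body b) (jet_tangent a - jet_tangent b)"
definition "- a = Jet (- jet_body a) (- jet_tangent a)"
definition "a * b = Jet (jet_body a * jet_body b) (jet_tangent a * jet_body b + jet_body a * jet_tangent b)"
instance
  by standard
    (simp_all add: zero_jet_def one_jet_def plus_jet_def minus_jet_def uminus_jet_def
      times_jet_def algebra_simps)
end

lemmas jet_defs = zero_jet_def one_jet_def plus_jet_def minus_jet_def uminus_jet_def times_jet_def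

lemma ring_map_jet_body: "ring_map jet_body"
  by (simp add: ring_map_def jet_defs)

lemma derivation_along_jet_tangent: "derivation_along jet_body jet_tangent"
  by (simp add: derivation_along_def jet_defs)

lemma derivation_along_sum:
  "derivation_along h D \<Longrightarrow> D (sum F S) = (\<Sum>s\<in>S. D (F s))"
  by (induction S rule: infinite_finite_induct) (simp_all add: derivation_alongD)

lemma derivation_along_1: "ring_map h \<Longrightarrow> derivation_along h D \<Longrightarrow> D 1 = 0"
  using derivation_alongD(2)[of h D 1 1] by (simp add: ring_mapD)

lemma derivation_along_map_coeffs:
  assumes "derivation_along h D"
  shows "derivation_along (map_coeffs h) (map_coeffs D)"
  unfolding derivation_along_def map_coeffs_def
  by (auto simp: fps_eq_iff fps_mult_nth derivation_alongD[OF assms] derivation_along_sum[OF assms]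
      sum.distrib)

lemma map_coeffs_derivation_series:
  assumes "ring_map h" "derivation_along h D"
  defines "D2 \<equiv> map_coeffs (map_coeffs D)"
  shows "D2 (at_lambda f) = at_lambda (map_coeffs D f)" "D2 (at_mu f) = at_mu (map_coeffs D f)"
    "D2 lambda_inv = 0" "D2 mu_inv = 0" "D2 (fps_const (fps_const c)) = fps_const (fps_const (D c))"
  unfolding D2_def at_lambda_def at_mu_def lambda_inv_def mu_inv_def map_coeffs_def
  by (simp_all add: fps_eq_iff fps_X_def derivation_alongD[OF assms(2)] derivation_along_1[OF assms(1,2)])

lemma derivation_exchange_relation:
  fixes h :: "'a::ring_1 \<Rightarrow> 'b::ring_1" and f g :: "'a fps"
  assumes h: "ring_map h" and D: "derivation_along h D" and c: "D c = 0"
  defines "u \<equiv> map_coeffs h f" and "du \<equiv> map_coeffs D f" and "v \<equiv> map_coeffs h g" and "dv \<equiv> map_coeffs D g"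
  shows "map_coeffs (map_coeffs D) (exchange_relation c f) =
      (lambda_inv * at_lambda du - mu_inv * at_mu du) * (at_lambda u - at_mu u)
      + (lambda_inv * at_lambda u - mu_inv * at_mu u) * (at_lambda du - at_mu du)
      - fps_const (fps_const (h c)) *
       ((at_lambda du - at_mu du) * (lambda_inv * at_lambda u - mu_inv * at_mu u)
        + (at_lambda u - at_mu u) * (lambda_inv * at_lambda du - mu_inv * at_mu du))"
    "map_coeffs (map_coeffs D) (mixed_relation c f g) =
      at_lambda du * at_mu v + at_lambda u * at_mu dv
      - fps_const (fps_const (h c)) * (at_mu dv * at_lambda u + at_mu v * at_lambda du)"
  unfolding u_def du_def v_def dv_def
  by (simp_all add: exchange_relation_def mixed_relation_def map_coeffs_derivation_series[OF h D]
      derivation_alongD[OF derivation_along_map_coeffs[OF derivation_along_map_coeffs[OF D]]]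
      map_coeffs2_series[OF h] ring_mapD[OF ring_map_map_coeffs[OF ring_map_map_coeffs[OF h]]] c)

lemma exchange_relations_qalg:
  "exchange_relation (scalar (q_pow 1)) u_series = 0"
  "exchange_relation (scalar (q_pow (- 1))) m_series = 0"
  "mixed_relation (scalar (q_pow (- 1))) u_series m_series = 0"
proof -
  have us: "map_coeffs abs_qalg free_u = u_series" "map_coeffs abs_qalg free_m = m_series"
    by (simp_all add: map_coeffs_def free_u_def free_m_def u_series_def m_series_def abs_qalg_hom
        ring_map_power_sign[OF ring_map_abs_qalg])
  have zero: "map_coeffs (map_coeffs abs_qalg) F = 0" if "coeffs2 F \<subseteq> relators" for F
  proof -
    have "abs_qalg (fps_nth (fps_nth F i) j) = 0" for i j
    proof (rule abs_qalg_rel_ideal)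
      have "fps_nth (fps_nth F i) j \<in> relators" using that by (auto simp: coeffs2_def)
      then show "fps_nth (fps_nth F i) j \<in> rel_ideal"
        using rel_ideal.add[of _ 0 1 1] rel_ideal.zero by simp
    qed
    then show ?thesis by (simp add: fps_eq_iff map_coeffs_def)
  qed
  note m = map_coeffs_exchange_relation[OF ring_map_abs_qalg]
  show "exchange_relation (scalar (q_pow 1)) u_series = 0"
    "exchange_relation (scalar (q_pow (- 1))) m_series = 0"
    "mixed_relation (scalar (q_pow (- 1))) u_series m_series = 0"
    unfolding us[symmetric] abs_qalg_hom(7)[symmetric] m[symmetric]
    by (rule zero, simp add: relators_def le_supI1 le_supI2)+
qed

text \<open>\<open>uu\<close>, \<open>mm\<close> and \<open>um\<close> are the tangent parts of the
  three relations over the dual numbers; the body parts hold because \<open>h\<close> is a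
  homomorphism. So \<open>qalg_universal\<close> applies, and the tangent part of the homomorphism
  obtained is the derivation.\<close>

lemma derivation_extend:
  fixes h :: "qalg \<Rightarrow> 'b::ring_1"
  assumes h: "ring_map h" "\<And>c. central (h (scalar c))"
  defines "u \<equiv> map_coeffs h u_series" and "m \<equiv> map_coeffs h m_series"
    and "q \<equiv> \<lambda>k. fps_const (fps_const (h (scalar (q_pow k))))"
  assumes uu: "(lambda_inv * at_lambda du - mu_inv * at_mu du) * (at_lambda u - at_mu u)
      + (lambda_inv * at_lambda u - mu_inv * at_mu u) * (at_lambda du - at_mu du)
      = q 1 * ((at_lambda du - at_mu du) * (lambda_inv * at_lambda u - mu_inv * at_mu u)
        + (at_lambda u - at_mu u) * (lambda_inv * at_lambda du - mu_inv * at_mu du))"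
    and mm: "(lambda_inv * at_lambda dm - mu_inv * at_mu dm) * (at_lambda m - at_mu m)
      + (lambda_inv * at_lambda m - mu_inv * at_mu m) * (at_lambda dm - at_mu dm)
      = q (- 1) * ((at_lambda dm - at_mu dm) * (lambda_inv * at_lambda m - mu_inv * at_mu m)
        + (at_lambda m - at_mu m) * (lambda_inv * at_lambda dm - mu_inv * at_mu dm))"
    and um: "at_lambda du * at_mu m + at_lambda u * at_mu dm
      = q (- 1) * (at_mu dm * at_lambda u + at_mu m * at_lambda du)"
  obtains D where "derivation_along h D" "\<And>c. D (scalar c) = 0"
    "map_coeffs D u_series = du" "map_coeffs D m_series = dm"
proof -
  define \<phi> where "\<phi> = (\<lambda>c. Jet (h (scalar c)) 0)"
  define g where "g = (\<lambda>a. case a of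
      GenU i \<Rightarrow> Jet (h (generator (GenU i))) ((- 1) ^ i * fps_nth du i)
    | GenM i \<Rightarrow> Jet (h (generator (GenM i))) ((- 1) ^ i * fps_nth dm i))"
  have \<phi>: "ring_map \<phi>" unfolding \<phi>_def
    by (simp add: ring_map_def jet_defs scalar_hom ring_mapD[OF h(1)])
  have c\<phi>: "central (\<phi> c)" for c
    using h(2)[of c] unfolding \<phi>_def central_def by (simp add: jet_defs)
  define us where "us = Abs_fps (\<lambda>i. (- 1) ^ i * g (GenU i))"
  define ms where "ms = Abs_fps (\<lambda>i. (- 1) ^ i * g (GenM i))"
  have sign: "(- 1) ^ i = Jet ((- 1) ^ i) (0 :: 'b)" for i
    by (induction i) (simp_all add: jet_defs)
  have us: "map_coeffs jet_body us = u" "map_coeffs jet_tangent us = du"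
    "map_coeffs jet_body ms = m" "map_coeffs jet_tangent ms = dm"
    unfolding map_coeffs_def us_def ms_def g_def u_def m_def u_series_def m_series_def
    by (simp_all add: fps_eq_iff sign times_jet_def sign_cancel ring_mapD[OF h(1)] ring_map_power_sign[OF h(1)])
  have jet0: "F = 0" if "map_coeffs (map_coeffs jet_body) F = 0" "map_coeffs (map_coeffs jet_tangent) F = 0"
    for F :: "'b jet fps fps"
    using that by (auto simp: fps_eq_iff map_coeffs_def zero_jet_def intro: jet.expand)
  have \<phi>': "jet_body (\<phi> c) = h (scalar c)" "jet_tangent (\<phi> c) = 0" for c by (simp_all add: \<phi>_def)
  have body: "map_coeffs (map_coeffs h) (exchange_relation c f) = 0"
    if "exchange_relation c f = 0" for c f
    using that ring_mapD(4)[OF ring_map_map_coeffs[OF ring_map_map_coeffs[OF h(1)]]] by simp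
  have body': "map_coeffs (map_coeffs h) (mixed_relation c f g) = 0"
    if "mixed_relation c f g = 0" for c f g
    using that ring_mapD(4)[OF ring_map_map_coeffs[OF ring_map_map_coeffs[OF h(1)]]] by simp
  note b = exchange_relations_qalg(1,2)[THEN body, unfolded map_coeffs_exchange_relation[OF h(1)]]
    exchange_relations_qalg(3)[THEN body', unfolded map_coeffs_exchange_relation[OF h(1)]]
  note t = derivation_exchange_relation[OF ring_map_jet_body derivation_along_jet_tangent \<phi>'(2), unfolded us \<phi>']
  obtain \<Psi> where \<Psi>: "ring_map \<Psi>" "\<And>c. \<Psi> (scalar c) = \<phi> c" "\<And>a. \<Psi> (generator a) = g a"
  proof (rule qalg_universal[OF \<phi> c\<phi>, of g])
    show "exchange_relation (\<phi> (q_pow 1)) (Abs_fps (\<lambda>i. (- 1) ^ i * g (GenU i))) = 0"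
      unfolding us_def[symmetric]
      by (rule jet0)
        (use b(1) uu in \<open>simp_all add: map_coeffs_exchange_relation[OF ring_map_jet_body] us \<phi>' t u_def[symmetric] q_def\<close>)
    show "exchange_relation (\<phi> (q_pow (- 1))) (Abs_fps (\<lambda>i. (- 1) ^ i * g (GenM i))) = 0"
      unfolding ms_def[symmetric]
      by (rule jet0)
        (use b(2) mm in \<open>simp_all add: map_coeffs_exchange_relation[OF ring_map_jet_body] us \<phi>' t m_def[symmetric] q_def\<close>)
    show "mixed_relation (\<phi> (q_pow (- 1))) (Abs_fps (\<lambda>i. (- 1) ^ i * g (GenU i))) (Abs_fps (\<lambda>i. (- 1) ^ i * g (GenM i))) = 0"
      unfolding us_def[symmetric] ms_def[symmetric]
      by (rule jet0)
        (use b(3) um in \<open>simp_all add: map_coeffs_exchange_relation[OF ring_map_jet_body] us \<phi>' t m_def[symmetric] u_def[symmetric] q_def\<close>)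
  qed blast
  have \<Psi>h: "jet_body (\<Psi> a) = h a" for a
    by (induction a rule: qalg_induct)
      (simp_all add: \<Psi> \<phi>' g_def ring_mapD[OF \<Psi>(1)] ring_mapD[OF h(1)] ring_mapD[OF ring_map_jet_body] split: gen.split)
  define D where "D = (\<lambda>a. jet_tangent (\<Psi> a))"
  have "derivation_along h D"
    unfolding derivation_along_def D_def
    by (simp add: ring_mapD[OF \<Psi>(1)] derivation_alongD[OF derivation_along_jet_tangent] \<Psi>h)
  moreover have "D (scalar c) = 0" for c by (simp add: D_def \<Psi> \<phi>')
  moreover have "map_coeffs D u_series = du" "map_coeffs D m_series = dm"
    unfolding map_coeffs_def D_def u_series_def m_series_def
    by (simp_all add: fps_eq_iff ring_mapD[OF \<Psi>(1)] ring_map_power_sign[OF \<Psi>(1)] \<Psi> g_def sign times_jet_def sign_cancel)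
  ultimately show ?thesis using that by blast
qed

section \<open>Power series in several central variables\<close>

lemma central_fps_const: "central c \<Longrightarrow> central (fps_const c)"
  unfolding central_def by (simp add: fps_eq_iff)

lemma central_fps_X: "central (fps_X :: 'a::ring_1 fps)"
  unfolding central_def by (simp add: fps_mult_fps_X_commute)

lemma central_lambda_inv: "central lambda_inv" and central_mu_inv: "central mu_inv"
  unfolding lambda_inv_def mu_inv_def at_mu_def by (intro central_fps_X central_fps_const)+

lemma ring_map_fps_const: "ring_map fps_const"
  by (simp add: ring_map_def fps_const_add fps_const_mult)

lemma at_lambda_eq_map_coeffs: "at_lambda = map_coeffs fps_const"
  by (rule ext) (simp add: at_lambda_def map_coeffs_def)

lemma ring_map_at_lambda: "ring_map at_lambda"
  unfolding at_lambda_eq_map_coeffs by (rule ring_map_map_coeffs[OF ring_map_fps_const])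

lemma at_mu_eq_const: "at_mu = fps_const" by (rule ext) (simp add: at_mu_def)

lemma ring_map_at_mu: "ring_map at_mu"
  unfolding at_mu_eq_const by (rule ring_map_fps_const)

lemma at_lambda_simps: "at_lambda lambda_inv = lambda_inv" "at_lambda (fps_const a) = fps_const (fps_const a)"
  "at_lambda mu_inv = fps_const (fps_const fps_X)" "at_mu lambda_inv = mu_inv"
  unfolding at_lambda_def lambda_inv_def mu_inv_def at_mu_def by (simp_all add: fps_eq_iff fps_X_def)

lemma fps_const_cancel:
  fixes c :: "'a::ring_1"
  assumes "\<And>w. c * w = 0 \<Longrightarrow> w = 0" "fps_const c * F = 0"
  shows "F = 0"
proof (rule fps_ext)
  fix n
  show "fps_nth F n = fps_nth 0 n"
    using assms(1)[of "fps_nth F n"] arg_cong[OF assms(2), of "\<lambda>G. fps_nth G n"] by simp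
qed

lemma fps_X_minus_const_cancel:
  fixes c :: "'a::ring_1"
  assumes "\<And>w. c * w = 0 \<Longrightarrow> w = 0" "(fps_X - fps_const c) * F = 0"
  shows "F = 0"
proof -
  have eq: "(if n = 0 then 0 else fps_nth F (n - 1)) - c * fps_nth F n = 0" for n
    using arg_cong[OF assms(2), of "\<lambda>G. fps_nth G n"] by (simp add: left_diff_distrib)
  have "fps_nth F n = 0" for n
  proof (induction n)
    case 0
    show ?case by (rule assms(1)) (use eq[of 0] in simp)
  next
    case (Suc n)
    show ?case by (rule assms(1)) (use eq[of "Suc n"] Suc in simp)
  qed
  then show ?thesis by (simp add: fps_eq_iff)
qed

section \<open>Inverses and cancellation of series\<close>

lemma fps_inverse_exists:
  fixes F :: "'a::ring_1 fps"
  assumes "fps_nth F 0 * y = 1" "y * fps_nth F 0 = 1"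
  shows "\<exists>G. F * G = 1 \<and> G * F = 1"
proof -
  have 1: "F * fps_right_inverse F y = 1" by (rule fps_right_inverse[OF assms(1)])
  have 2: "fps_left_inverse F y * F = 1" by (rule fps_left_inverse[OF assms(2)])
  have "fps_left_inverse F y = fps_left_inverse F y * (F * fps_right_inverse F y)" unfolding 1 by simp
  also have "\<dots> = fps_right_inverse F y" unfolding mult.assoc[symmetric] 2 by simp
  finally show ?thesis using 1 2 by metis
qed

lemma fps_right_inverse_two_sided:
  fixes F :: "'a::ring_1 fps"
  assumes "fps_nth F 0 = 1"
  shows "F * fps_right_inverse F 1 = 1" "fps_right_inverse F 1 * F = 1"
proof -
  show 1: "F * fps_right_inverse F 1 = 1" by (rule fps_right_inverse) (simp add: assms)
  obtain G where "G * F = 1" using fps_inverse_exists[of F 1] assms by auto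
  then have "G = fps_right_inverse F 1"
    using arg_cong[OF 1, of "\<lambda>H. G * H"] by (simp add: mult.assoc[symmetric])
  with \<open>G * F = 1\<close> show "fps_right_inverse F 1 * F = 1" by simp
qed

text \<open>The innermost variable will be the parameter of the flow. Every inverse in the flow is
  that of 1 plus a series divisible by this variable.\<close>

definition innermost_ideal :: "'a::ring_1 fps fps fps set" where
  "innermost_ideal = {F. \<forall>i j. fps_nth (fps_nth (fps_nth F i) j) 0 = 0}"

lemma small_ideal_innermost: "small_ideal innermost_ideal"
  unfolding small_ideal_def
proof (intro conjI ballI allI)
  fix v :: "'a fps fps fps" assume v: "v \<in> innermost_ideal"
  then have "fps_nth (fps_nth (fps_nth (1 + v) 0) 0) 0 = 1" by (simp add: innermost_ideal_def)
  then obtain G where "fps_nth (fps_nth (1 + v) 0) 0 * G = 1 \<and> G * fps_nth (fps_nth (1 + v) 0) 0 = 1"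
    using fps_inverse_exists[of "fps_nth (fps_nth (1 + v) 0) 0" 1] by auto
  then obtain G where "fps_nth (1 + v) 0 * G = 1 \<and> G * fps_nth (1 + v) 0 = 1"
    using fps_inverse_exists by blast
  then show "\<exists>w. (1 + v) * w = 1 \<and> w * (1 + v) = 1" using fps_inverse_exists by blast
  fix w :: "'a fps fps fps"
  show "v * w \<in> innermost_ideal" "w * v \<in> innermost_ideal"
    using v by (simp_all add: innermost_ideal_def fps_mult_nth fps_sum_nth)
qed (simp add: innermost_ideal_def)

text \<open>\<open>lambda_inv - mu_inv\<close> does not involve the innermost variable, so
  multiplication by it acts on each innermost degree \<open>k\<close> separately, and it is
  injective there.\<close>

lemma diff_mult_innermost_cancel:
  fixes F :: "'a::ring_1 fps fps fps"
  assumes "\<And>i j. fps_nth (fps_nth (fps_nth ((lambda_inv - mu_inv) * F) i) j) k = 0"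
  shows "fps_nth (fps_nth (fps_nth F i) j) k = 0"
proof -
  have eq: "(if i = 0 then 0 else fps_nth (fps_nth (fps_nth F (i - 1)) j) k)
      - (if j = 0 then 0 else fps_nth (fps_nth (fps_nth F i) (j - 1)) k) = 0" for i j
    using assms[of i j] unfolding diff_mult_nth by (simp split: if_splits)
  have "\<forall>j. fps_nth (fps_nth (fps_nth F i) j) k = 0"
  proof (induction i)
    case 0
    show ?case using eq[of 0 "Suc _"] by auto
  next
    case (Suc i)
    then show ?case using eq[of "Suc i" "Suc _"] by auto
  qed
  then show ?thesis by blast
qed

text \<open>Multiplication by \<open>v\<close> raises the innermost degree: in degree
  \<open>k\<close> it involves only coefficients of \<open>F\<close> of lower degree, which vanish
  by induction. The second version serves the relation that is treated in the opposite ring.\<close>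

lemma diff_plus_small_cancel:
  fixes F v :: "'a::ring_1 fps fps fps"
  assumes v: "v \<in> innermost_ideal"
  shows "(lambda_inv - mu_inv + v) * F = 0 \<Longrightarrow> F = 0"
    and "F * (lambda_inv - mu_inv + v) = 0 \<Longrightarrow> F = 0"
proof -
  have zero: "F = 0"
    if step: "\<And>i j k. (\<And>l a b. l < k \<Longrightarrow> fps_nth (fps_nth (fps_nth F a) b) l = 0) \<Longrightarrow>
      fps_nth (fps_nth (fps_nth ((lambda_inv - mu_inv) * F) i) j) k = 0"
  proof -
    have "\<forall>i j. fps_nth (fps_nth (fps_nth F i) j) k = 0" for k
      by (induction k rule: less_induct) (blast intro: diff_mult_innermost_cancel step)
    then show ?thesis by (simp add: fps_eq_iff)
  qed
  have v0: "fps_nth (fps_nth (fps_nth v a) b) l * fps_nth (fps_nth (fps_nth F c) d) (k - l) = 0"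
    "fps_nth (fps_nth (fps_nth F c) d) l * fps_nth (fps_nth (fps_nth v a) b) (k - l) = 0"
    if "\<And>l a b. l < k \<Longrightarrow> fps_nth (fps_nth (fps_nth F a) b) l = 0" "l \<le> k" for a b c d k l
  proof -
    show "fps_nth (fps_nth (fps_nth v a) b) l * fps_nth (fps_nth (fps_nth F c) d) (k - l) = 0"
      using v that(1)[of "k - l"] that(2) by (cases "l = 0"; auto simp: innermost_ideal_def)
    show "fps_nth (fps_nth (fps_nth F c) d) l * fps_nth (fps_nth (fps_nth v a) b) (k - l) = 0"
      using v that(1)[of l] that(2) by (cases "l = k"; auto simp: innermost_ideal_def)
  qed
  have comm: "F * (lambda_inv - mu_inv) = (lambda_inv - mu_inv) * F"
    by (simp add: left_diff_distrib right_diff_distrib central_swap[OF central_lambda_inv]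
        central_swap[OF central_mu_inv, of F])
  show "F = 0" if "(lambda_inv - mu_inv + v) * F = 0"
  proof (rule zero)
    fix i j k assume l: "\<And>l a b. l < k \<Longrightarrow> fps_nth (fps_nth (fps_nth F a) b) l = 0"
    have "fps_nth (fps_nth (fps_nth (v * F) i) j) k = 0"
      using v0(1)[OF l] by (simp add: fps_mult_nth fps_sum_nth)
    moreover have "(lambda_inv - mu_inv) * F = - (v * F)"
      using that by (simp add: distrib_right eq_neg_iff_add_eq_0)
    ultimately show "fps_nth (fps_nth (fps_nth ((lambda_inv - mu_inv) * F) i) j) k = 0" by simp
  qed
  show "F = 0" if "F * (lambda_inv - mu_inv + v) = 0"
  proof (rule zero)
    fix i j k assume l: "\<And>l a b. l < k \<Longrightarrow> fps_nth (fps_nth (fps_nth F a) b) l = 0"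
    have "fps_nth (fps_nth (fps_nth (F * v) i) j) k = 0"
      using v0(2)[OF l] by (simp add: fps_mult_nth fps_sum_nth)
    moreover have "(lambda_inv - mu_inv) * F = - (F * v)"
      using that unfolding comm[symmetric] by (simp add: distrib_left eq_neg_iff_add_eq_0)
    ultimately show "fps_nth (fps_nth (fps_nth ((lambda_inv - mu_inv) * F) i) j) k = 0" by simp
  qed
qed

section \<open>Series whose coefficients q-commute\<close>

lemma q_commute_fps:
  assumes "\<And>i j. fps_nth F i * fps_nth G j = c * (fps_nth G j * fps_nth F i)" "central c"
  shows "F * G = fps_const c * (G * F)"
proof (rule fps_ext)
  fix n
  have "(\<Sum>i=0..n. fps_nth F i * fps_nth G (n - i)) = (\<Sum>i=0..n. fps_nth F (n - i) * fps_nth G i)"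
    by (rule sum.reindex_bij_witness[of _ "\<lambda>i. n - i" "\<lambda>i. n - i"]) auto
  then show "fps_nth (F * G) n = fps_nth (fps_const c * (G * F)) n"
    unfolding fps_mult_left_const_nth by (simp add: fps_mult_nth sum_distrib_left assms(1))
qed

text \<open>Two series q-commute as soon as all their coefficients do. So for difference quotients
  and embedded series it suffices to know that their coefficients are, up to zero, coefficients of
  \<open>u\<close> or of \<open>m\<close>.\<close>

definition coeffs_in :: "'a::zero set \<Rightarrow> 'a fps set" where
  "coeffs_in A = {F. \<forall>i. fps_nth F i \<in> A}"

lemma q_commute_coeffs_in:
  assumes "\<And>a b. a \<in> A \<Longrightarrow> b \<in> B \<Longrightarrow> a * b = c * (b * a)" "central c"
    and "F \<in> coeffs_in A" "G \<in> coeffs_in B"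
  shows "F * G = fps_const c * (G * F)"
  using assms by (intro q_commute_fps) (auto simp: coeffs_in_def)

definition shifted_quotient :: "'a::ring_1 fps \<Rightarrow> 'a fps fps" where
  "shifted_quotient f = Abs_fps (\<lambda>i. Abs_fps (\<lambda>j. fps_nth f (Suc (i + j))))"

lemma coeffs_in_intros:
  fixes A :: "'a::ring_1 set"
  assumes "0 \<in> A"
  shows "0 \<in> coeffs_in A" "a \<in> A \<Longrightarrow> fps_const a \<in> coeffs_in A"
    "F \<in> coeffs_in A \<Longrightarrow> fps_X * F \<in> coeffs_in A"
    "F \<in> coeffs_in A \<Longrightarrow> shifted_quotient F \<in> coeffs_in (coeffs_in A)"
    "F \<in> coeffs_in A \<Longrightarrow> at_lambda F \<in> coeffs_in (coeffs_in A)"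
    "F \<in> coeffs_in A \<Longrightarrow> at_mu F \<in> coeffs_in (coeffs_in A)"
    "G \<in> coeffs_in (coeffs_in A) \<Longrightarrow> mu_inv * G \<in> coeffs_in (coeffs_in A)"
  using assms
  by (auto simp: coeffs_in_def shifted_quotient_def at_lambda_def at_mu_def mu_inv_def)

lemma shifted_quotient:
  "(lambda_inv - mu_inv) * shifted_quotient f = at_lambda f - at_mu f"
  unfolding shifted_quotient_def by (rule diff_dvd_at_lambda_minus_at_mu)

lemma at_lambda_eq_shifted_quotient:
  "at_lambda f = at_mu f + lambda_inv * shifted_quotient f - mu_inv * shifted_quotient f"
  using shifted_quotient[of f] by (simp add: algebra_simps)

text \<open>The two differences in the relation are \<open>d * r\<close> and \<open>d * p\<close>,
  so the relation is the claim multiplied by \<open>d * d\<close>, with \<open>d\<close> central and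
  cancellable.\<close>

lemma shifted_quotient_exchange:
  fixes f :: "'a::ring_1 fps"
  assumes "exchange_relation c f = 0" "central c"
  defines "r \<equiv> shifted_quotient f" and "C \<equiv> fps_const (fps_const c)"
  defines "p \<equiv> at_mu f + lambda_inv * r"
  shows "p * r = C * (r * p)"
proof -
  have C: "central C" unfolding C_def by (intro central_fps_const assms)
  define d :: "'a fps fps" where "d = lambda_inv - mu_inv"
  have d: "central d" unfolding d_def by (intro central_closed central_lambda_inv central_mu_inv)
  have 1: "at_lambda f - at_mu f = d * r" unfolding d_def r_def shifted_quotient ..
  have 2: "lambda_inv * at_lambda f - mu_inv * at_mu f = d * p"
    unfolding p_def at_lambda_eq_shifted_quotient[of f] r_def[symmetric] d_def
    by (simp add: algebra_simps central_left_swap[OF central_mu_inv, of lambda_inv])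
  have "d * (d * (p * r)) = d * (d * (C * (r * p)))"
    using assms(1) unfolding exchange_relation_def 1 2 C_def[symmetric]
    by (simp add: mult.assoc central_left_swap[OF d, of p] central_left_swap[OF d, of r] central_left_swap[OF d, of C])
  then show ?thesis unfolding d_def by (blast dest: diff_mult_cancel)
qed

section \<open>The flow\<close>

text \<open>In the exchange lemmas for \<open>u\<close> and for the mixed relation,
  \<open>um_inverse\<close> is \<open>Q\<close> and \<open>mu_inverse\<close> is \<open>Q'\<close>,
  with \<open>fps_X * m_series\<close> in the role of \<open>m\<close>.\<close>

definition um_inverse :: "qalg fps" where
  "um_inverse = fps_right_inverse (1 + u_series * (fps_X * m_series)) 1"

definition mu_inverse :: "qalg fps" where
  "mu_inverse = fps_right_inverse (1 + fps_X * m_series * u_series) 1"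

lemma um_inverse: "(1 + u_series * (fps_X * m_series)) * um_inverse = 1" "um_inverse * (1 + u_series * (fps_X * m_series)) = 1"
  and mu_inverse: "(1 + fps_X * m_series * u_series) * mu_inverse = 1" "mu_inverse * (1 + fps_X * m_series * u_series) = 1"
  unfolding um_inverse_def mu_inverse_def by (rule fps_right_inverse_two_sided, simp)+

text \<open>The prescribed value of \<open>H_mu\<close> with the division carried out,
  \<open>v\<close> written as \<open>- (fps_X * m_series * um_inverse)\<close>, and
  \<open>1 + v * u\<close> as \<open>mu_inverse\<close>.\<close>

definition u_flow :: "qalg fps fps" where
  "u_flow = - ((at_mu u_series + lambda_inv * shifted_quotient u_series) * at_mu (fps_X * m_series)
       * at_mu um_inverse * at_lambda u_series
     + mu_inv * shifted_quotient u_series * at_mu mu_inverse)"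

definition m_flow :: "qalg fps fps" where
  "m_flow = at_lambda m_series * at_mu um_inverse * at_mu (fps_X * u_series)
       * (at_mu m_series + lambda_inv * shifted_quotient m_series)
     + mu_inv * at_mu mu_inverse * shifted_quotient m_series"

section \<open>Series in three variables\<close>

text \<open>
  In \<^typ>\<open>qalg fps fps fps\<close> the outermost variable is \<^const>\<open>lambda_inv\<close>, the middle one \<^const>\<open>mu_inv\<close>,
  and the innermost one, \<open>const3 fps_X\<close>, is the parameter of the flow.
\<close>

abbreviation const3 :: "'a::ring_1 fps \<Rightarrow> 'a fps fps fps" where
  "const3 f \<equiv> fps_const (fps_const f)"

definition q3 :: "int \<Rightarrow> qalg fps fps fps" where
  "q3 k = const3 (fps_const (scalar (q_pow k)))"

lemma central_q3: "central (q3 k)"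
  unfolding q3_def by (intro central_fps_const central_scalar)

lemma q_pow_mult: "q_pow 1 * q_pow (- 1) = 1" "q_pow (- 1) * q_pow 1 = 1"
  unfolding q_pow_def by (simp_all add: mult_single)

lemma q3_inverse: "q3 1 * q3 (- 1) = 1" "q3 (- 1) * q3 1 = 1"
  unfolding q3_def fps_const_mult scalar_hom(2)[symmetric] q_pow_mult by (simp_all add: scalar_hom)

definition coeffs3 :: "qalg fps \<Rightarrow> qalg fps fps fps set" where
  "coeffs3 f = coeffs_in (coeffs_in (coeffs_in (insert 0 (range (fps_nth f)))))"

lemma mixed_coeffs:
  "fps_nth m_series j * fps_nth u_series i = scalar (q_pow 1) * (fps_nth u_series i * fps_nth m_series j)"
proof -
  have "fps_nth (fps_nth (mixed_relation (scalar (q_pow (- 1))) u_series m_series) i) j = 0"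
    unfolding exchange_relations_qalg by simp
  then have "fps_nth u_series i * fps_nth m_series j = scalar (q_pow (- 1)) * (fps_nth m_series j * fps_nth u_series i)"
    by (simp add: mixed_relation_def at_lambda_def at_mu_def)
  then show ?thesis by (simp add: mult.assoc[symmetric] scalar_hom(2)[symmetric] q_pow_mult scalar_hom(1))
qed

lemma mixed_commute:
  assumes "F \<in> coeffs3 m_series" "G \<in> coeffs3 u_series"
  shows "F * G = q3 1 * (G * F)"
  using assms unfolding coeffs3_def q3_def
  by (rule q_commute_coeffs_in[rotated 2])
    ((rule q_commute_coeffs_in, auto intro!: central_fps_const central_scalar simp: mixed_coeffs)+)?

lemma const3_in_coeffs3: "f \<in> coeffs_in (insert 0 (range (fps_nth g))) \<Longrightarrow> const3 f \<in> coeffs3 g"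
  unfolding coeffs3_def by (intro coeffs_in_intros) auto

lemma self_in_coeffs_in: "f \<in> coeffs_in (insert 0 (range (fps_nth f)))"
  by (auto simp: coeffs_in_def)

lemma in_coeffs3:
  "const3 f \<in> coeffs3 f" "const3 (fps_X * f) \<in> coeffs3 f"
  "at_lambda (shifted_quotient f) \<in> coeffs3 f" "at_mu (shifted_quotient f) \<in> coeffs3 f"
  "at_mu (mu_inv * shifted_quotient f) \<in> coeffs3 f"
proof -
  let ?A = "insert 0 (range (fps_nth f))"
  have z: "0 \<in> ?A" "0 \<in> coeffs_in ?A" by (auto simp: coeffs_in_def)
  note f = self_in_coeffs_in[of f]
  have s: "shifted_quotient f \<in> coeffs_in (coeffs_in ?A)" by (rule coeffs_in_intros(4)[OF z(1) f])
  show "const3 f \<in> coeffs3 f" by (rule const3_in_coeffs3[OF f])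
  show "const3 (fps_X * f) \<in> coeffs3 f" by (intro const3_in_coeffs3 coeffs_in_intros(3)[OF z(1)] f)
  show "at_lambda (shifted_quotient f) \<in> coeffs3 f" "at_mu (shifted_quotient f) \<in> coeffs3 f"
    unfolding coeffs3_def by (intro coeffs_in_intros(5,6)[OF z(2)] s)+
  show "at_mu (mu_inv * shifted_quotient f) \<in> coeffs3 f"
    unfolding coeffs3_def by (intro coeffs_in_intros(6)[OF z(2)] coeffs_in_intros(7)[OF z(1)] s)
qed

lemma const3_hom: "const3 (f + g) = const3 f + const3 g" "const3 (f * g) = const3 f * const3 g" "const3 1 = 1"
  by (simp_all add: fps_const_add fps_const_mult)

lemma const3_inverse:
  "(1 + const3 u_series * const3 (fps_X * m_series)) * const3 um_inverse = 1"
  "const3 um_inverse * (1 + const3 u_series * const3 (fps_X * m_series)) = 1"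
  "(1 + const3 (fps_X * m_series) * const3 u_series) * const3 mu_inverse = 1"
  "const3 mu_inverse * (1 + const3 (fps_X * m_series) * const3 u_series) = 1"
  unfolding const3_hom(3)[symmetric] const3_hom(1,2)[symmetric] um_inverse mu_inverse by (rule refl)+

lemma central_z3: "central (const3 fps_X)" by (intro central_fps_const central_fps_X)

lemma at_mu_simps: "at_mu (at_mu f) = const3 f" "at_mu mu_inv = const3 fps_X" "at_lambda (at_mu f) = const3 f"
  unfolding mu_inv_def by (simp_all add: at_mu_def at_lambda_simps)

lemma at_mu_const: "at_mu (fps_const a) = fps_const (fps_const a)"
  by (simp add: at_mu_def)

lemma cancel3:
  fixes w :: "'a::ring_1 fps fps fps"
  shows "(lambda_inv - mu_inv) * w = 0 \<Longrightarrow> w = 0" "(lambda_inv - const3 fps_X) * w = 0 \<Longrightarrow> w = 0"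
    "(mu_inv - const3 fps_X) * w = 0 \<Longrightarrow> w = 0" "lambda_inv * w = 0 \<Longrightarrow> w = 0" "mu_inv * w = 0 \<Longrightarrow> w = 0"
    "const3 fps_X * w = 0 \<Longrightarrow> w = 0"
proof -
  have X: "fps_X * f = 0 \<Longrightarrow> f = 0" for f :: "'b::ring_1 fps" by (rule fps_X_mult_eq_0)
  have cX: "fps_const fps_X * f = 0 \<Longrightarrow> f = 0" for f :: "'b::ring_1 fps fps" by (rule fps_const_cancel[OF X])
  have XcX: "(fps_X - fps_const fps_X) * f = 0 \<Longrightarrow> f = 0" for f :: "'b::ring_1 fps fps"
    by (rule fps_X_minus_const_cancel[OF X])
  show "(lambda_inv - mu_inv) * w = 0 \<Longrightarrow> w = 0"
    unfolding lambda_inv_def mu_inv_def at_mu_def by (rule XcX)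
  show "(lambda_inv - const3 fps_X) * w = 0 \<Longrightarrow> w = 0"
    unfolding lambda_inv_def by (rule fps_X_minus_const_cancel[OF cX])
  show "(mu_inv - const3 fps_X) * w = 0 \<Longrightarrow> w = 0"
    unfolding mu_inv_def at_mu_def fps_const_sub by (rule fps_const_cancel[OF XcX])
  show "lambda_inv * w = 0 \<Longrightarrow> w = 0" unfolding lambda_inv_def by (rule X)
  show "mu_inv * w = 0 \<Longrightarrow> w = 0" unfolding mu_inv_def at_mu_def by (rule cX)
  show "const3 fps_X * w = 0 \<Longrightarrow> w = 0" by (rule fps_const_cancel[OF cX])
qed

lemma small_const3: "const3 (fps_X * f) \<in> innermost_ideal"
  by (simp add: innermost_ideal_def)

lemma exchange_relation_level:
  "exchange_relation c f = 0 \<Longrightarrow> exchange_relation (fps_const c) (at_lambda f) = 0"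
  "mixed_relation c f g = 0 \<Longrightarrow> mixed_relation (fps_const c) (at_lambda f) (at_lambda g) = 0"
  unfolding at_lambda_eq_map_coeffs map_coeffs_exchange_relation[OF ring_map_fps_const, symmetric]
  using ring_mapD(4)[OF ring_map_map_coeffs[OF ring_map_map_coeffs[OF ring_map_fps_const]]] by simp_all

lemmas at_lambda_hom = ring_mapD[OF ring_map_at_lambda]
lemmas at_mu_hom = ring_mapD[OF ring_map_at_mu]

text \<open>Expansion around the parameter \<open>z\<close> of the flow,
  \<open>f(x) = f(z) + (x - z) r(x, z)\<close>, with \<open>x\<close> the outer or the middle
  variable. It brings the series into the shape \<open>p - z * r\<close> of the abstract
  lemmas.\<close>

lemma at_lambda_at_lambda:
  "at_lambda (at_lambda f) = const3 f + lambda_inv * at_lambda (shifted_quotient f)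
     - const3 fps_X * at_lambda (shifted_quotient f)"
  "at_mu (at_lambda f) = const3 f + mu_inv * at_mu (shifted_quotient f)
     - const3 fps_X * at_mu (shifted_quotient f)"
  by (subst at_lambda_eq_shifted_quotient[of f], simp add: at_lambda_hom at_mu_hom at_mu_simps at_lambda_simps)+

lemma exchange3:
  assumes "exchange_relation (scalar (q_pow k)) f = 0"
  defines "r1 \<equiv> at_lambda (shifted_quotient f)" and "r2 \<equiv> at_mu (shifted_quotient f)"
  shows "(const3 f + lambda_inv * r1) * r1 = q3 k * (r1 * (const3 f + lambda_inv * r1))"
    "(const3 f + mu_inv * r2) * r2 = q3 k * (r2 * (const3 f + mu_inv * r2))"
proof -
  let ?r = "shifted_quotient f"
  have 0: "(at_mu f + lambda_inv * ?r) * ?r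
     = fps_const (fps_const (scalar (q_pow k))) * (?r * (at_mu f + lambda_inv * ?r))"
    by (rule shifted_quotient_exchange[OF assms(1) central_scalar])
  show "(const3 f + lambda_inv * r1) * r1 = q3 k * (r1 * (const3 f + lambda_inv * r1))"
    using arg_cong[OF 0, of at_lambda]
    by (simp add: at_lambda_hom at_mu_simps at_lambda_simps q3_def r1_def)
  show "(const3 f + mu_inv * r2) * r2 = q3 k * (r2 * (const3 f + mu_inv * r2))"
    using arg_cong[OF 0, of at_mu]
    by (simp add: at_mu_hom at_mu_simps at_lambda_simps q3_def r2_def at_mu_const)
qed

section \<open>The values of the flow satisfy the linearized relations\<close>

lemma u_flow_exchange:
  defines "u \<equiv> at_lambda u_series"
  shows "(lambda_inv * at_lambda u_flow - mu_inv * at_mu u_flow) * (at_lambda u - at_mu u)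
      + (lambda_inv * at_lambda u - mu_inv * at_mu u) * (at_lambda u_flow - at_mu u_flow)
      = q3 1 * ((at_lambda u_flow - at_mu u_flow) * (lambda_inv * at_lambda u - mu_inv * at_mu u)
        + (at_lambda u - at_mu u) * (lambda_inv * at_lambda u_flow - mu_inv * at_mu u_flow))"
proof -
  let ?r = "shifted_quotient u_series"
  define d1 where "d1 = (const3 u_series + lambda_inv * at_lambda ?r) * const3 (fps_X * m_series) * const3 um_inverse * at_lambda u
     + const3 fps_X * at_lambda ?r * const3 mu_inverse"
  define d2 where "d2 = (const3 u_series + mu_inv * at_mu ?r) * const3 (fps_X * m_series) * const3 um_inverse * at_mu u
     + const3 fps_X * at_mu ?r * const3 mu_inverse"
  have d: "at_lambda u_flow = - d1" "at_mu u_flow = - d2"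
    unfolding u_flow_def d1_def d2_def u_def
    by (simp_all add: at_lambda_hom at_mu_hom at_mu_simps at_lambda_simps)
  note u = u_def at_lambda_at_lambda[of u_series]
  have rel: "(lambda_inv * at_lambda u - mu_inv * at_mu u) * (at_lambda u - at_mu u)
      = q3 1 * ((at_lambda u - at_mu u) * (lambda_inv * at_lambda u - mu_inv * at_mu u))"
    using exchange_relation_level(1)[OF exchange_relations_qalg(1)]
    unfolding exchange_relation_def u_def q3_def by simp
  have "(lambda_inv * d1 - mu_inv * d2) * (at_lambda u - at_mu u)
      + (lambda_inv * at_lambda u - mu_inv * at_mu u) * (d1 - d2)
      = q3 1 * ((d1 - d2) * (lambda_inv * at_lambda u - mu_inv * at_mu u)
        + (at_lambda u - at_mu u) * (lambda_inv * d1 - mu_inv * d2))"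
    unfolding d1_def d2_def unfolding u
    by (rule exchange_relation_preserved[OF central_q3 central_lambda_inv central_mu_inv central_z3
          q3_inverse cancel3(1-5) small_ideal_innermost small_const3 diff_plus_small_cancel(1)
          exchange3[OF exchange_relations_qalg(1)] rel[unfolded u] _ _ _ const3_inverse])
      (assumption | rule mixed_commute in_coeffs3)+
  then show ?thesis unfolding d by (simp add: algebra_simps)
qed

lemma m_flow_exchange:
  defines "m \<equiv> at_lambda m_series"
  shows "(lambda_inv * at_lambda m_flow - mu_inv * at_mu m_flow) * (at_lambda m - at_mu m)
      + (lambda_inv * at_lambda m - mu_inv * at_mu m) * (at_lambda m_flow - at_mu m_flow)
      = q3 (- 1) * ((at_lambda m_flow - at_mu m_flow) * (lambda_inv * at_lambda m - mu_inv * at_mu m)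
        + (at_lambda m - at_mu m) * (lambda_inv * at_lambda m_flow - mu_inv * at_mu m_flow))"
proof -
  let ?r = "shifted_quotient m_series"
  define d1 where "d1 = at_lambda m * const3 um_inverse * const3 (fps_X * u_series) * (const3 m_series + lambda_inv * at_lambda ?r)
     + const3 fps_X * const3 mu_inverse * at_lambda ?r"
  define d2 where "d2 = at_mu m * const3 um_inverse * const3 (fps_X * u_series) * (const3 m_series + mu_inv * at_mu ?r)
     + const3 fps_X * const3 mu_inverse * at_mu ?r"
  have d: "at_lambda m_flow = d1" "at_mu m_flow = d2"
    unfolding m_flow_def d1_def d2_def m_def
    by (simp_all add: at_lambda_hom at_mu_hom at_mu_simps at_lambda_simps)
  note m = m_def at_lambda_at_lambda[of m_series]
  have rel: "(lambda_inv * at_lambda m - mu_inv * at_mu m) * (at_lambda m - at_mu m)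
      = q3 (- 1) * ((at_lambda m - at_mu m) * (lambda_inv * at_lambda m - mu_inv * at_mu m))"
    using exchange_relation_level(1)[OF exchange_relations_qalg(2)]
    unfolding exchange_relation_def m_def q3_def by simp
  \<comment> \<open>The relation of \<open>m\<close> expresses \<open>p * r\<close> through
    \<open>r * p\<close> with the inverse of \<open>q\<close>; the mirrored lemma expects it solved
    for \<open>r * p\<close>.\<close>
  have flip: "b = q3 1 * a" if "a = q3 (- 1) * b" for a b
    unfolding that mult.assoc[symmetric] q3_inverse by simp
  have X: "f * (fps_X * g) = fps_X * (f * g)" for f g :: "qalg fps"
    by (rule central_left_swap[OF central_fps_X])
  have inv: "(1 + const3 m_series * const3 (fps_X * u_series)) * const3 mu_inverse = 1"
    "const3 mu_inverse * (1 + const3 m_series * const3 (fps_X * u_series)) = 1"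
    "(1 + const3 (fps_X * u_series) * const3 m_series) * const3 um_inverse = 1"
    "const3 um_inverse * (1 + const3 (fps_X * u_series) * const3 m_series) = 1"
    using const3_inverse unfolding const3_hom(2)[symmetric] X mult.assoc by simp_all
  show ?thesis
    unfolding d unfolding d1_def d2_def unfolding m
    by (rule exchange_relation_preserved_mirror[OF central_q3 central_lambda_inv central_mu_inv central_z3
          q3_inverse cancel3(1-5) small_ideal_innermost small_const3 diff_plus_small_cancel(2)
          exchange3[OF exchange_relations_qalg(2), THEN flip] rel[unfolded m] _ _ _ inv])
      (assumption | rule mixed_commute in_coeffs3)+
qed

text \<open>\<open>mixed_relation_preserved\<close> wants the letters of \<open>m\<close> in the
  small ideal. It is therefore applied to \<open>Z\<close> times the series \<open>m\<close>, and
  \<open>Z\<close> is cancelled at the end.\<close>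

lemma mixed_flow_exchange:
  "at_lambda u_flow * at_mu (at_lambda m_series) + at_lambda (at_lambda u_series) * at_mu m_flow
    = q3 (- 1) * (at_mu m_flow * at_lambda (at_lambda u_series) + at_mu (at_lambda m_series) * at_lambda u_flow)"
proof -
  let ?r = "shifted_quotient u_series" and ?s = "shifted_quotient m_series"
  define b where "b = at_mu (mu_inv * ?s)"
  define X where "X = at_lambda (at_lambda u_series)"
  define Y where "Y = at_mu (at_lambda m_series)"
  define Z where "Z = (const3 fps_X :: qalg fps fps fps)"
  define dX where "dX = at_lambda u_flow"
  define dY where "dY = at_mu m_flow"
  note z = central_z3[where 'a = qalg, folded Z_def]
  have X: "const3 u_series + lambda_inv * at_lambda ?r - Z * at_lambda ?r = X"
    unfolding X_def Z_def at_lambda_at_lambda ..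
  have bZ: "b = Z * at_mu ?s" unfolding b_def Z_def by (simp add: at_mu_hom at_mu_simps)
  have mX: "const3 (fps_X * m_series) = Z * const3 m_series" unfolding Z_def const3_hom ..
  have a: "const3 (fps_X * m_series) + mu_inv * b = Z * (const3 m_series + mu_inv * at_mu ?s)"
    unfolding bZ mX by (simp add: distrib_left central_left_swap[OF z])
  have Y: "const3 (fps_X * m_series) + mu_inv * b - Z * b = Z * Y"
    unfolding a Y_def at_lambda_at_lambda Z_def[symmetric] unfolding bZ by (simp add: algebra_simps)
  have ba: "b * (const3 (fps_X * m_series) + mu_inv * b) = q3 1 * ((const3 (fps_X * m_series) + mu_inv * b) * b)"
  proof -
    have "at_mu ?s * (const3 m_series + mu_inv * at_mu ?s)
        = q3 1 * ((const3 m_series + mu_inv * at_mu ?s) * at_mu ?s)"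
      unfolding exchange3(2)[OF exchange_relations_qalg(2)] mult.assoc[symmetric] q3_inverse by simp
    then show ?thesis unfolding a unfolding bZ
      by (simp add: mult.assoc central_left_swap[OF z, of "at_mu ?s"] central_left_swap[OF z, of "q3 1"]
          central_left_swap[OF z, of "const3 m_series + mu_inv * at_mu ?s"])
  qed
  have dX: "(const3 u_series + lambda_inv * at_lambda ?r) * const3 (fps_X * m_series) * const3 um_inverse * X
     + Z * at_lambda ?r * const3 mu_inverse = - dX"
    unfolding dX_def u_flow_def X_def Z_def
    by (simp add: at_lambda_hom at_mu_simps at_lambda_simps)
  have QU: "const3 um_inverse * const3 u_series = const3 u_series * const3 mu_inverse"
    by (rule inverse_intertwine[OF _ const3_inverse(2,3)]) (simp add: algebra_simps)
  have dY: "- (Z * Y * const3 u_series * const3 mu_inverse * (Z * (const3 m_series + mu_inv * at_mu ?s))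
      + Z * const3 mu_inverse * b) = - (Z * dY)"
  proof -
    have uX: "const3 (fps_X * u_series) = Z * const3 u_series" unfolding Z_def const3_hom ..
    have "dY = Y * const3 um_inverse * const3 (fps_X * u_series) * (const3 m_series + mu_inv * at_mu ?s)
       + Z * const3 mu_inverse * at_mu ?s"
      unfolding dY_def m_flow_def Y_def Z_def
      by (simp add: at_mu_hom at_mu_simps at_lambda_simps)
    also have "\<dots> = Y * (const3 um_inverse * const3 u_series) * (Z * (const3 m_series + mu_inv * at_mu ?s))
       + Z * const3 mu_inverse * at_mu ?s"
      unfolding uX by (simp add: mult.assoc central_left_swap[OF z, of "const3 u_series"] del: fps_const_mult)
    finally show ?thesis unfolding QU bZ
      by (simp add: algebra_simps central_left_swap[OF z, of "const3 mu_inverse"] del: fps_const_mult)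
  qed
  have "- dX * (Z * Y) + X * - (Z * dY) = q3 (- 1) * (- (Z * dY) * X + Z * Y * - dX)"
  proof -
    have "b \<in> innermost_ideal"
      unfolding b_def by (simp add: innermost_ideal_def at_mu_def mu_inv_def)
    note r = mixed_relation_preserved[OF central_q3 central_lambda_inv central_mu_inv z
        q3_inverse small_ideal_innermost small_const3[of m_series] this _ _ _ _
        exchange3(1)[OF exchange_relations_qalg(1)] ba const3_inverse,
        unfolded X Y dX, unfolded a dY]
    show ?thesis
      by (rule r) (rule mixed_commute in_coeffs3 in_coeffs3(5)[of m_series, folded b_def])+
  qed
  then have "Z * (dX * Y + X * dY) = Z * (q3 (- 1) * (dY * X + Y * dX))"
    by (simp add: algebra_simps central_left_swap[OF z, of dX] central_left_swap[OF z, of X]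
        central_left_swap[OF z, of "q3 (- 1)"])
  then have "Z * (dX * Y + X * dY - q3 (- 1) * (dY * X + Y * dX)) = 0" by (simp add: right_diff_distrib)
  then have "dX * Y + X * dY - q3 (- 1) * (dY * X + Y * dX) = 0" unfolding Z_def by (rule cancel3(6))
  then show ?thesis unfolding dX_def dY_def X_def Y_def by simp
qed

section \<open>The derivations and their uniqueness\<close>

lemma flow_exists:
  "\<exists>D. derivation_along fps_const D \<and> (\<forall>c. D (scalar c) = 0) \<and>
    map_coeffs D u_series = u_flow \<and> map_coeffs D m_series = m_flow"
proof -
  note e = derivation_extend[OF ring_map_fps_const central_fps_const[OF central_scalar],
      of u_flow m_flow, folded at_lambda_eq_map_coeffs q3_def]
  obtain D where "derivation_along fps_const D" "\<And>c. D (scalar c) = 0"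
    "map_coeffs D u_series = u_flow" "map_coeffs D m_series = m_flow"
    by (rule e[OF u_flow_exchange m_flow_exchange mixed_flow_exchange]) blast
  then show ?thesis by blast
qed

text \<open>This is the generating series \<open>H_mu\<close> as a single derivation into series in
  the inverse of mu.\<close>

definition flow :: "qalg \<Rightarrow> qalg fps" where
  "flow = (SOME D. derivation_along fps_const D \<and> (\<forall>c. D (scalar c) = 0) \<and>
    map_coeffs D u_series = u_flow \<and> map_coeffs D m_series = m_flow)"

lemma derivation_along_flow: "derivation_along fps_const flow"
  and flow_scalar: "flow (scalar c) = 0"
  and flow_series: "map_coeffs flow u_series = u_flow" "map_coeffs flow m_series = m_flow"
  using someI_ex[OF flow_exists] unfolding flow_def[symmetric] by blast+

lemma flow_1: "flow 1 = 0"
  using flow_scalar[of 1] by (simp add: scalar_hom)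

text \<open>Every summand of the two values has a factor that is divisible by the inverse of mu.
  This is why the family can start at \<open>k = 1\<close>.\<close>

lemma flows_nth_0: "fps_nth (fps_nth u_flow i) 0 = 0" "fps_nth (fps_nth m_flow i) 0 = 0"
  by (simp_all add: u_flow_def m_flow_def fps_mult_nth fps_sum_nth at_mu_def mu_inv_def
      if_distrib[of "\<lambda>f. fps_nth f 0"] cong: if_cong)

definition flow_coeff :: "nat \<Rightarrow> qalg \<Rightarrow> qalg" where
  "flow_coeff k a = (- 1) ^ k * fps_nth (flow a) k"

lemma central_sign: "central ((- 1) ^ k)"
  by (induction k) (simp_all add: central_0_1 central_closed)

lemma flow_coeff_simps:
  "flow_coeff k (a + b) = flow_coeff k a + flow_coeff k b"
  "flow_coeff k (a * b) = flow_coeff k a * b + a * flow_coeff k b"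
  "flow_coeff k (scalar c) = 0"
  unfolding flow_coeff_def derivation_alongD[OF derivation_along_flow] flow_scalar
  by (simp_all add: distrib_left mult.assoc central_left_swap[OF central_sign, of a])

lemma derivation_flow_coeff: "derivation (flow_coeff k)"
  unfolding derivation_def by (simp add: flow_coeff_simps)

lemma H_mu_flow_coeff:
  assumes "\<And>i. fps_nth (fps_nth (map_coeffs flow f) i) 0 = 0"
  shows "H_mu flow_coeff f = map_coeffs flow f"
proof (intro fps_ext)
  fix i k
  show "fps_nth (fps_nth (H_mu flow_coeff f) i) k = fps_nth (fps_nth (map_coeffs flow f) i) k"
    using assms[of i] by (simp add: H_mu_def flow_coeff_def map_coeffs_def sign_cancel)
qed

lemma derivation_scalar: "derivation D \<Longrightarrow> D (scalar c) = 0"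
proof -
  assume D: "derivation D"
  then have "D (1 * 1) = D 1 * 1 + 1 * D 1" unfolding derivation_def by blast
  then have "D 1 = 0" by simp
  moreover have "D (scalar c * 1) = scalar c * D 1" using D unfolding derivation_def by blast
  ultimately show ?thesis by simp
qed

lemma derivations_eqI:
  assumes D: "derivation D" "derivation D'" and g: "\<And>g. D (generator g) = D' (generator g)"
  shows "D = D'"
proof
  fix a
  show "D a = D' a"
    by (induction a rule: qalg_induct)
      (use D g in \<open>simp_all add: derivation_scalar\<close>, simp_all add: derivation_def)
qed

lemma derivation_sign:
  assumes "derivation D"
  shows "D ((- 1) ^ i * a) = (- 1) ^ i * D a"
proof -
  have s: "(- 1) ^ i = scalar ((- 1) ^ i)"
  proof (induction i)
    case (Suc i)
    have "scalar (- 1) = - 1"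
      using scalar_hom(3)[of "- 1" 1] scalar_hom(3)[of 0 0] by (simp add: scalar_hom eq_neg_iff_add_eq_0)
    then show ?case using Suc by (simp add: scalar_hom del: mult_minus_left mult_minus1)
  qed (simp add: scalar_hom)
  show ?thesis unfolding s using assms unfolding derivation_def by blast
qed

text \<open>The coefficients of the two series are, up to sign, the values on all generators, and
  these determine a derivation over the scalars.\<close>

lemma H_mu_eq_derivations:
  assumes D: "\<And>n. n \<ge> 1 \<Longrightarrow> derivation (H n)" "\<And>n. n \<ge> 1 \<Longrightarrow> derivation (H' n)"
    and u: "H_mu H' u_series = H_mu H u_series" and m: "H_mu H' m_series = H_mu H m_series" and n: "n \<ge> 1"
  shows "H' n = H n"
proof (rule derivations_eqI[OF D(2,1)[OF n]])
  fix g
  have cancel: "a = b" if "(- 1) ^ n * ((- 1) ^ i * a) = (- 1) ^ n * ((- 1) ^ i * b)" for i and a b :: qalg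
    using arg_cong[OF that, of "\<lambda>w. (- 1) ^ i * ((- 1) ^ n * w)"] by (simp add: sign_cancel)
  show "H' n (generator g) = H n (generator g)"
  proof (cases g)
    case (GenU i)
    show ?thesis
      by (rule cancel[of i])
        (use arg_cong[OF u, of "\<lambda>F. fps_nth (fps_nth F i) n"] n in
          \<open>simp add: H_mu_def u_series_def derivation_sign[OF D(1)] derivation_sign[OF D(2)] GenU\<close>)
  next
    case (GenM i)
    show ?thesis
      by (rule cancel[of i])
        (use arg_cong[OF m, of "\<lambda>F. fps_nth (fps_nth F i) n"] n in
          \<open>simp add: H_mu_def m_series_def derivation_sign[OF D(1)] derivation_sign[OF D(2)] GenM\<close>)
  qed
qed

section \<open>Agreement with the prescribed formulas\<close>

lemma X_swap: "f * (fps_X * g) = fps_X * (f * (g :: 'a::ring_1 fps))"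
  by (rule central_left_swap[OF central_fps_X])

lemma um_inverse_intertwine:
  "um_inverse * u_series = u_series * mu_inverse" "mu_inverse * m_series = m_series * um_inverse"
  by (rule inverse_intertwine[OF _ um_inverse(2) mu_inverse(1)] inverse_intertwine[OF _ mu_inverse(2) um_inverse(1)],
      simp add: algebra_simps X_swap)+

lemma v_series_eq: "v_series = - (fps_X * m_series * um_inverse)"
  and w_series_eq: "w_series = - (fps_X * u_series * mu_inverse)"
  unfolding v_series_def w_series_def um_inverse_def mu_inverse_def by (simp_all add: mult.assoc X_swap)

text \<open>Both products equal \<open>- (z m u Q')\<close> with \<open>z = fps_X\<close> and
  \<open>Q' = mu_inverse\<close>; in the first one the inverse is moved to the right by
  \<open>Q u = u Q'\<close>.\<close>

lemma one_plus_vu: "1 + v_series * u_series = mu_inverse"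
  and one_plus_mw: "1 + m_series * w_series = mu_inverse"
proof -
  have "mu_inverse = 1 - fps_X * m_series * u_series * mu_inverse"
    using mu_inverse(1) by (simp add: algebra_simps)
  then show "1 + v_series * u_series = mu_inverse" "1 + m_series * w_series = mu_inverse"
    unfolding v_series_eq w_series_eq by (simp_all add: mult.assoc um_inverse_intertwine X_swap)
qed

lemma u_flow_formula:
  "u_flow = div_diff ((lambda_inv * at_lambda u_series - mu_inv * at_mu u_series)
                   * at_mu v_series * at_lambda u_series)
       - div_diff (mu_inv * (at_lambda u_series - at_mu u_series)
                   * (1 + at_mu v_series * at_mu u_series))"
proof -
  let ?r = "shifted_quotient u_series"
  let ?p = "at_mu u_series + lambda_inv * ?r"
  have p: "(lambda_inv - mu_inv) * ?p = lambda_inv * at_lambda u_series - mu_inv * at_mu u_series"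
    by (subst at_lambda_eq_shifted_quotient) (simp add: algebra_simps central_left_swap[OF central_mu_inv, of lambda_inv])
  have 1: "div_diff ((lambda_inv * at_lambda u_series - mu_inv * at_mu u_series) * at_mu v_series * at_lambda u_series)
      = ?p * at_mu v_series * at_lambda u_series"
    by (rule div_diff_eqI) (simp add: p[symmetric] mult.assoc)
  have 2: "div_diff (mu_inv * (at_lambda u_series - at_mu u_series) * (1 + at_mu v_series * at_mu u_series))
      = mu_inv * ?r * (1 + at_mu v_series * at_mu u_series)"
  proof (rule div_diff_eqI)
    have "(lambda_inv - mu_inv) * (mu_inv * ?r) = mu_inv * ((lambda_inv - mu_inv) * ?r)"
      by (rule central_left_swap[OF central_mu_inv])
    then show "(lambda_inv - mu_inv) * (mu_inv * ?r * (1 + at_mu v_series * at_mu u_series))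
        = mu_inv * (at_lambda u_series - at_mu u_series) * (1 + at_mu v_series * at_mu u_series)"
      unfolding shifted_quotient by (metis mult.assoc)
  qed
  have 3: "1 + at_mu v_series * at_mu u_series = at_mu mu_inverse"
    unfolding at_mu_hom(3,1)[symmetric] at_mu_hom(2)[symmetric] one_plus_vu[symmetric] by simp
  show ?thesis unfolding 1 2 unfolding 3 unfolding u_flow_def v_series_eq by (simp add: at_mu_hom algebra_simps)
qed

lemma m_flow_formula:
  "m_flow = div_diff (mu_inv * (1 + at_mu m_series * at_mu w_series)
                   * (at_lambda m_series - at_mu m_series))
       - div_diff (at_lambda m_series * at_mu w_series
                   * (lambda_inv * at_lambda m_series - mu_inv * at_mu m_series))"
proof -
  let ?r = "shifted_quotient m_series"
  let ?p = "at_mu m_series + lambda_inv * ?r"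
  have d: "(lambda_inv - mu_inv) * (F * G) = F * ((lambda_inv - mu_inv) * G)" for F G :: "qalg fps fps"
    by (rule central_left_swap[OF central_closed(2)[OF central_lambda_inv central_mu_inv], symmetric])
  have p: "(lambda_inv - mu_inv) * ?p = lambda_inv * at_lambda m_series - mu_inv * at_mu m_series"
    by (subst at_lambda_eq_shifted_quotient) (simp add: algebra_simps central_left_swap[OF central_mu_inv, of lambda_inv])
  have 1: "div_diff (at_lambda m_series * at_mu w_series * (lambda_inv * at_lambda m_series - mu_inv * at_mu m_series))
      = at_lambda m_series * at_mu w_series * ?p"
    by (rule div_diff_eqI) (simp only: d p)
  have 2: "div_diff (mu_inv * (1 + at_mu m_series * at_mu w_series) * (at_lambda m_series - at_mu m_series))
      = mu_inv * (1 + at_mu m_series * at_mu w_series) * ?r"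
    by (rule div_diff_eqI) (simp only: d shifted_quotient)
  have 3: "1 + at_mu m_series * at_mu w_series = at_mu mu_inverse"
    unfolding at_mu_hom(3,1)[symmetric] at_mu_hom(2)[symmetric] one_plus_mw[symmetric] by simp
  have 4: "w_series = - (um_inverse * (fps_X * u_series))"
    unfolding w_series_eq by (simp add: mult.assoc um_inverse_intertwine X_swap)
  show ?thesis unfolding 1 2 unfolding 3 unfolding m_flow_def 4 by (simp add: at_mu_hom algebra_simps)
qed

section \<open>Commutativity\<close>

definition swap_variables :: "'a::ring_1 fps fps \<Rightarrow> 'a fps fps" where
  "swap_variables F = Abs_fps (\<lambda>i. Abs_fps (\<lambda>j. fps_nth (fps_nth F j) i))"

text \<open>The restriction of a series to the diagonal, F(x, y) to F(x, x).\<close>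

definition merge_variables :: "'a::ring_1 fps fps \<Rightarrow> 'a fps" where
  "merge_variables F = Abs_fps (\<lambda>n. \<Sum>i=0..n. fps_nth (fps_nth F i) (n - i))"

lemma ring_map_swap_variables: "ring_map swap_variables"
  unfolding ring_map_def swap_variables_def
  by (auto simp: fps_eq_iff fps_mult_nth fps_sum_nth if_distrib[of "\<lambda>f. fps_nth f _"] cong: if_cong
      intro: sum.swap)

lemma ring_map_merge_variables: "ring_map merge_variables"
proof -
  have "merge_variables (F * G) = merge_variables F * merge_variables G" for F G :: "'a::ring_1 fps fps"
  proof (rule fps_ext)
    fix n
    let ?t = "\<lambda>a c b d. fps_nth (fps_nth F a) c * fps_nth (fps_nth G b) d"
    have "fps_nth (merge_variables (F * G)) n = (\<Sum>i=0..n. \<Sum>a=0..i. \<Sum>c=0..n-i. ?t a c (i - a) (n - i - c))"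
      by (simp add: merge_variables_def fps_mult_nth fps_sum_nth)
    also have "\<dots> = (\<Sum>(i, a, c)\<in>(SIGMA i:{0..n}. {0..i} \<times> {0..n-i}). ?t a c (i - a) (n - i - c))"
      by (simp add: sum.Sigma sum.cartesian_product split_def)
    \<comment> \<open>The new index \<open>k = a + c\<close> is the total degree taken from
      \<open>F\<close>, and \<open>b = i - a\<close> is the outer degree taken from
      \<open>G\<close>.\<close>
    also have "\<dots> = (\<Sum>(k, a, b)\<in>(SIGMA k:{0..n}. {0..k} \<times> {0..n-k}). ?t a (k - a) b (n - k - b))"
      by (rule sum.reindex_bij_witness[of _ "\<lambda>(k, a, b). (a + b, a, k - a)" "\<lambda>(i, a, c). (a + c, a, i - a)"])
        (auto simp: add.commute)
    also have "\<dots> = (\<Sum>k=0..n. \<Sum>a=0..k. \<Sum>b=0..n-k. ?t a (k - a) b (n - k - b))"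
      by (simp add: sum.Sigma sum.cartesian_product split_def)
    also have "\<dots> = fps_nth (merge_variables F * merge_variables G) n"
      by (simp add: merge_variables_def fps_mult_nth sum_product)
    finally show "fps_nth (merge_variables (F * G)) n = fps_nth (merge_variables F * merge_variables G) n" .
  qed
  moreover have "merge_variables 1 = (1 :: 'a fps)"
    by (auto simp: fps_eq_iff merge_variables_def if_distrib[of "\<lambda>f. fps_nth f _"] cong: if_cong)
  ultimately show ?thesis
    unfolding ring_map_def by (simp add: fps_eq_iff merge_variables_def sum.distrib)
qed

lemma derivation_along_compose:
  "ring_map T \<Longrightarrow> derivation_along h D \<Longrightarrow> derivation_along (\<lambda>a. T (h a)) (\<lambda>a. T (D a))"
  unfolding derivation_along_def by (simp add: ring_mapD)

text \<open>Here the parameter of the derivation is also the variable of the series it acts on.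
  Coefficientwise application yields two variables, which are then identified, so that the extension
  is linear over that variable.\<close>

definition extend_derivation :: "('a::ring_1 \<Rightarrow> 'a fps) \<Rightarrow> 'a fps \<Rightarrow> 'a fps" where
  "extend_derivation D f = merge_variables (map_coeffs D f)"

lemma derivation_along_extend:
  assumes "derivation_along fps_const D"
  shows "derivation_along (\<lambda>f. f) (extend_derivation D)"
proof -
  have "merge_variables (map_coeffs fps_const f) = f" for f :: "'a fps"
  proof (rule fps_ext)
    fix n
    have "fps_nth (merge_variables (map_coeffs fps_const f)) n = (\<Sum>i=0..n. if i = n then fps_nth f n else 0)"
      unfolding merge_variables_def by (auto simp: map_coeffs_def intro: sum.cong)
    then show "fps_nth (merge_variables (map_coeffs fps_const f)) n = fps_nth f n" by simp
  qed
  then show ?thesis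
    using derivation_along_compose[OF ring_map_merge_variables derivation_along_map_coeffs[OF assms]]
    by (simp add: extend_derivation_def[abs_def])
qed

lemma map_coeffs_fps_const: "h 0 = 0 \<Longrightarrow> map_coeffs h (fps_const a) = fps_const (h a)"
  by (simp add: fps_eq_iff map_coeffs_def)

lemma extend_derivation_const:
  assumes "derivation_along fps_const D"
  shows "extend_derivation D (fps_const a) = D a"
proof (rule fps_ext)
  fix n
  have "(\<Sum>i=0..n. fps_nth (fps_nth (fps_const (D a)) i) (n - i)) = (\<Sum>i=0..n. if i = 0 then fps_nth (D a) n else 0)"
    by (intro sum.cong) auto
  also have "\<dots> = fps_nth (D a) n" by simp
  finally show "fps_nth (extend_derivation D (fps_const a)) n = fps_nth (D a) n"
    by (simp add: extend_derivation_def merge_variables_def map_coeffs_fps_const derivation_alongD(3)[OF assms])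
qed

lemma extend_derivation_X:
  assumes "derivation_along fps_const D" "D 1 = 0"
  shows "extend_derivation D fps_X = 0"
proof -
  have "map_coeffs D fps_X = 0"
    by (simp add: fps_eq_iff map_coeffs_def fps_X_def derivation_alongD(3)[OF assms(1)] assms(2))
  then show ?thesis by (simp add: extend_derivation_def ring_mapD[OF ring_map_merge_variables])
qed

section \<open>The Riccati equations of the flow\<close>

text \<open>The entries of the idempotent matrix whose rows and columns solve the Riccati equations of the flow.\<close>

definition idem11 :: "qalg fps" where "idem11 = mu_inverse"
definition idem12 :: "qalg fps" where "idem12 = - (mu_inverse * (fps_X * m_series))"
definition idem21 :: "qalg fps" where "idem21 = - (u_series * mu_inverse)"
definition idem22 :: "qalg fps" where "idem22 = u_series * mu_inverse * (fps_X * m_series)"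
lemmas idem_defs = idem11_def idem12_def idem21_def idem22_def

text \<open>Multiplied by the difference of the variables, \<open>p\<close> and \<open>r\<close>
  become differences of values of \<open>u\<close>, and the factors at mu combine to entries of the
  idempotent. The sign is the one used in \<open>riccati_flows_commute\<close>.\<close>

lemma u_flow_riccati:
  "(lambda_inv - mu_inv) * - u_flow
    = - (lambda_inv * (at_lambda u_series * at_mu idem12 * at_lambda u_series))
      + mu_inv * (at_lambda u_series * at_mu idem11 - at_mu idem22 * at_lambda u_series + at_mu idem21)"
proof -
  let ?r = "shifted_quotient u_series"
  let ?p = "at_mu u_series + lambda_inv * ?r"
  have p: "(lambda_inv - mu_inv) * ?p = lambda_inv * at_lambda u_series - mu_inv * at_mu u_series"
    by (subst at_lambda_eq_shifted_quotient) (simp add: algebra_simps central_left_swap[OF central_mu_inv, of lambda_inv])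
  have r: "(lambda_inv - mu_inv) * (mu_inv * ?r) = mu_inv * (at_lambda u_series - at_mu u_series)"
    unfolding shifted_quotient[symmetric] by (rule central_left_swap[OF central_mu_inv])
  have mQ: "fps_X * m_series * um_inverse = mu_inverse * (fps_X * m_series)"
    by (simp add: mult.assoc um_inverse_intertwine X_swap)
  have "(lambda_inv - mu_inv) * - u_flow = (lambda_inv - mu_inv) * ?p * at_mu (fps_X * m_series * um_inverse) * at_lambda u_series
      + (lambda_inv - mu_inv) * (mu_inv * ?r) * at_mu mu_inverse"
  proof -
    have "d * - (- (P * A * B * C + R * E)) = d * P * (A * B) * C + d * R * E" for d P A B C R E :: "qalg fps fps"
      by (simp add: distrib_left mult.assoc)
    then show ?thesis unfolding u_flow_def at_mu_hom(3)[of "fps_X * m_series"] .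
  qed
  then show ?thesis unfolding p r mQ idem_defs at_mu_hom by (simp add: algebra_simps)
qed

lemma m_flow_riccati:
  defines "Y \<equiv> lambda_inv * at_lambda m_series"
  shows "(lambda_inv - mu_inv) * - (lambda_inv * m_flow)
    = - (mu_inv * (at_mu idem11 * Y)) - lambda_inv * at_mu idem12
      + mu_inv * (Y * at_mu idem21 * Y + Y * at_mu idem22)"
proof -
  let ?r = "shifted_quotient m_series"
  let ?p = "at_mu m_series + lambda_inv * ?r"
  note lx = central_left_swap[OF central_lambda_inv] and lz = central_left_swap[OF central_mu_inv]
  have d: "(lambda_inv - mu_inv) * (F * G) = F * ((lambda_inv - mu_inv) * G)" for F G :: "qalg fps fps"
    by (rule central_left_swap[OF central_closed(2)[OF central_lambda_inv central_mu_inv], symmetric])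
  have p: "(lambda_inv - mu_inv) * ?p = Y - mu_inv * at_mu m_series"
    unfolding Y_def
    by (subst at_lambda_eq_shifted_quotient) (simp add: algebra_simps central_left_swap[OF central_mu_inv, of lambda_inv])
  have Qu: "um_inverse * (fps_X * u_series) = fps_X * (u_series * mu_inverse)"
    by (simp add: X_swap um_inverse_intertwine)
  have X: "at_mu fps_X = mu_inv" by (simp add: mu_inv_def)
  have m: "m_flow = at_lambda m_series * at_mu (um_inverse * (fps_X * u_series)) * ?p + mu_inv * at_mu mu_inverse * ?r"
    unfolding m_flow_def by (simp add: at_mu_hom mult.assoc)
  have m2: "(lambda_inv - mu_inv) * m_flow
     = at_lambda m_series * at_mu (um_inverse * (fps_X * u_series)) * (Y - mu_inv * at_mu m_series)
      + mu_inv * at_mu mu_inverse * (at_lambda m_series - at_mu m_series)"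
  proof -
    have "(lambda_inv - mu_inv) * (A * P + B * R) = A * ((lambda_inv - mu_inv) * P) + B * ((lambda_inv - mu_inv) * R)"
      for A P B R :: "qalg fps fps"
      by (simp only: distrib_left d)
    then show ?thesis unfolding m p[symmetric] shifted_quotient[symmetric] .
  qed
  have m3: "lambda_inv * ((lambda_inv - mu_inv) * m_flow)
     = Y * (mu_inv * at_mu (u_series * mu_inverse)) * (Y - mu_inv * at_mu m_series)
      + mu_inv * at_mu mu_inverse * Y - lambda_inv * (mu_inv * at_mu mu_inverse * at_mu m_series)"
    unfolding m2 unfolding Qu at_mu_hom X Y_def
    by (simp add: algebra_simps lx[of "at_mu mu_inverse"] lx[of mu_inv])
  show ?thesis unfolding mult_minus_right d[of lambda_inv] m3 idem_defs at_mu_hom X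
    by (simp add: algebra_simps lz[of Y] lz[of "at_mu u_series"] lz[of "at_mu mu_inverse"])
qed

section \<open>Two flows with independent parameters\<close>

text \<open>
  Two copies of the flow that differ in the parameter, the innermost variable for \<open>z_flow\<close> and the
  middle one for \<open>w_flow\<close>, extended to derivations of the ring of series in all three variables.
\<close>

definition z_flow :: "qalg fps fps fps \<Rightarrow> qalg fps fps fps" where
  "z_flow = map_coeffs (map_coeffs (extend_derivation flow))"

text \<open>On a series in the innermost variable, coefficientwise application of
  \<open>flow\<close> puts the parameter inside. The swap brings it outside, where
  \<open>extend_derivation\<close> identifies it with the middle variable.\<close>

definition swapped_flow :: "qalg fps \<Rightarrow> qalg fps fps" where
  "swapped_flow f = swap_variables (map_coeffs flow f)"

definition w_flow :: "qalg fps fps fps \<Rightarrow> qalg fps fps fps" where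
  "w_flow = map_coeffs (extend_derivation swapped_flow)"

lemma map_coeffs_id: "map_coeffs (\<lambda>a. a) = (\<lambda>f. f)"
  by (rule ext) (simp add: fps_eq_iff map_coeffs_def)

lemma swap_variables_simps: "swap_variables lambda_inv = mu_inv" "swap_variables mu_inv = lambda_inv"
  "swap_variables (at_lambda f) = at_mu f" "swap_variables (at_mu f) = at_lambda f"
  by (auto simp: fps_eq_iff swap_variables_def lambda_inv_def mu_inv_def at_mu_def at_lambda_def fps_X_def
      if_distrib[of "\<lambda>f. fps_nth f _"] cong: if_cong)

lemma derivation_along_swapped_flow: "derivation_along fps_const swapped_flow"
proof -
  have "swap_variables (map_coeffs fps_const f) = fps_const f" for f :: "qalg fps"
    using swap_variables_simps(3)[of f] by (simp add: at_lambda_eq_map_coeffs at_mu_eq_const)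
  then show ?thesis
    using derivation_along_compose[OF ring_map_swap_variables derivation_along_map_coeffs[OF derivation_along_flow]]
    by (simp add: swapped_flow_def[abs_def])
qed

lemma derivation_along_z_flow: "derivation_along (\<lambda>F. F) z_flow"
  using derivation_along_map_coeffs[OF derivation_along_map_coeffs[OF derivation_along_extend[OF derivation_along_flow]]]
  by (simp add: z_flow_def map_coeffs_id)

lemma derivation_along_w_flow: "derivation_along (\<lambda>F. F) w_flow"
  using derivation_along_map_coeffs[OF derivation_along_extend[OF derivation_along_swapped_flow]]
  by (simp add: w_flow_def map_coeffs_id)

lemma map_coeffs_X_zero: "h 0 = 0 \<Longrightarrow> h 1 = 0 \<Longrightarrow> map_coeffs h fps_X = 0"
  by (simp add: fps_eq_iff map_coeffs_def fps_X_def)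

lemma flow_0: "flow 0 = 0" by (rule derivation_alongD(3)[OF derivation_along_flow])

lemma ext_flow: "extend_derivation flow (fps_const a) = flow a" "extend_derivation flow fps_X = 0"
  "extend_derivation flow 0 = 0" "extend_derivation flow 1 = 0"
  using extend_derivation_const[OF derivation_along_flow] extend_derivation_X[OF derivation_along_flow flow_1]
    extend_derivation_const[OF derivation_along_flow, of 0] extend_derivation_const[OF derivation_along_flow, of 1]
  by (simp_all add: flow_0 flow_1)

lemma swapped_flow_simps: "swapped_flow 0 = 0" "swapped_flow 1 = 0" "swapped_flow fps_X = 0"
  using derivation_alongD(3)[OF derivation_along_swapped_flow] map_coeffs_fps_const[of flow 1]
  by (simp_all add: swapped_flow_def map_coeffs_X_zero flow_0 flow_1 ring_mapD[OF ring_map_swap_variables])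

lemma ext_swapped_flow: "extend_derivation swapped_flow (fps_const a) = swapped_flow a"
  "extend_derivation swapped_flow fps_X = 0"
  "extend_derivation swapped_flow 0 = 0" "extend_derivation swapped_flow 1 = 0"
  using extend_derivation_const[OF derivation_along_swapped_flow]
    extend_derivation_X[OF derivation_along_swapped_flow swapped_flow_simps(2)]
    extend_derivation_const[OF derivation_along_swapped_flow, of 0] extend_derivation_const[OF derivation_along_swapped_flow, of 1]
  by (simp_all add: swapped_flow_simps)

lemma flows_scalars: "z_flow lambda_inv = 0" "z_flow mu_inv = 0" "z_flow (const3 fps_X) = 0"
  "w_flow lambda_inv = 0" "w_flow mu_inv = 0" "w_flow (const3 fps_X) = 0"
proof -
  have 0: "map_coeffs (extend_derivation flow) 0 = 0" "map_coeffs (extend_derivation flow) 1 = 0"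
    using map_coeffs_fps_const[of "extend_derivation flow", OF ext_flow(3)] ext_flow by (metis fps_const_0_eq_0 fps_const_1_eq_1)+
  show "z_flow lambda_inv = 0" "z_flow mu_inv = 0" "z_flow (const3 fps_X) = 0"
    unfolding z_flow_def lambda_inv_def mu_inv_def at_mu_def
    by (simp_all add: map_coeffs_X_zero map_coeffs_fps_const 0 ext_flow)
  show "w_flow lambda_inv = 0" "w_flow mu_inv = 0" "w_flow (const3 fps_X) = 0"
    unfolding w_flow_def lambda_inv_def mu_inv_def at_mu_def
    by (simp_all add: map_coeffs_X_zero map_coeffs_fps_const ext_swapped_flow swapped_flow_simps)
qed

lemma at_lambda_nth: "fps_nth (at_lambda f) i = fps_const (fps_nth f i)"
  by (simp add: at_lambda_def)

text \<open>\<open>at_lambda (at_lambda f)\<close>, \<open>fps_const (at_lambda f)\<close> and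
  \<open>const3 f\<close> are \<open>f\<close> as a series in the outer, the middle and the
  innermost variable.\<close>

lemma flows_embedded:
  "z_flow (at_lambda (at_lambda f)) = at_lambda (map_coeffs flow f)"
  "w_flow (at_lambda (at_lambda f)) = map_coeffs at_lambda (map_coeffs flow f)"
  "z_flow (fps_const (at_lambda f)) = at_mu (map_coeffs flow f)"
  "w_flow (const3 f) = fps_const (swap_variables (map_coeffs flow f))"
proof -
  have 0: "map_coeffs (extend_derivation flow) 0 = 0" "at_lambda 0 = 0"
    using map_coeffs_fps_const[of "extend_derivation flow", OF ext_flow(3)] ext_flow
    by (metis fps_const_0_eq_0, simp add: at_lambda_hom)
  have 1: "swapped_flow (fps_const a) = at_lambda (flow a)" for a
    unfolding swapped_flow_def map_coeffs_fps_const[of flow, OF flow_0] at_mu_eq_const[symmetric]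
    by (rule swap_variables_simps)
  have 2: "map_coeffs (extend_derivation flow) (at_lambda f) = map_coeffs flow f"
    by (simp add: fps_eq_iff map_coeffs_def at_lambda_def ext_flow)
  show "z_flow (at_lambda (at_lambda f)) = at_lambda (map_coeffs flow f)"
    unfolding z_flow_def at_lambda_def map_coeffs_def[of "map_coeffs _"] map_coeffs_def[of flow]
    by (simp add: fps_eq_iff) (simp add: map_coeffs_def ext_flow if_distrib[of "extend_derivation flow"] cong: if_cong)
  show "w_flow (at_lambda (at_lambda f)) = map_coeffs at_lambda (map_coeffs flow f)"
    by (rule fps_ext)
      (simp add: w_flow_def map_coeffs_def at_lambda_nth ext_swapped_flow 1[unfolded at_lambda_nth])
  show "z_flow (fps_const (at_lambda f)) = at_mu (map_coeffs flow f)"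
    unfolding z_flow_def map_coeffs_fps_const[of "map_coeffs (extend_derivation flow)", OF 0(1)] 2 at_mu_def ..
  show "w_flow (const3 f) = fps_const (swap_variables (map_coeffs flow f))"
    unfolding w_flow_def map_coeffs_fps_const[of "extend_derivation swapped_flow", OF ext_swapped_flow(3)]
      ext_swapped_flow swapped_flow_def ..
qed

lemma map_coeffs_X_mult:
  fixes h :: "'a::ring_1 \<Rightarrow> 'b::ring_1"
  shows "h 0 = 0 \<Longrightarrow> map_coeffs h (fps_X * f) = fps_X * map_coeffs h f"
  by (simp add: fps_eq_iff map_coeffs_def)

lemma commuting_flows_series:
  "z_flow (w_flow (at_lambda (at_lambda u_series))) = w_flow (z_flow (at_lambda (at_lambda u_series)))"
  "z_flow (w_flow (lambda_inv * at_lambda (at_lambda m_series)))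
     = w_flow (z_flow (lambda_inv * at_lambda (at_lambda m_series)))"
proof -
  define D where "D = (\<lambda>F. - z_flow F)"
  define D' where "D' = (\<lambda>F. - w_flow F)"
  have D: "derivation_along (\<lambda>F. F) D" "derivation_along (\<lambda>F. F) D'"
    using derivation_along_z_flow derivation_along_w_flow
    unfolding derivation_along_def D_def D'_def by simp_all
  note scal = central_lambda_inv central_mu_inv central_z3
  \<comment> \<open>The Riccati equations are transported to four pairs of variables:
    \<open>at_lambda\<close> gives (outer, innermost), \<open>at_mu\<close> (middle, innermost),
    \<open>T2\<close> (outer, middle) and \<open>T4\<close> (innermost, middle).\<close>
  define T4 :: "qalg fps fps \<Rightarrow> qalg fps fps fps" where "T4 = (\<lambda>F. fps_const (swap_variables F))"
  define T2 :: "qalg fps fps \<Rightarrow> qalg fps fps fps" where "T2 = map_coeffs at_lambda"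
  have T4: "ring_map T4" unfolding T4_def
    using ring_map_swap_variables ring_map_fps_const by (simp add: ring_map_def)
  have T2: "ring_map T2" unfolding T2_def by (rule ring_map_map_coeffs[OF ring_map_at_lambda])
  have T4a: "fps_const (swap_variables F) = T4 F" for F by (simp add: T4_def)
  have T4s: "T4 lambda_inv = const3 fps_X" "T4 mu_inv = mu_inv" "T4 (at_lambda f) = const3 f"
    "T4 (at_mu f) = fps_const (at_lambda f)" for f
    unfolding T4_def swap_variables_simps by (simp_all add: mu_inv_def at_mu_def lambda_inv_def)
  have X: "at_lambda fps_X = lambda_inv" by (simp add: at_lambda_def lambda_inv_def fps_eq_iff fps_X_def)
  have T2s: "T2 lambda_inv = lambda_inv" "T2 mu_inv = mu_inv" "T2 (at_lambda f) = at_lambda (at_lambda f)"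
    "T2 (at_mu f) = fps_const (at_lambda f)" for f
  proof -
    show "T2 lambda_inv = lambda_inv"
      unfolding T2_def lambda_inv_def by (simp add: fps_eq_iff map_coeffs_def fps_X_def at_lambda_hom)
    show m: "T2 (at_mu f) = fps_const (at_lambda f)" for f
      unfolding T2_def at_mu_def by (rule map_coeffs_fps_const) (simp add: at_lambda_hom)
    show "T2 mu_inv = mu_inv" unfolding mu_inv_def m X unfolding at_mu_def lambda_inv_def ..
    show "T2 (at_lambda f) = at_lambda (at_lambda f)"
      unfolding T2_def by (simp add: fps_eq_iff map_coeffs_def at_lambda_def)
  qed
  have T3s: "at_mu (at_lambda f) = fps_const (at_lambda f)" for f :: "qalg fps" by (simp add: at_mu_def)
  have mw: "fps_const (at_lambda (fps_X * m_series)) = mu_inv * fps_const (at_lambda m_series)"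
    unfolding at_lambda_hom X mu_inv_def at_mu_def lambda_inv_def by simp
  have mz: "const3 (fps_X * m_series) = const3 fps_X * const3 m_series" by simp
  note R1 = u_flow_riccati and R2 = m_flow_riccati
  have Xm: "map_coeffs flow (fps_X * m_series) = lambda_inv * m_flow"
    unfolding map_coeffs_X_mult[of flow, OF flow_0] flow_series lambda_inv_def ..
  define e where "e = (\<lambda>f :: qalg fps. (fps_const (at_lambda f) :: qalg fps fps fps))"
  have e_hom: "e (f * g) = e f * e g" "e (- f) = - e f" "e (1 + f) = 1 + e f" "e 1 = 1" for f g
    unfolding e_def by (simp_all add: at_lambda_hom fps_const_add[symmetric] del: fps_const_add)
  have c_hom: "const3 (- f) = - const3 f" for f :: "qalg fps" by simp
  have e_inv: "(1 + e (fps_X * m_series) * e u_series) * e mu_inverse = 1"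
    "e mu_inverse * (1 + e (fps_X * m_series) * e u_series) = 1"
    using arg_cong[OF mu_inverse(1), of e] arg_cong[OF mu_inverse(2), of e] by (simp_all only: e_hom)
  have u_z: "(mu_inv - const3 fps_X) * D (e u_series) = - (mu_inv * (e u_series * const3 idem12 * e u_series))
    + const3 fps_X * (e u_series * const3 idem11 - const3 idem22 * e u_series + const3 idem21)"
    using arg_cong[OF R1, of at_mu]
    by (simp add: D_def e_def flows_embedded flow_series at_mu_hom at_mu_simps at_lambda_simps T3s)
  have m_z: "(mu_inv - const3 fps_X) * D (e (fps_X * m_series)) = - (const3 fps_X * (const3 idem11 * e (fps_X * m_series))) - mu_inv * const3 idem12
    + const3 fps_X * (e (fps_X * m_series) * const3 idem21 * e (fps_X * m_series) + e (fps_X * m_series) * const3 idem22)"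
    using arg_cong[OF R2, of at_mu] unfolding e_def D_def flows_embedded Xm unfolding mw
    by (simp add: at_mu_hom at_mu_simps at_lambda_simps T3s)
  have D1: "D 1 = 0" using derivation_along_1[OF _ D(1)] by (simp add: ring_map_def)
  \<comment> \<open>\<open>De\<close> describes the idempotent at the middle variable under the flow
    with innermost parameter; \<open>Df\<close> is the same with the two variables
    exchanged.\<close>
  note De = idempotent_flow[OF D(1) D1 scal(2,3) e_inv u_z m_z, folded e_hom(1,2), folded idem_defs]
  have u_w: "(const3 fps_X - mu_inv) * D' (const3 u_series) = - (const3 fps_X * (const3 u_series * e idem12 * const3 u_series))
    + mu_inv * (const3 u_series * e idem11 - e idem22 * const3 u_series + e idem21)"
    using arg_cong[OF R1, of T4] unfolding D'_def e_def flows_embedded flow_series T4a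
    by (simp only: ring_mapD[OF T4] T4s)
  have m_w: "(const3 fps_X - mu_inv) * D' (const3 (fps_X * m_series)) = - (mu_inv * (e idem11 * const3 (fps_X * m_series))) - const3 fps_X * e idem12
    + mu_inv * (const3 (fps_X * m_series) * e idem21 * const3 (fps_X * m_series) + const3 (fps_X * m_series) * e idem22)"
    using arg_cong[OF R2, of T4] unfolding e_def D'_def flows_embedded Xm unfolding mz T4a
    by (simp only: ring_mapD[OF T4] T4s)
  have D1': "D' 1 = 0" using derivation_along_1[OF _ D(2)] by (simp add: ring_map_def)
  note Df = idempotent_flow[OF D(2) D1' scal(3,2) const3_inverse(3,4) u_w m_w,
      folded const3_hom(2) c_hom, folded idem_defs]
  have D0: "D lambda_inv = 0" "D mu_inv = 0" "D (const3 fps_X) = 0"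
    "D' lambda_inv = 0" "D' mu_inv = 0" "D' (const3 fps_X) = 0"
    unfolding D_def D'_def flows_scalars by simp_all
  note commute = riccati_flows_commute[OF D scal D0 cancel3(1,2,3) De Df]
  let ?X = "at_lambda (at_lambda u_series)" and ?Y = "lambda_inv * at_lambda (at_lambda m_series)"
  have "D (D' ?X) = D' (D ?X)"
  proof (rule commute(1))
    show "(lambda_inv - const3 fps_X) * D ?X = - (lambda_inv * (?X * const3 idem12 * ?X))
       + const3 fps_X * (?X * const3 idem11 - const3 idem22 * ?X + const3 idem21)"
      using arg_cong[OF R1, of at_lambda] unfolding D_def flows_embedded flow_series
      by (simp only: at_lambda_hom at_lambda_simps at_mu_simps)
    show "(lambda_inv - mu_inv) * D' ?X = - (lambda_inv * (?X * e idem12 * ?X))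
       + mu_inv * (?X * e idem11 - e idem22 * ?X + e idem21)"
      using arg_cong[OF R1, of T2] unfolding D'_def flows_embedded flow_series T2_def[symmetric] e_def
      by (simp only: ring_mapD[OF T2] T2s)
  qed
  then show "z_flow (w_flow ?X) = w_flow (z_flow ?X)"
    unfolding D_def D'_def
    by (simp add: derivation_alongD(4)[OF derivation_along_z_flow] derivation_alongD(4)[OF derivation_along_w_flow])
  have zY: "z_flow ?Y = at_lambda (lambda_inv * m_flow)" "w_flow ?Y = T2 (lambda_inv * m_flow)"
    unfolding derivation_alongD(2)[OF derivation_along_z_flow] derivation_alongD(2)[OF derivation_along_w_flow]
      flows_scalars flows_embedded flow_series T2_def[symmetric] ring_mapD[OF T2] T2s at_lambda_hom at_lambda_simps
    by simp_all
  have "D (D' ?Y) = D' (D ?Y)"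
  proof (rule commute(2))
    show "(lambda_inv - const3 fps_X) * D ?Y = - (const3 fps_X * (const3 idem11 * ?Y)) - lambda_inv * const3 idem12
       + const3 fps_X * (?Y * const3 idem21 * ?Y + ?Y * const3 idem22)"
      using arg_cong[OF R2, of at_lambda] unfolding D_def zY
      by (simp only: at_lambda_hom at_lambda_simps at_mu_simps)
    show "(lambda_inv - mu_inv) * D' ?Y = - (mu_inv * (e idem11 * ?Y)) - lambda_inv * e idem12
       + mu_inv * (?Y * e idem21 * ?Y + ?Y * e idem22)"
      using arg_cong[OF R2, of T2] unfolding D'_def zY e_def
      by (simp only: ring_mapD[OF T2] T2s)
  qed
  then show "z_flow (w_flow ?Y) = w_flow (z_flow ?Y)"
    unfolding D_def D'_def
    by (simp add: derivation_alongD(4)[OF derivation_along_z_flow] derivation_alongD(4)[OF derivation_along_w_flow])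
qed

lemma flow_nested:
  "fps_nth (fps_nth (fps_nth (z_flow (w_flow (at_lambda (at_lambda f)))) i) j) k
     = fps_nth (flow (fps_nth (flow (fps_nth f i)) j)) k"
  "fps_nth (fps_nth (fps_nth (w_flow (z_flow (at_lambda (at_lambda f)))) i) j) k
     = fps_nth (flow (fps_nth (flow (fps_nth f i)) k)) j"
proof -
  show "fps_nth (fps_nth (fps_nth (z_flow (w_flow (at_lambda (at_lambda f)))) i) j) k
     = fps_nth (flow (fps_nth (flow (fps_nth f i)) j)) k"
    unfolding flows_embedded by (simp add: z_flow_def map_coeffs_def at_lambda_nth ext_flow)
  show "fps_nth (fps_nth (fps_nth (w_flow (z_flow (at_lambda (at_lambda f)))) i) j) k
     = fps_nth (flow (fps_nth (flow (fps_nth f i)) k)) j"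
    unfolding flows_embedded
    by (simp add: w_flow_def map_coeffs_def at_lambda_nth ext_swapped_flow swapped_flow_def swap_variables_def)
qed

text \<open>On generators this is \<open>commuting_flows_series\<close> read off coefficientwise,
  after a factor \<open>lambda_inv\<close> is cancelled for \<open>m\<close>. It extends to the
  algebra because a commutator of derivations is a derivation.\<close>

lemma flow_coeffs_commute: "flow_coeff n \<circ> flow_coeff p = flow_coeff p \<circ> flow_coeff n"
proof
  fix a
  have sign: "flow_coeff n ((- 1) ^ i * a) = (- 1) ^ i * flow_coeff n a" for n i a
    by (rule derivation_sign[OF derivation_flow_coeff])
  have u: "fps_nth (flow (fps_nth (flow (fps_nth u_series i)) p)) n
      = fps_nth (flow (fps_nth (flow (fps_nth u_series i)) n)) p" for i
    using commuting_flows_series(1) flow_nested[of u_series] by metis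
  have "lambda_inv * z_flow (w_flow (at_lambda (at_lambda m_series)))
      = lambda_inv * w_flow (z_flow (at_lambda (at_lambda m_series)))"
    using commuting_flows_series(2)
    by (simp add: derivation_alongD(2)[OF derivation_along_z_flow] derivation_alongD(2)[OF derivation_along_w_flow]
        flows_scalars)
  then have "lambda_inv * (z_flow (w_flow (at_lambda (at_lambda m_series)))
      - w_flow (z_flow (at_lambda (at_lambda m_series)))) = 0"
    by (simp add: right_diff_distrib)
  then have "z_flow (w_flow (at_lambda (at_lambda m_series))) = w_flow (z_flow (at_lambda (at_lambda m_series)))"
    using cancel3(4) by (metis eq_iff_diff_eq_0)
  then have m: "fps_nth (flow (fps_nth (flow (fps_nth m_series i)) p)) n
      = fps_nth (flow (fps_nth (flow (fps_nth m_series i)) n)) p" for i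
    using flow_nested[of m_series] by metis
  have nest: "flow_coeff n (flow_coeff p a) = (- 1) ^ p * ((- 1) ^ n * fps_nth (flow (fps_nth (flow a) p)) n)" for n p a
    unfolding flow_coeff_def[of p] sign by (simp add: flow_coeff_def)
  have swap: "(- 1) ^ p * ((- 1) ^ n * w) = (- 1) ^ n * ((- 1) ^ p * w)" for w :: qalg
    by (rule central_left_swap[OF central_sign])
  have series: "flow_coeff n (flow_coeff p a) = flow_coeff p (flow_coeff n a)"
    if "fps_nth (flow (fps_nth (flow a) p)) n = fps_nth (flow (fps_nth (flow a) n)) p" for a
    unfolding nest that by (rule swap)
  have "flow_coeff n (flow_coeff p a) = flow_coeff p (flow_coeff n a)"
  proof (induction a rule: qalg_induct)
    case (scalar c)
    have "flow_coeff k 0 = 0" for k by (simp add: flow_coeff_def flow_0)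
    then show ?case by (simp add: flow_coeff_simps(3))
  next
    case (gen g)
    have "flow_coeff n (flow_coeff p ((- 1) ^ i * generator g)) = flow_coeff p (flow_coeff n ((- 1) ^ i * generator g))
      \<Longrightarrow> ?case" for i
      unfolding sign by (metis sign_cancel)
    then show ?case
      using series[OF u] series[OF m] by (cases g) (auto simp: u_series_def m_series_def)
  next
    case (add a b)
    then show ?case by (simp add: flow_coeff_simps)
  next
    case (mult a b)
    then show ?case by (simp add: flow_coeff_simps algebra_simps)
  qed
  then show "(flow_coeff n \<circ> flow_coeff p) a = (flow_coeff p \<circ> flow_coeff n) a" by simp
qed

section \<open>The classical limit\<close>

lemma mat2_nth: "vec_nth (vec_nth (mat2 a b c d) 1) 1 = a" "vec_nth (vec_nth (mat2 a b c d) 1) 2 = b"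
  "vec_nth (vec_nth (mat2 a b c d) 2) 1 = c" "vec_nth (vec_nth (mat2 a b c d) 2) 2 = d"
  by (simp_all add: mat2_def)

lemma mat2_entries:
  "x = mat2 (vec_nth (vec_nth x 1) 1) (vec_nth (vec_nth x 1) 2) (vec_nth (vec_nth x 2) 1) (vec_nth (vec_nth x 2) 2)"
  by (simp add: vec_eq_iff forall_2 mat2_nth)

lemma mat2_eq_iff: "mat2 a b c d = mat2 a' b' c' d' \<longleftrightarrow> a = a' \<and> b = b' \<and> c = c' \<and> d = d'"
  by (metis mat2_nth)

lemma mat2_mult: "mat2 a b c d ** mat2 a' b' c' d' = mat2 (a * a' + b * c') (a * b' + b * d') (c * a' + d * c') (c * b' + d * d')"
  by (simp add: vec_eq_iff forall_2 matrix_matrix_mult_def sum_2 mat2_nth)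

lemma det_mat2: "det (mat2 a b c d) = a * d - b * c"
  by (simp add: det_2 mat2_nth)

lemma mat_1_mat2: "mat 1 = mat2 1 0 0 1"
  by (simp add: vec_eq_iff forall_2 mat2_nth mat_def)

lemma B_minus_iff:
  "x \<in> B_minus \<longleftrightarrow> (\<exists>a b c d. x = mat2 (fps_to_fls a) (fps_to_fls b) (fps_to_fls c) (fps_to_fls d)
      \<and> a * d - b * c = 1 \<and> fps_nth b 0 = 0)"
proof
  assume x: "x \<in> B_minus"
  then have "\<forall>i j. \<exists>f. vec_nth (vec_nth x i) j = fps_to_fls f"
    unfolding B_minus_def by blast
  then obtain f where f: "\<And>i j. vec_nth (vec_nth x i) j = fps_to_fls (f i j)" by metis
  have e: "x = mat2 (fps_to_fls (f 1 1)) (fps_to_fls (f 1 2)) (fps_to_fls (f 2 1)) (fps_to_fls (f 2 2))"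
    using mat2_entries[of x] unfolding f .
  moreover have "f 1 1 * f 2 2 - f 1 2 * f 2 1 = 1"
  proof -
    have "fps_to_fls (f 1 1 * f 2 2 - f 1 2 * f 2 1) = det x"
      by (subst e) (simp add: det_mat2 fls_times_fps_to_fls)
    also have "\<dots> = fps_to_fls 1" using x by (simp add: B_minus_def)
    finally show ?thesis by (simp only: fps_to_fls_eq_iff)
  qed
  moreover have "fps_nth (f 1 2) 0 = 0"
    using x f[of 1 2] by (simp add: B_minus_def)
  ultimately show "\<exists>a b c d. x = mat2 (fps_to_fls a) (fps_to_fls b) (fps_to_fls c) (fps_to_fls d)
      \<and> a * d - b * c = 1 \<and> fps_nth b 0 = 0" by blast
next
  assume "\<exists>a b c d. x = mat2 (fps_to_fls a) (fps_to_fls b) (fps_to_fls c) (fps_to_fls d)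
      \<and> a * d - b * c = 1 \<and> fps_nth b 0 = 0"
  then obtain a b c d where "x = mat2 (fps_to_fls a) (fps_to_fls b) (fps_to_fls c) (fps_to_fls d)"
    and d: "a * d - b * c = 1" and b: "fps_nth b 0 = 0" by blast
  moreover have "fps_to_fls a * fps_to_fls d - fps_to_fls b * fps_to_fls c = 1"
    using arg_cong[OF d, of fps_to_fls] by (simp add: fls_times_fps_to_fls)
  ultimately show "x \<in> B_minus"
    by (simp add: B_minus_def forall_2 mat2_nth det_mat2)
qed

lemma unit_coordinates:
  fixes a b c d :: "'r::comm_ring_1 fps"
  assumes "a * d - b * c = 1" "fps_nth b 0 = 0"
  obtains e where "d * e = 1"
proof -
  have "fps_nth (a * d - b * c) 0 = 1" using assms(1) by simp
  then have "fps_nth d 0 * fps_nth a 0 = 1" using assms(2) by (simp add: mult.commute)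
  then have "d * fps_right_inverse d (fps_nth a 0) = 1" by (rule fps_right_inverse)
  then show ?thesis by (rule that)
qed

text \<open>Comparing entries forces \<open>h\<close> to be the diagonal matrix of \<open>e\<close>
  and \<open>d\<close>, hence \<open>u = c / d\<close> and \<open>v = b * d\<close>.\<close>

lemma uv_cl_mat2:
  fixes a b c d :: "'r::comm_ring_1 fps"
  assumes det: "a * d - b * c = 1" and b: "fps_nth b 0 = 0" and e: "d * e = 1"
  shows "uv_cl (mat2 (fps_to_fls a) (fps_to_fls b) (fps_to_fls c) (fps_to_fls d)) = (c * e, b * d)"
proof -
  let ?x = "mat2 (fps_to_fls a) (fps_to_fls b) (fps_to_fls c) (fps_to_fls d)"
  have prod: "mat2 (fps_to_fls s) 0 0 (fps_to_fls t) ** mat2 1 (fps_to_fls v) 0 1 ** mat2 1 0 (fps_to_fls u) 1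
      = mat2 (fps_to_fls (s + s * v * u)) (fps_to_fls (s * v)) (fps_to_fls (t * u)) (fps_to_fls t)" for s t u v :: "'r fps"
    by (simp add: mat2_mult fls_times_fps_to_fls)
  have "fps_nth (b * d) 0 = 0" using b by simp
  moreover have "\<exists>h\<in>H_minus. ?x = h ** mat2 1 (fps_to_fls (b * d)) 0 1 ** mat2 1 0 (fps_to_fls (c * e)) 1"
  proof
    have "e + e * (b * d) * (c * e) = e * (1 + b * c * (d * e))" by (simp add: algebra_simps)
    also have "\<dots> = e * (a * d)" unfolding e using det by (simp add: algebra_simps)
    also have "\<dots> = a * (d * e)" by (simp add: mult_ac)
    finally have "e + e * (b * d) * (c * e) = a" using e by simp
    moreover have "e * (b * d) = b" "d * (c * e) = c" using e by (simp_all add: mult.left_commute mult.commute)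
    ultimately show "?x = mat2 (fps_to_fls e) 0 0 (fps_to_fls d) ** mat2 1 (fps_to_fls (b * d)) 0 1 ** mat2 1 0 (fps_to_fls (c * e)) 1"
      unfolding prod by simp
    show "mat2 (fps_to_fls e) 0 0 (fps_to_fls d) \<in> H_minus"
      unfolding H_minus_def using e[unfolded mult.commute[of d e]] by blast
  qed
  moreover have "u = c * e \<and> v = b * d"
    if hH: "h \<in> H_minus" and xh: "?x = h ** mat2 1 (fps_to_fls v) 0 1 ** mat2 1 0 (fps_to_fls u) 1" for u v h
  proof -
    obtain s t where h: "h = mat2 (fps_to_fls s) 0 0 (fps_to_fls t)" and st: "s * t = 1"
      using hH unfolding H_minus_def by blast
    have "b = s * v" "c = t * u" "d = t" using xh unfolding h prod mat2_eq_iff by simp_all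
    then show ?thesis using st e by (metis mult.assoc mult.commute mult_1_left)
  qed
  ultimately show ?thesis
    unfolding uv_cl_def by (intro the_equality) auto
qed

text \<open>Since \<open>1 + u * v = a * d\<close>, the coordinates are the ratios
  \<open>u = c / d\<close> and \<open>lambda^-1 m = - b / a\<close>. Written without division they
  can be differentiated over the dual numbers by the Leibniz rule.\<close>

lemma cl_coordinates:
  fixes a b c d :: "'r::comm_ring_1 fps"
  assumes det: "a * d - b * c = 1" and b: "fps_nth b 0 = 0"
  defines "x \<equiv> mat2 (fps_to_fls a) (fps_to_fls b) (fps_to_fls c) (fps_to_fls d)"
  shows "u_cl x * d = c" "fps_X * m_cl x * a = - b"
proof -
  obtain e where e: "d * e = 1" using unit_coordinates[OF det b] .
  note uv = uv_cl_mat2[OF det b e, folded x_def]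
  have de: "d * (e * w) = w" for w using e by (metis mult.assoc mult_1_left)
  show "u_cl x * d = c" by (simp add: u_cl_def uv mult_ac de e)
  have 1: "1 + u_cl x * v_cl x = a * d"
    using det by (simp add: u_cl_def v_cl_def uv mult_ac de e algebra_simps)
  have "fps_nth (a * d) 0 = fps_nth (1 + b * c) 0" using det by (metis add.commute diff_add_cancel)
  then have i: "a * d * fps_right_inverse (a * d) 1 = 1"
    by (intro fps_right_inverse_two_sided) (simp add: b)
  have X: "fps_X * fps_shift 1 (b * d) = b * d"
    by (rule fps_ext) (auto simp: b)
  have "fps_X * m_cl x * a = - (fps_X * fps_shift 1 (b * d) * fps_right_inverse (a * d) 1 * a)"
    unfolding m_cl_def 1 by (simp add: v_cl_def uv mult_ac)
  also have "\<dots> = - (b * (a * d * fps_right_inverse (a * d) 1))" unfolding X by (simp add: mult_ac)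
  finally show "fps_X * m_cl x * a = - b" unfolding i by simp
qed

lemma fps_unit_cancel: "d * e = 1 \<Longrightarrow> a * d = b * d \<Longrightarrow> a = (b :: 'a::comm_ring_1)"
  by (metis mult.assoc mult_1_right)

text \<open>An element of \<open>H_minus\<close> scales the rows and so preserves the ratios
  \<open>c / d\<close> and \<open>b / a\<close>.\<close>

lemma cl_coordinates_H_minus:
  fixes x :: "'r::comm_ring_1 loop_matrix"
  assumes x: "x \<in> B_minus" and h: "h \<in> H_minus"
  shows "h ** x \<in> B_minus" "coordinate (h ** x) = coordinate x"
proof -
  obtain a b c d where e: "x = mat2 (fps_to_fls a) (fps_to_fls b) (fps_to_fls c) (fps_to_fls d)"
    and det: "a * d - b * c = 1" and b: "fps_nth b 0 = 0" using x unfolding B_minus_iff by blast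
  obtain s t where h: "h = mat2 (fps_to_fls s) 0 0 (fps_to_fls t)" and st: "s * t = 1"
    using h unfolding H_minus_def by blast
  have hx: "h ** x = mat2 (fps_to_fls (s * a)) (fps_to_fls (s * b)) (fps_to_fls (t * c)) (fps_to_fls (t * d))"
    unfolding h e by (simp add: mat2_mult fls_times_fps_to_fls)
  have "s * a * (t * d) - s * b * (t * c) = (s * t) * (a * d - b * c)" by (simp add: algebra_simps)
  then have det': "s * a * (t * d) - s * b * (t * c) = 1" unfolding det st by simp
  have b': "fps_nth (s * b) 0 = 0" using b by simp
  show "h ** x \<in> B_minus" unfolding hx B_minus_iff using det' b' by blast
  note new = cl_coordinates[OF det' b', folded hx] and old = cl_coordinates[OF det b, folded e]
  obtain i where i: "d * i = 1" using unit_coordinates[OF det b] .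
  have "fps_nth (a * d - b * c) 0 = 1" using det by simp
  then have "fps_nth a 0 * fps_nth d 0 = 1" using b by simp
  then have j: "a * fps_right_inverse a (fps_nth d 0) = 1" by (rule fps_right_inverse)
  have "u_cl (h ** x) * (t * d) = u_cl x * (t * d)"
    unfolding new(1) old(1)[symmetric] by (simp only: mult_ac)
  moreover have "t * d * (s * i) = (s * t) * (d * i)" by (simp add: mult_ac)
  then have "t * d * (s * i) = 1" unfolding st i by simp
  ultimately have u: "u_cl (h ** x) = u_cl x" by (rule fps_unit_cancel[rotated])
  have "fps_X * m_cl (h ** x) * (s * a) = s * - b" unfolding new(2) by simp
  also have "\<dots> = fps_X * m_cl x * (s * a)" unfolding old(2)[symmetric] by (simp only: mult_ac)
  finally have "fps_X * m_cl (h ** x) * (s * a) = fps_X * m_cl x * (s * a)" .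
  moreover have "s * a * (t * fps_right_inverse a (fps_nth d 0)) = (s * t) * (a * fps_right_inverse a (fps_nth d 0))"
    by (simp add: mult_ac)
  then have "s * a * (t * fps_right_inverse a (fps_nth d 0)) = 1" unfolding st j by simp
  ultimately have "fps_X * m_cl (h ** x) = fps_X * m_cl x" by (rule fps_unit_cancel[rotated])
  then have "fps_X * (m_cl (h ** x) - m_cl x) = 0" by (simp add: right_diff_distrib)
  then have m: "m_cl (h ** x) = m_cl x" using fps_X_mult_eq_0 by (metis eq_iff_diff_eq_0)
  show "coordinate (h ** x) = coordinate x"
  proof
    fix g show "coordinate (h ** x) g = coordinate x g" by (cases g) (simp_all add: u m)
  qed
qed

section \<open>Uniqueness of the factorization\<close>

lemma fls_times_no_positive:
  fixes f g :: "'r::comm_ring_1 fls"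
  assumes "\<forall>k>0. fls_nth f k = 0" "\<forall>k>0. fls_nth g k = 0"
  shows "k > 0 \<Longrightarrow> fls_nth (f * g) k = 0" "fls_nth (f * g) 0 = fls_nth f 0 * fls_nth g 0"
proof -
  show "k > 0 \<Longrightarrow> fls_nth (f * g) k = 0"
    unfolding fls_times_nth(2) by (intro sum.neutral ballI) (metis assms diff_gt_0_iff_gt mult_zero_left mult_zero_right not_less order.strict_trans2)
  have "(\<Sum>i=fls_subdegree f..0 - fls_subdegree g. fls_nth f i * fls_nth g (0 - i))
      = (\<Sum>i=fls_subdegree f..0 - fls_subdegree g. if i = 0 then fls_nth f 0 * fls_nth g 0 else 0)"
  proof (intro sum.cong refl)
    fix i
    show "fls_nth f i * fls_nth g (0 - i) = (if i = 0 then fls_nth f 0 * fls_nth g 0 else 0)"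
      using assms by (cases i "0::int" rule: linorder_cases) auto
  qed
  also have "\<dots> = fls_nth f 0 * fls_nth g 0"
    using fls_eq0_below_subdegree[of 0 f] fls_eq0_below_subdegree[of 0 g] by auto
  finally show "fls_nth (f * g) 0 = fls_nth f 0 * fls_nth g 0" unfolding fls_times_nth(2) .
qed

text \<open>The quotient \<open>W\<close> of \<open>g\<close> by \<open>g'\<close> is also a
  quotient in \<open>N_plus\<close>. Its entries are both power series in \<open>lambda^-1\<close>
  and polynomials in \<open>lambda\<close>, hence constants; \<open>N_plus\<close> gives ones on the
  diagonal and 0 below it, \<open>B_minus\<close> gives 0 above it.\<close>

lemma B_minus_N_plus_unique:
  fixes g g' n n' :: "'r::comm_ring_1 loop_matrix"
  assumes g: "g \<in> B_minus" "g' \<in> B_minus" and n: "n \<in> N_plus" "n' \<in> N_plus" and eq: "g ** n = g' ** n'"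
  shows "g = g'"
proof -
  obtain a b c d where e: "g = mat2 (fps_to_fls a) (fps_to_fls b) (fps_to_fls c) (fps_to_fls d)"
    and b: "fps_nth b 0 = 0" using g(1) unfolding B_minus_iff by blast
  obtain a' b' c' d' where e': "g' = mat2 (fps_to_fls a') (fps_to_fls b') (fps_to_fls c') (fps_to_fls d')"
    and det': "a' * d' - b' * c' = 1" and b': "fps_nth b' 0 = 0" using g(2) unfolding B_minus_iff by blast
  obtain p q r s where m: "n = mat2 p q r s" using mat2_entries by metis
  obtain p' q' r' s' where m': "n' = mat2 p' q' r' s'" using mat2_entries by metis
  have N: "p * s - q * r = 1" "\<forall>k>0. fls_nth p k = 0" "\<forall>k>0. fls_nth q k = 0" "\<forall>k>0. fls_nth r k = 0"
    "\<forall>k>0. fls_nth s k = 0" "fls_nth p 0 = 1" "fls_nth s 0 = 1" "fls_nth r 0 = 0"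
    using n(1) unfolding m N_plus_def by (auto simp: forall_2 mat2_nth det_mat2)
  have N': "p' * s' - q' * r' = 1" "\<forall>k>0. fls_nth p' k = 0" "\<forall>k>0. fls_nth q' k = 0" "\<forall>k>0. fls_nth r' k = 0"
    "\<forall>k>0. fls_nth s' k = 0" "fls_nth p' 0 = 1" "fls_nth s' 0 = 1" "fls_nth r' 0 = 0"
    using n(2) unfolding m' N_plus_def by (auto simp: forall_2 mat2_nth det_mat2)
  \<comment> \<open>The left factor is the adjugate of \<open>g'\<close>, which is its inverse as
    the determinant is 1.\<close>
  define W where "W = mat2 (fps_to_fls d') (- fps_to_fls b') (- fps_to_fls c') (fps_to_fls a') ** g"
  have W1: "W = mat2 (fps_to_fls (d' * a - b' * c)) (fps_to_fls (d' * b - b' * d))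
      (fps_to_fls (a' * c - c' * a)) (fps_to_fls (a' * d - c' * b))"
    unfolding W_def e by (simp add: mat2_mult fls_times_fps_to_fls)
  have dl: "fps_to_fls a' * fps_to_fls d' - fps_to_fls b' * fps_to_fls c' = 1"
    using arg_cong[OF det', of fps_to_fls] by (simp add: fls_times_fps_to_fls)
  have i1: "mat2 (fps_to_fls d') (- fps_to_fls b') (- fps_to_fls c') (fps_to_fls a') ** g' = mat 1"
    unfolding e' mat2_mult mat_1_mat2 mat2_eq_iff using dl by (simp add: algebra_simps)
  have i1': "g' ** mat2 (fps_to_fls d') (- fps_to_fls b') (- fps_to_fls c') (fps_to_fls a') = mat 1"
    unfolding e' mat2_mult mat_1_mat2 mat2_eq_iff using dl by (simp add: algebra_simps)
  have i2: "n ** mat2 s (- q) (- r) p = mat 1"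
    unfolding m mat2_mult mat_1_mat2 mat2_eq_iff using N(1) by (simp add: algebra_simps)
  have "W = W ** (n ** mat2 s (- q) (- r) p)" unfolding i2 by (simp add: matrix_mul_rid)
  also have "\<dots> = mat2 (fps_to_fls d') (- fps_to_fls b') (- fps_to_fls c') (fps_to_fls a') ** (g' ** n') ** mat2 s (- q) (- r) p"
    unfolding W_def eq[symmetric] by (simp add: matrix_mul_assoc)
  also have "\<dots> = n' ** mat2 s (- q) (- r) p"
    unfolding matrix_mul_assoc i1 by (simp add: matrix_mul_lid)
  finally have W2: "W = mat2 (p' * s - q' * r) (q' * p - p' * q) (r' * s - s' * r) (s' * p - r' * q)"
    unfolding m' mat2_mult by (simp add: algebra_simps)
  have eqs: "fps_to_fls (d' * a - b' * c) = p' * s - q' * r" "fps_to_fls (d' * b - b' * d) = q' * p - p' * q"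
    "fps_to_fls (a' * c - c' * a) = r' * s - s' * r" "fps_to_fls (a' * d - c' * b) = s' * p - r' * q"
    using W1[unfolded W2 mat2_eq_iff] by presburger+
  have const: "f = fps_const (fls_nth (fps_to_fls f) 0)"
    if "\<And>k. k > 0 \<Longrightarrow> fls_nth (fps_to_fls f) k = 0" for f :: "'r fps"
  proof (rule fps_ext)
    fix i show "fps_nth f i = fps_nth (fps_const (fls_nth (fps_to_fls f) 0)) i"
      using that[of "int i"] by (cases "i = 0") auto
  qed
  note t = fls_times_no_positive
  have "d' * a - b' * c = fps_const 1" "d' * b - b' * d = fps_const 0" "a' * c - c' * a = fps_const 0" "a' * d - c' * b = fps_const 1"
  proof -
    show "d' * a - b' * c = fps_const 1"
      by (rule trans[OF const]; unfold eqs) (simp_all add: t N N')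
    show "d' * b - b' * d = fps_const 0"
    proof (rule trans[OF const])
      show "fls_nth (fps_to_fls (d' * b - b' * d)) k = 0" if "k > 0" for k
        unfolding eqs using that by (simp add: t N N')
    qed (simp add: b b')
    show "a' * c - c' * a = fps_const 0"
      by (rule trans[OF const]; unfold eqs) (simp_all add: t N N')
    show "a' * d - c' * b = fps_const 1"
      by (rule trans[OF const]; unfold eqs) (simp_all add: t N N')
  qed
  then have "W = mat 1" unfolding W1 mat_1_mat2 by simp
  then have "g' ** W = g'" by (simp add: matrix_mul_rid)
  then show ?thesis unfolding W_def matrix_mul_assoc i1' by (simp add: matrix_mul_lid)
qed

section \<open>Evaluation of functions and translation over the dual numbers\<close>

lemma ring_map_value_at:
  assumes "ring_map \<iota>"
  shows "ring_map (\<lambda>p. value_at \<iota> p x)"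
  unfolding value_at_def
proof (rule ring_map_extend[OF assms])
  let ?f = "\<lambda>\<alpha> :: gen \<Rightarrow>\<^sub>0 nat. \<Prod>g\<in>Poly_Mapping.keys \<alpha>. coordinate x g ^ Poly_Mapping.lookup \<alpha> g"
  show "?f 0 = 1" by simp
  fix \<alpha> \<beta> :: "gen \<Rightarrow>\<^sub>0 nat"
  let ?S = "Poly_Mapping.keys \<alpha> \<union> Poly_Mapping.keys \<beta>"
  have e: "?f \<gamma> = (\<Prod>g\<in>?S. coordinate x g ^ Poly_Mapping.lookup \<gamma> g)" if "Poly_Mapping.keys \<gamma> \<subseteq> ?S" for \<gamma>
    by (rule prod.mono_neutral_left) (use that in \<open>auto simp: in_keys_iff\<close>)
  show "?f (\<alpha> + \<beta>) = ?f \<alpha> * ?f \<beta>"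
    unfolding e[OF Poly_Mapping.keys_add] e[OF Un_upper1] e[OF Un_upper2]
    by (simp add: lookup_add power_add prod.distrib)
qed

lemma value_at_simps:
  assumes "ring_map \<iota>"
  shows "value_at \<iota> (cl_gen g) x = coordinate x g" "value_at \<iota> (Poly_Mapping.single 0 c) x = \<iota> c"
  unfolding value_at_def cl_gen_def by (simp_all add: extend_single ring_mapD[OF assms])

lemma ring_map_dual_of: "ring_map dual_of"
  by (simp add: ring_map_def dual_of_def one_dual_def plus_dual_def times_dual_def)

lemma ring_map_body: "ring_map body"
  by (simp add: ring_map_def one_dual_def plus_dual_def times_dual_def)

lemma derivation_along_tangent: "derivation_along body tangent"
  by (simp add: derivation_along_def plus_dual_def times_dual_def)

lemma body_simps: "body (dual_of c) = c" "tangent (dual_of c) = 0" "body eps = 0" "tangent eps = 1"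
  by (simp_all add: dual_of_def eps_def)

lemma eps_square: "eps * eps = 0" by (simp add: eps_def times_dual_def zero_dual_def)

text \<open>In the upper right entry a constant coefficient is allowed in \<open>N_plus\<close> and
  forbidden in \<open>B_minus\<close>, so the \<open>B_minus\<close> part loses it. In the other
  entries the constant coefficient stays in the \<open>B_minus\<close> part, which is then the plain
  \<open>fps_shift\<close>.\<close>

definition shift_from :: "nat \<Rightarrow> complex fps \<Rightarrow> complex fps" where
  "shift_from k f = fps_shift k f - fps_const (fps_nth f k)"

definition hat :: "complex fps \<Rightarrow> dual fps" where
  "hat = map_coeffs dual_of"

lemma ring_map_hat: "ring_map hat" unfolding hat_def by (rule ring_map_map_coeffs[OF ring_map_dual_of])

lemmas hat_hom = ring_mapD[OF ring_map_hat]

lemma fls_dual_of_fps: "fls_dual_of (fps_to_fls f) = fps_to_fls (hat f)"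
  by (rule fls_eqI) (simp add: fls_nth_fls_dual_of hat_def map_coeffs_def ring_mapD[OF ring_map_dual_of])

lemma fls_dual_of_X: "fls_dual_of (fls_X_inv ^ k) = fls_X_inv ^ k" "fls_dual_of (- (fls_X_inv ^ k)) = - (fls_X_inv ^ k)"
  "fls_dual_of 0 = 0"
  by (rule fls_eqI, simp add: fls_nth_fls_dual_of ring_mapD[OF ring_map_dual_of])+

text \<open>Left translation by \<open>exp_eps (h_elem k)\<close> is compensated on the right by an element of
  \<^const>\<open>N_plus\<close>, the polynomial part of $2\lambda^k e-\lambda^k$ for the idempotent
  $e=x^{-1}\,\mathrm{diag}(1,0)\,x$; the remaining part moves the point inside \<^const>\<open>B_minus\<close>.\<close>

lemma exp_eps_decomposition:
  fixes a b c d :: "complex fps"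
  assumes det: "a * d - b * c = 1" and b: "fps_nth b 0 = 0" and k: "k \<ge> 1"
  defines "x \<equiv> mat2 (fps_to_fls a) (fps_to_fls b) (fps_to_fls c) (fps_to_fls d)"
    and "e11 \<equiv> fps_shift k (d * a)" and "e12 \<equiv> shift_from k (d * b)"
    and "e21 \<equiv> fps_shift k (- (c * a))" and "e22 \<equiv> fps_shift k (- (c * b))"
  defines "a' \<equiv> hat a + fps_const eps * hat (2 * (a * e11 + b * e21))"
    and "b' \<equiv> hat b + fps_const eps * hat (2 * (a * e12 + b * e22))"
    and "c' \<equiv> hat c + fps_const eps * hat (2 * (c * e11 + d * e21))"
    and "d' \<equiv> hat d + fps_const eps * hat (2 * (c * e12 + d * e22))"
  shows "a' * d' - b' * c' = 1" "fps_nth b' 0 = 0"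
    "\<exists>n\<in>N_plus. exp_eps (h_elem k) ** matrix_dual_of x
       = mat2 (fps_to_fls a') (fps_to_fls b') (fps_to_fls c') (fps_to_fls d') ** n"
proof -
  define E where "E = (fps_const eps :: dual fps)"
  have EE: "E * E = 0" "E * (E * w) = 0" for w
    by (simp_all add: E_def eps_square mult.assoc[symmetric])
  \<comment> \<open>The idempotent has trace 1, and the shift by \<open>k >= 1\<close> sends the
    series 1 to 0.\<close>
  have tr: "e11 + e22 = 0"
  proof -
    have "e11 + e22 = fps_shift k (a * d - b * c)"
      by (rule fps_ext) (simp add: e11_def e22_def mult.commute)
    then show ?thesis unfolding det using k by (simp add: fps_eq_iff)
  qed
  have e22: "e22 = - e11" using tr by (simp add: eq_neg_iff_add_eq_0 add.commute)
  have dh: "hat a * hat d - hat b * hat c = 1"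
    using arg_cong[OF det, of hat] by (simp add: hat_hom)
  have t2: "hat (2 * w) = 2 * hat w" for w
    unfolding mult_2 by (rule hat_hom)
  note defs = a'_def b'_def c'_def d'_def
  have "a' * d' - b' * c' = (hat a * hat d - hat b * hat c)
      + E * (2 * (hat a * (hat c * hat e12 + hat d * hat e22) + (hat a * hat e11 + hat b * hat e21) * hat d
         - hat b * (hat c * hat e11 + hat d * hat e21) - (hat a * hat e12 + hat b * hat e22) * hat c))"
    unfolding defs E_def[symmetric] t2 by (simp add: hat_hom algebra_simps EE)
  also have "hat a * (hat c * hat e12 + hat d * hat e22) + (hat a * hat e11 + hat b * hat e21) * hat d
         - hat b * (hat c * hat e11 + hat d * hat e21) - (hat a * hat e12 + hat b * hat e22) * hat c = 0"
    unfolding e22 hat_hom by (simp add: algebra_simps)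
  finally show "a' * d' - b' * c' = 1" unfolding dh by simp
  have "fps_nth e12 0 = 0" by (simp add: e12_def shift_from_def)
  then show "fps_nth b' 0 = 0"
    using b by (simp add: b'_def hat_def map_coeffs_def fps_mult_nth ring_mapD[OF ring_map_dual_of])
  define L where "L = (fls_X_inv ^ k :: dual fls)"
  define F where "F = (fls_const eps :: dual fls)"
  define i where "i = (\<lambda>f. fps_to_fls (hat f))"
  have i: "i (f + g) = i f + i g" "i (f - g) = i f - i g" "i (f * g) = i f * i g" "i (- f) = - i f" "i 1 = 1" for f g
    by (simp_all add: i_def hat_hom fls_times_fps_to_fls)
  have FF: "F * F = 0" "F * (F * w) = 0" for w
    by (simp_all add: F_def eps_square mult.assoc[symmetric])
  have Lnth: "fls_nth (L * i f) j = (if j + int k < 0 then 0 else dual_of (fps_nth f (nat (j + int k))))" for f j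
    unfolding L_def i_def fls_X_inv_power_times_conv_shift by (simp add: hat_def map_coeffs_def)
  have L0: "fls_nth L j = 0" if "j \<ge> 0" for j
    using that k by (simp add: L_def)
  have inth: "fls_nth (i f) j = (if j < 0 then 0 else dual_of (fps_nth f (nat j)))" for f j
    by (simp add: i_def hat_def map_coeffs_def)
  \<comment> \<open>\<open>d * a\<close>, \<open>d * b\<close>, \<open>- (c * a)\<close> and
    \<open>- (c * b)\<close> are the entries of the idempotent. What remains of
    \<open>lambda^k\<close> times them has only positive powers of \<open>lambda\<close>, and in the
    upper right entry also a constant.\<close>
  define P11 where "P11 = L * i (d * a) - i e11"
  define P12 where "P12 = L * i (d * b) - i e12"
  define P21 where "P21 = L * i (- (c * a)) - i e21"
  define P22 where "P22 = L * i (- (c * b)) - i e22"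
  have nk: "nat (j + int k) = nat j + k" if "j \<ge> 0" for j using that by (simp add: nat_add_distrib)
  have P0: "fls_nth P11 j = 0" "fls_nth P21 j = 0" "fls_nth P22 j = 0" if "j \<ge> 0" for j
    using that by (simp_all add: P11_def P21_def P22_def Lnth inth e11_def e21_def e22_def nk add.commute)
  have P12: "fls_nth P12 j = 0" if "j > 0" for j
    using that by (simp add: P12_def Lnth inth e12_def shift_from_def nk add.commute)
  define n where "n = mat2 (1 + F * (2 * P11 - L)) (F * (2 * P12)) (F * (2 * P21)) (1 + F * (2 * P22 - L))"
  have diag: "i (d * a) + i (- (c * b)) = 1"
  proof -
    have "d * a + - (c * b) = 1" using det by (simp add: algebra_simps)
    then show ?thesis unfolding i(1)[symmetric] by (simp add: i(5))
  qed
  have "P11 + P22 = L * (i (d * a) + i (- (c * b))) - i (e11 + e22)"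
    unfolding P11_def P22_def i(1) by (simp add: algebra_simps)
  also have "\<dots> = L" unfolding diag tr using i(2)[of 0 0] by simp
  finally have PL: "P22 = L - P11" by (simp add: algebra_simps)
  have "det n = 1 + F * (2 * (P11 + P22) - 2 * L)"
    unfolding n_def det_mat2 by (simp add: algebra_simps FF)
  then have det_n: "det n = 1" unfolding PL by simp
  have two: "fls_nth (2 * f) j = 2 * fls_nth f j" for f :: "dual fls" and j unfolding mult_2 by simp
  have "n \<in> N_plus"
    unfolding N_plus_def using det_n
    by (simp add: forall_2 n_def mat2_nth F_def two P0 P12 L0)
  moreover have "exp_eps (h_elem k) ** matrix_dual_of x
      = mat2 (fps_to_fls a') (fps_to_fls b') (fps_to_fls c') (fps_to_fls d') ** n"
  proof -
    have 1: "exp_eps (h_elem k) = mat2 (1 + F * L) 0 0 (1 - F * L)"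
      unfolding exp_eps_def h_elem_def mat_1_mat2 F_def L_def
      by (simp add: vec_eq_iff forall_2 mat2_nth fls_dual_of_X)
    have 2: "matrix_dual_of x = mat2 (i a) (i b) (i c) (i d)"
      unfolding matrix_dual_of_def x_def i_def
      by (simp add: vec_eq_iff forall_2 mat2_nth fls_dual_of_fps)
    have 3: "fps_to_fls (hat f + fps_const eps * hat (2 * g)) = i f + F * (2 * i g)" for f g
      unfolding t2 by (simp add: i_def F_def fls_times_fps_to_fls)
    have dl: "i a * i d = 1 + i b * i c"
      using arg_cong[OF det, of i] unfolding i by (simp add: algebra_simps)
    have dl': "i a * (i d * w) = w + i b * (i c * w)" for w
      using arg_cong[OF dl, of "\<lambda>t. t * w"] by (simp add: algebra_simps)
    have dl'': "i a * (i b * (i d * w)) = i b * w + i b * (i b * (i c * w))"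
      "i a * (i c * (i d * w)) = i c * w + i b * (i c * (i c * w))" for w
      using dl'[of "i b * w"] dl'[of "i c * w"] by (simp_all add: mult_ac)
    show ?thesis
      unfolding 1 2 defs 3 n_def mat2_mult mat2_eq_iff P11_def P12_def P21_def P22_def i
      by (simp add: algebra_simps FF dl dl' dl'')
  qed
  ultimately show "\<exists>n\<in>N_plus. exp_eps (h_elem k) ** matrix_dual_of x
       = mat2 (fps_to_fls a') (fps_to_fls b') (fps_to_fls c') (fps_to_fls d') ** n" by blast
qed

lemma value_at_cong: "coordinate x = coordinate y \<Longrightarrow> value_at \<iota> p x = value_at \<iota> p y"
  unfolding value_at_def by simp

text \<open>The value does not depend on the factorization: two elements of \<open>B_minus\<close>
  that represent the double coset differ by an element of \<open>H_minus\<close>, which the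
  coordinates do not see.\<close>

lemma left_action_eq:
  assumes "b \<in> B_minus" "n \<in> N_plus" "exp_eps X ** matrix_dual_of x = b ** n"
  shows "left_action X \<phi> x = tangent (value_at dual_of \<phi> b)"
  unfolding left_action_def
proof (rule the_equality)
  have "mat 1 \<in> (H_minus :: dual loop_matrix set)"
    unfolding H_minus_def mat_1_mat2 by (auto intro!: exI[of _ 1])
  moreover have "exp_eps X ** matrix_dual_of x = mat 1 ** b ** n"
    using assms(3) by (simp add: matrix_mul_lid)
  ultimately show "\<exists>b'\<in>B_minus. \<exists>h\<in>H_minus. \<exists>n\<in>N_plus. exp_eps X ** matrix_dual_of x = h ** b' ** n
      \<and> tangent (value_at dual_of \<phi> b) = tangent (value_at dual_of \<phi> b')"
    using assms by blast
next
  fix e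
  assume "\<exists>b\<in>B_minus. \<exists>h\<in>H_minus. \<exists>n\<in>N_plus. exp_eps X ** matrix_dual_of x = h ** b ** n
      \<and> e = tangent (value_at dual_of \<phi> b)"
  then obtain b' h n' where b': "b' \<in> B_minus" "h \<in> H_minus" "n' \<in> N_plus"
    "exp_eps X ** matrix_dual_of x = h ** b' ** n'" "e = tangent (value_at dual_of \<phi> b')" by blast
  note hb = cl_coordinates_H_minus[OF b'(1,2)]
  have "h ** b' = b"
    by (rule B_minus_N_plus_unique[OF hb(1) assms(1) b'(3) assms(2)]) (use assms(3) b'(4) in simp)
  then show "e = tangent (value_at dual_of \<phi> b)"
    using hb(2) b'(5) value_at_cong by metis
qed

section \<open>Comparison of the flow with the translation\<close>

definition mu_coeff :: "nat \<Rightarrow> 'a::ring_1 fps fps \<Rightarrow> 'a fps" where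
  "mu_coeff k F = Abs_fps (\<lambda>i. fps_nth (fps_nth F i) k)"

text \<open>The sixth equation links the flow to the factorization: in \<open>mu^-1\<close> times
  the difference quotient of \<open>f\<close>, the coefficient of \<open>mu^-k\<close> is
  \<open>lambda^k f\<close> without its positive powers of \<open>lambda\<close>.\<close>

lemma mu_coeff_simps:
  fixes F G :: "'a::ring_1 fps fps"
  shows "mu_coeff k (F + G) = mu_coeff k F + mu_coeff k G" "mu_coeff k (F - G) = mu_coeff k F - mu_coeff k G"
    "mu_coeff k (- F) = - mu_coeff k F"
    "mu_coeff k (at_lambda w * F) = w * mu_coeff k F" "mu_coeff k (lambda_inv * F) = fps_X * mu_coeff k F"
    "k \<ge> 1 \<Longrightarrow> mu_coeff k (mu_inv * shifted_quotient f) = fps_shift k f"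
    "mu_coeff k (at_mu f) = fps_const (fps_nth f k)"
  by (auto simp: fps_eq_iff mu_coeff_def fps_mult_nth[of w] fps_mult_nth[of "at_lambda w"] fps_sum_nth
      at_lambda_nth lambda_inv_def mu_inv_def at_mu_def shifted_quotient_def)

lemma hat_derivatives:
  "map_coeffs body (hat f) = f" "map_coeffs tangent (hat f) = 0"
  by (simp_all add: fps_eq_iff hat_def map_coeffs_def body_simps)

lemma first_order_hat:
  "map_coeffs body (hat f + fps_const eps * hat g) = f" "map_coeffs tangent (hat f + fps_const eps * hat g) = g"
proof -
  note b = ring_mapD[OF ring_map_map_coeffs[OF ring_map_body]]
  note t = derivation_alongD[OF derivation_along_map_coeffs[OF derivation_along_tangent]]
  have 0: "body 0 = 0" "tangent 0 = 0" by (simp_all add: zero_dual_def)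
  have e: "map_coeffs body (fps_const eps) = 0" "map_coeffs tangent (fps_const eps) = 1"
    using map_coeffs_fps_const[of body eps] map_coeffs_fps_const[of tangent eps] 0 by (simp_all add: body_simps)
  show "map_coeffs body (hat f + fps_const eps * hat g) = f" "map_coeffs tangent (hat f + fps_const eps * hat g) = g"
    by (simp_all add: b t e hat_derivatives)
qed

text \<open>\<open>G\<close> and \<open>G'\<close> are explicit solutions of the evaluated Riccati
  equations: each entry of the idempotent is replaced by \<open>mu^-1\<close> times its difference
  quotient, with a correction in the upper right one. Their coefficients at \<open>mu^-k\<close> are
  the truncations that occur in the factorization.\<close>

lemma flow_at_point:
  fixes a b c d :: "complex fps"
  assumes det: "a * d - b * c = 1" and b0: "fps_nth b 0 = 0" and k: "k \<ge> 1"
  defines "x \<equiv> mat2 (fps_to_fls a) (fps_to_fls b) (fps_to_fls c) (fps_to_fls d)"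
    and "e11 \<equiv> fps_shift k (d * a)" and "e12 \<equiv> shift_from k (d * b)"
    and "e21 \<equiv> fps_shift k (- (c * a))" and "e22 \<equiv> fps_shift k (- (c * b))"
  defines "u \<equiv> u_cl x" and "Y \<equiv> fps_X * m_cl x"
    and "ev \<equiv> \<lambda>w. value_at (\<lambda>c. c) (classical_limit w) x"
  shows "mu_coeff k (map_coeffs (map_coeffs ev) u_flow) = u * e11 + e21 - u * (u * e12) - u * e22"
    "fps_X * mu_coeff k (map_coeffs (map_coeffs ev) m_flow) = - (e12 - Y * e22 + Y * e11 - Y * (Y * e21))"
proof -
  have id: "ring_map (\<lambda>c :: complex. c)" by (simp add: ring_map_def)
  have ev: "ring_map ev"
    using ring_map_value_at[OF id] ring_map_classical_limit unfolding ev_def ring_map_def by simp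
  note ev1 = ring_mapD[OF ring_map_map_coeffs[OF ev]]
  note ev2 = ring_mapD[OF ring_map_map_coeffs[OF ring_map_map_coeffs[OF ev]]]
  have evg: "ev (generator g) = coordinate x g" for g
    unfolding ev_def classical_limit_generator value_at_simps[OF id] ..
  have us: "map_coeffs ev u_series = u" "map_coeffs ev m_series = m_cl x"
    by (simp_all add: fps_eq_iff map_coeffs_def u_series_def m_series_def ring_mapD[OF ev]
        ring_map_power_sign[OF ev] evg sign_cancel u_def)
  have eX: "map_coeffs ev fps_X = fps_X" by (rule map_coeffs_X[OF ev])
  have ud: "u * d = c" and Ya: "Y * a = - b"
    using cl_coordinates[OF det b0] unfolding u_def Y_def x_def by simp_all
  have i11: "map_coeffs ev idem11 = d * a"
  proof -
    have "map_coeffs ev mu_inverse * (1 + Y * u) = 1"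
      using arg_cong[OF mu_inverse(2), of "map_coeffs ev"] by (simp add: ev1 us eX Y_def)
    moreover have "(1 + Y * u) * (d * a) = 1"
    proof -
      have "(1 + Y * u) * (d * a) = d * a + (Y * a) * (u * d)" by (simp add: algebra_simps)
      also have "\<dots> = a * d - b * c" unfolding ud Ya by (simp add: mult_ac)
      finally show ?thesis unfolding det .
    qed
    ultimately show ?thesis unfolding idem11_def by (metis mult.assoc mult_1_left mult_1_right)
  qed
  have i12: "map_coeffs ev idem12 = d * b"
  proof -
    have "map_coeffs ev idem12 = - (d * (Y * a))"
      unfolding idem12_def ev1 i11[unfolded idem11_def] us eX Y_def by (simp add: mult_ac)
    then show ?thesis unfolding Ya by simp
  qed
  have i21: "map_coeffs ev idem21 = - (c * a)"
    unfolding idem21_def ev1 i11[unfolded idem11_def] us ud[symmetric] by (simp add: mult_ac)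
  have i22: "map_coeffs ev idem22 = - (c * b)"
  proof -
    have "map_coeffs ev idem22 = (u * d) * (Y * a)"
      unfolding idem22_def ev1 i11[unfolded idem11_def] us eX Y_def by (simp add: mult_ac)
    then show ?thesis unfolding Ya ud by simp
  qed
  define S where "S = (\<lambda>f :: complex fps. mu_inv * shifted_quotient f)"
  have S: "(lambda_inv - mu_inv) * S f = mu_inv * (at_lambda f - at_mu f)" for f
    unfolding S_def shifted_quotient[symmetric] by (simp add: mult_ac)
  have S': "lambda_inv * S f = mu_inv * S f + mu_inv * (at_lambda f - at_mu f)" for f
    using S[of f] by (simp add: left_diff_distrib algebra_simps)
  \<comment> \<open>The subtracted term removes the constant coefficient, as in
    \<open>shift_from\<close>. It also accounts for the factor \<open>lambda_inv\<close>, in place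
    of \<open>mu_inv\<close>, at this entry of the Riccati equation.\<close>
  define S12 where "S12 = S (d * b) - at_mu (d * b)"
  have cS: "mu_coeff k (S f) = fps_shift k f" for f unfolding S_def by (rule mu_coeff_simps(6)[OF k])
  have cS12: "mu_coeff k S12 = e12"
    unfolding S12_def mu_coeff_simps cS e12_def shift_from_def ..
  note al = at_lambda_hom
  let ?u = "at_lambda u" and ?y = "at_lambda Y"
  have X: "at_lambda (fps_X :: complex fps) = lambda_inv"
    by (simp add: at_lambda_def lambda_inv_def fps_eq_iff fps_X_def)
  have Yl: "?y = lambda_inv * at_lambda (m_cl x)"
    unfolding Y_def al(3) X ..
  define G where "G = ?u * S (d * a) + S (- (c * a)) - ?u * (?u * S12) - ?u * S (- (c * b))"
  have R1: "(lambda_inv - mu_inv) * - map_coeffs (map_coeffs ev) u_flow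
    = - (lambda_inv * (?u * at_mu (d * b) * ?u))
      + mu_inv * (?u * at_mu (d * a) - at_mu (- (c * b)) * ?u + at_mu (- (c * a)))"
    using arg_cong[OF u_flow_riccati, of "map_coeffs (map_coeffs ev)"]
    unfolding ev2 map_coeffs2_series[OF ev] us i11 i12 i21 i22 .
  \<comment> \<open>This is the row \<open>(u, 1)\<close> times the idempotent times the column
    \<open>(1, -u)\<close>, all at lambda. The idempotent annihilates the row because
    \<open>u * d = c\<close>.\<close>
  have z1: "?u * at_lambda (d * a) + at_lambda (- (c * a)) - ?u * (?u * at_lambda (d * b)) - ?u * at_lambda (- (c * b)) = 0"
    unfolding al(3)[symmetric] al(2)[symmetric] al(6)[symmetric] ud[symmetric]
    by (simp add: algebra_simps al)
  have g: "(lambda_inv - mu_inv) * G = mu_inv * (?u * at_lambda (d * a) + at_lambda (- (c * a)) - ?u * (?u * at_lambda (d * b)) - ?u * at_lambda (- (c * b)))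
      - mu_inv * (?u * at_mu (d * a) + at_mu (- (c * a)) - ?u * (?u * at_mu (d * b)) - ?u * at_mu (- (c * b)))
      + (lambda_inv - mu_inv) * (?u * (?u * at_mu (d * b)))"
    unfolding G_def S12_def by (simp add: algebra_simps S')
  have "(lambda_inv - mu_inv) * map_coeffs (map_coeffs ev) u_flow
      = - ((lambda_inv - mu_inv) * - map_coeffs (map_coeffs ev) u_flow)" by simp
  also have "\<dots> = (lambda_inv - mu_inv) * G"
    unfolding R1 g z1 by (simp add: algebra_simps)
  finally have "(lambda_inv - mu_inv) * map_coeffs (map_coeffs ev) u_flow = (lambda_inv - mu_inv) * G" .
  then have "map_coeffs (map_coeffs ev) u_flow = G" by (rule diff_mult_cancel)
  then show "mu_coeff k (map_coeffs (map_coeffs ev) u_flow) = u * e11 + e21 - u * (u * e12) - u * e22"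
    unfolding G_def by (simp add: mu_coeff_simps cS cS12 e11_def e21_def e22_def)
  define G' where "G' = - (S12 - ?y * S (- (c * b)) + ?y * S (d * a) - ?y * (?y * S (- (c * a))))"
  have R2: "(lambda_inv - mu_inv) * - (lambda_inv * map_coeffs (map_coeffs ev) m_flow)
    = - (mu_inv * (at_mu (d * a) * ?y)) - lambda_inv * at_mu (d * b)
      + mu_inv * (?y * at_mu (- (c * a)) * ?y + ?y * at_mu (- (c * b)))"
    using arg_cong[OF m_flow_riccati, of "map_coeffs (map_coeffs ev)"]
    unfolding ev2 map_coeffs2_series[OF ev] us i11 i12 i21 i22 Yl[symmetric] .
  have bY: "b = - (Y * a)" using Ya by simp
  \<comment> \<open>Here the row is \<open>(1, -Y)\<close> and the column is \<open>(Y, 1)\<close>,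
    which is annihilated because \<open>Y * a = - b\<close>.\<close>
  have z2: "at_lambda (d * b) - ?y * at_lambda (- (c * b)) + ?y * at_lambda (d * a) - ?y * (?y * at_lambda (- (c * a))) = 0"
    unfolding al(3)[symmetric] al(2)[symmetric] al(6)[symmetric] bY
    by (simp add: algebra_simps al)
  have g': "(lambda_inv - mu_inv) * G' = - mu_inv * (at_lambda (d * b) - ?y * at_lambda (- (c * b)) + ?y * at_lambda (d * a) - ?y * (?y * at_lambda (- (c * a))))
      + mu_inv * (at_mu (d * b) - ?y * at_mu (- (c * b)) + ?y * at_mu (d * a) - ?y * (?y * at_mu (- (c * a))))
      + (lambda_inv - mu_inv) * at_mu (d * b)"
    unfolding G'_def S12_def by (simp add: algebra_simps S')
  have "(lambda_inv - mu_inv) * (lambda_inv * map_coeffs (map_coeffs ev) m_flow)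
      = - ((lambda_inv - mu_inv) * - (lambda_inv * map_coeffs (map_coeffs ev) m_flow))" by simp
  also have "\<dots> = (lambda_inv - mu_inv) * G'"
    unfolding R2 g' z2 by (simp add: algebra_simps)
  finally have "(lambda_inv - mu_inv) * (lambda_inv * map_coeffs (map_coeffs ev) m_flow) = (lambda_inv - mu_inv) * G'" .
  then have "lambda_inv * map_coeffs (map_coeffs ev) m_flow = G'" by (rule diff_mult_cancel)
  then have "mu_coeff k (lambda_inv * map_coeffs (map_coeffs ev) m_flow) = mu_coeff k G'" by simp
  then show "fps_X * mu_coeff k (map_coeffs (map_coeffs ev) m_flow) = - (e12 - Y * e22 + Y * e11 - Y * (Y * e21))"
    unfolding G'_def by (simp add: mu_coeff_simps cS cS12 e11_def e21_def e22_def)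
qed

text \<open>Evaluation at the translate \<open>y\<close> is a homomorphism into the dual numbers.
  Its tangent and twice the flow evaluated at \<open>x\<close> are both derivations along evaluation
  at \<open>x\<close>, so they need only be compared on generators. There the tangents come from
  differentiating \<open>u_cl y * d' = c'\<close> and
  \<open>fps_X * m_cl y * a' = - b'\<close>.\<close>

lemma flow_is_left_action:
  assumes x: "x \<in> B_minus" and k: "k \<ge> 1"
  shows "value_at (\<lambda>c. c) (classical_limit ((- 1) ^ k * flow_coeff k w)) x
    = 1 / 2 * left_action (h_elem k) (classical_limit w) x"
proof -
  \<comment> \<open>\<open>y\<close> represents the double coset of the translate of \<open>x\<close>.\<close>
  obtain a b c d where xe: "x = mat2 (fps_to_fls a) (fps_to_fls b) (fps_to_fls c) (fps_to_fls d)"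
    and det: "a * d - b * c = 1" and b0: "fps_nth b 0 = 0" using x unfolding B_minus_iff by blast
  define e11 where "e11 = fps_shift k (d * a)"
  define e12 where "e12 = shift_from k (d * b)"
  define e21 where "e21 = fps_shift k (- (c * a))"
  define e22 where "e22 = fps_shift k (- (c * b))"
  define u where "u = u_cl x"
  define m where "m = m_cl x"
  define Y where "Y = fps_X * m"
  define ev where "ev = (\<lambda>w. value_at (\<lambda>c. c) (classical_limit w) x)"
  define a' where "a' = hat a + fps_const eps * hat (2 * (a * e11 + b * e21))"
  define b' where "b' = hat b + fps_const eps * hat (2 * (a * e12 + b * e22))"
  define c' where "c' = hat c + fps_const eps * hat (2 * (c * e11 + d * e21))"
  define d' where "d' = hat d + fps_const eps * hat (2 * (c * e12 + d * e22))"
  define y where "y = mat2 (fps_to_fls a') (fps_to_fls b') (fps_to_fls c') (fps_to_fls d')"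
  note dec = exp_eps_decomposition[OF det b0 k, folded xe e11_def e12_def e21_def e22_def,
      folded a'_def b'_def c'_def d'_def, folded y_def]
  note point = flow_at_point[OF det b0 k, folded xe e11_def e12_def e21_def e22_def,
      folded u_def m_def ev_def, folded Y_def]
  have yB: "y \<in> B_minus" unfolding B_minus_iff y_def using dec(1,2) by blast
  have ud: "u * d = c" and Ya: "Y * a = - b"
    using cl_coordinates[OF det b0] unfolding u_def Y_def m_def xe by simp_all
  have ud': "u_cl y * d' = c'" and Ya': "fps_X * m_cl y * a' = - b'"
    using cl_coordinates[OF dec(1,2)] unfolding y_def by simp_all
  note bd = ring_mapD[OF ring_map_map_coeffs[OF ring_map_body]]
  note tg = derivation_alongD[OF derivation_along_map_coeffs[OF derivation_along_tangent]]
  have bX: "map_coeffs body fps_X = fps_X" by (rule map_coeffs_X[OF ring_map_body])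
  have tX: "map_coeffs tangent fps_X = 0"
    by (rule map_coeffs_X_zero) (simp_all add: zero_dual_def one_dual_def)
  have bt: "map_coeffs body a' = a" "map_coeffs body b' = b" "map_coeffs body c' = c" "map_coeffs body d' = d"
    "map_coeffs tangent a' = 2 * (a * e11 + b * e21)" "map_coeffs tangent b' = 2 * (a * e12 + b * e22)"
    "map_coeffs tangent c' = 2 * (c * e11 + d * e21)" "map_coeffs tangent d' = 2 * (c * e12 + d * e22)"
    unfolding a'_def b'_def c'_def d'_def by (rule first_order_hat)+
  obtain i where di: "d * i = 1" using unit_coordinates[OF det b0] .
  obtain j where aj: "a * j = 1"
    using unit_coordinates[of d a b c] det b0 by (metis mult.commute)
  have bu: "map_coeffs body (u_cl y) = u"
    by (rule fps_unit_cancel[OF di]) (use arg_cong[OF ud', of "map_coeffs body"] ud in \<open>simp add: bd bt\<close>)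
  have "fps_X * map_coeffs body (m_cl y) = Y"
    by (rule fps_unit_cancel[OF aj])
      (use arg_cong[OF Ya', of "map_coeffs body"] Ya in \<open>simp add: bd bt bX\<close>)
  then have "fps_X * (map_coeffs body (m_cl y) - m) = 0" unfolding Y_def by (simp add: right_diff_distrib)
  then have bm: "map_coeffs body (m_cl y) = m" using fps_X_mult_eq_0 by (metis eq_iff_diff_eq_0)
  have tu: "map_coeffs tangent (u_cl y) = 2 * mu_coeff k (map_coeffs (map_coeffs ev) u_flow)"
  proof (rule fps_unit_cancel[OF di])
    have "map_coeffs tangent (u_cl y) * d + u * (2 * (c * e12 + d * e22)) = 2 * (c * e11 + d * e21)"
      using arg_cong[OF ud', of "map_coeffs tangent"] by (simp add: tg bt bu)
    then have "map_coeffs tangent (u_cl y) * d = 2 * (c * e11 + d * e21) - u * (2 * (c * e12 + d * e22))"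
      by (simp add: algebra_simps)
    also have "\<dots> = 2 * (u * e11 + e21 - u * (u * e12) - u * e22) * d"
      unfolding ud[symmetric] by (simp add: algebra_simps)
    finally show "map_coeffs tangent (u_cl y) * d = 2 * mu_coeff k (map_coeffs (map_coeffs ev) u_flow) * d"
      unfolding point(1) .
  qed
  have "fps_X * map_coeffs tangent (m_cl y) = 2 * (fps_X * mu_coeff k (map_coeffs (map_coeffs ev) m_flow))"
  proof (rule fps_unit_cancel[OF aj])
    have "fps_X * map_coeffs tangent (m_cl y) * a + Y * (2 * (a * e11 + b * e21)) = - (2 * (a * e12 + b * e22))"
      using arg_cong[OF Ya', of "map_coeffs tangent"] by (simp add: tg bd bt bm tX bX Y_def)
    then have "fps_X * map_coeffs tangent (m_cl y) * a = - (2 * (a * e12 + b * e22)) - Y * (2 * (a * e11 + b * e21))"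
      by (simp add: algebra_simps)
    also have "\<dots> = - (2 * (a * e12 - (- b) * e22)) - Y * (2 * (a * e11 - (- b) * e21))" by simp
    also have "\<dots> = 2 * (- (e12 - Y * e22 + Y * e11 - Y * (Y * e21))) * a"
      unfolding Ya[symmetric] by (simp add: algebra_simps)
    finally show "fps_X * map_coeffs tangent (m_cl y) * a = 2 * (fps_X * mu_coeff k (map_coeffs (map_coeffs ev) m_flow)) * a"
      unfolding point(2) .
  qed
  then have "fps_X * (map_coeffs tangent (m_cl y) - 2 * mu_coeff k (map_coeffs (map_coeffs ev) m_flow)) = 0"
    by (simp add: right_diff_distrib mult_ac)
  then have tm: "map_coeffs tangent (m_cl y) = 2 * mu_coeff k (map_coeffs (map_coeffs ev) m_flow)"
    using fps_X_mult_eq_0 by (metis eq_iff_diff_eq_0)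
  have id: "ring_map (\<lambda>c :: complex. c)" by (simp add: ring_map_def)
  have ev: "ring_map ev"
    using ring_map_value_at[OF id] ring_map_classical_limit unfolding ev_def ring_map_def by simp
  define \<phi> where "\<phi> = (\<lambda>w. value_at dual_of (classical_limit w) y)"
  have \<phi>: "ring_map \<phi>"
    using ring_map_value_at[OF ring_map_dual_of] ring_map_classical_limit unfolding \<phi>_def ring_map_def by simp
  have evg: "ev (generator g) = coordinate x g" and evs: "ev (scalar s) = at_q_1 s" for g s
    unfolding ev_def classical_limit_generator classical_limit_scalar value_at_simps[OF id] by (rule refl)+
  have \<phi>g: "\<phi> (generator g) = coordinate y g" and \<phi>s: "\<phi> (scalar s) = dual_of (at_q_1 s)" for g s
    unfolding \<phi>_def classical_limit_generator classical_limit_scalar value_at_simps[OF ring_map_dual_of] by (rule refl)+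
  have fc: "(- 1) ^ k * flow_coeff k w = fps_nth (flow w) k" for w
    unfolding flow_coeff_def sign_cancel ..
  have fsign: "fps_nth (flow ((- 1) ^ i * w)) k = (- 1) ^ i * fps_nth (flow w) k" for i w
    unfolding fc[symmetric] derivation_sign[OF derivation_flow_coeff]
    by (rule central_left_swap[OF central_sign])
  have dsign: "(- 1) ^ i = dual_of ((- 1) ^ i)" for i
    by (induction i) (simp_all add: dual_of_def one_dual_def uminus_dual_def times_dual_def)
  have tsign: "tangent ((- 1) ^ i * w) = (- 1) ^ i * tangent w" "body ((- 1) ^ i * w) = (- 1) ^ i * body w" for i w
    unfolding dsign by (simp_all add: times_dual_def dual_of_def)
  have key: "body (\<phi> w) = ev w \<and> tangent (\<phi> w) = 2 * ev (fps_nth (flow w) k)" for w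
  proof (induction w rule: qalg_induct)
    case (scalar s)
    show ?case by (simp add: \<phi>s evs body_simps flow_scalar ring_mapD[OF ev])
  next
    case (gen g)
    have col: "tangent (fps_nth f i) = 2 * ev (fps_nth (flow (fps_nth s i)) k)"
      if "map_coeffs tangent f = 2 * mu_coeff k (map_coeffs (map_coeffs ev) (map_coeffs flow s))" for f s i
      using arg_cong[OF that[unfolded mult_2[of "mu_coeff k _"]], of "\<lambda>F. fps_nth F i"]
      by (simp add: map_coeffs_def mu_coeff_def)
    have bod: "body (fps_nth f i) = fps_nth s i" if "map_coeffs body f = s" for f s i
      unfolding that[symmetric] by (simp add: map_coeffs_def)
    have split: "2 * ev (fps_nth (flow w) k) = (- 1) ^ i * (2 * ev (fps_nth (flow ((- 1) ^ i * w)) k))" for w i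
      unfolding fsign ring_mapD[OF ev] ring_map_power_sign[OF ev] by (simp add: mult.left_commute sign_cancel)
    show ?case
    proof (cases g)
      case (GenU i)
      have "tangent (fps_nth (u_cl y) i) = 2 * ev (fps_nth (flow ((- 1) ^ i * generator (GenU i))) k)"
        using col[of "u_cl y" u_series i, unfolded flow_series, OF tu] by (simp add: u_series_def)
      then have "tangent (\<phi> (generator g)) = 2 * ev (fps_nth (flow (generator g)) k)"
        unfolding \<phi>g GenU coordinate.simps tsign by (simp only: split[symmetric])
      moreover have "body (\<phi> (generator g)) = ev (generator g)"
        unfolding \<phi>g evg GenU coordinate.simps tsign bod[OF bu] u_def ..
      ultimately show ?thesis by blast
    next
      case (GenM i)
      have "tangent (fps_nth (m_cl y) i) = 2 * ev (fps_nth (flow ((- 1) ^ i * generator (GenM i))) k)"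
        using col[of "m_cl y" m_series i, unfolded flow_series, OF tm] by (simp add: m_series_def)
      then have "tangent (\<phi> (generator g)) = 2 * ev (fps_nth (flow (generator g)) k)"
        unfolding \<phi>g GenM coordinate.simps tsign by (simp only: split[symmetric])
      moreover have "body (\<phi> (generator g)) = ev (generator g)"
        unfolding \<phi>g evg GenM coordinate.simps tsign bod[OF bm] m_def ..
      ultimately show ?thesis by blast
    qed
  next
    case (add v w)
    then show ?case
      by (simp add: ring_mapD[OF \<phi>] ring_mapD[OF ev] plus_dual_def derivation_alongD[OF derivation_along_flow])
  next
    case (mult v w)
    then show ?case
      by (simp add: ring_mapD[OF \<phi>] ring_mapD[OF ev] times_dual_def derivation_alongD[OF derivation_along_flow] algebra_simps)
  qed
  obtain n where "n \<in> N_plus" "exp_eps (h_elem k) ** matrix_dual_of x = y ** n" using dec(3) by blast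
  then have "left_action (h_elem k) (classical_limit w) x = tangent (\<phi> w)"
    unfolding \<phi>_def by (rule left_action_eq[OF yB])
  then show ?thesis using key[of w] unfolding fc ev_def by simp
qed

theorem proposition6:
  shows "\<exists>H :: nat \<Rightarrow> qalg \<Rightarrow> qalg.
     (\<forall>n\<ge>1. derivation (H n)) \<and>
     (\<forall>n\<ge>1. \<forall>p\<ge>1. H n \<circ> H p = H p \<circ> H n) \<and>
     H_mu H u_series =
       div_diff ((lambda_inv * at_lambda u_series - mu_inv * at_mu u_series)
                   * at_mu v_series * at_lambda u_series)
       - div_diff (mu_inv * (at_lambda u_series - at_mu u_series)
                   * (1 + at_mu v_series * at_mu u_series)) \<and>
     H_mu H m_series =
       div_diff (mu_inv * (1 + at_mu m_series * at_mu w_series)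
                   * (at_lambda m_series - at_mu m_series))
       - div_diff (at_lambda m_series * at_mu w_series
                   * (lambda_inv * at_lambda m_series - mu_inv * at_mu m_series)) \<and>
     (\<forall>H'. (\<forall>n\<ge>1. derivation (H' n)) \<and>
        H_mu H' u_series = H_mu H u_series \<and> H_mu H' m_series = H_mu H m_series \<longrightarrow>
        (\<forall>n\<ge>1. H' n = H n)) \<and>
     (\<forall>k\<ge>1. \<forall>a. \<forall>x\<in>B_minus.
        value_at (\<lambda>c. c) (classical_limit ((-1) ^ k * H k a)) x
          = 1 / 2 * left_action (h_elem k) (classical_limit a) x)"
proof (intro exI[of _ flow_coeff] conjI)
  show "\<forall>n\<ge>1. derivation (flow_coeff n)" by (simp add: derivation_flow_coeff)
  show "\<forall>n\<ge>1. \<forall>p\<ge>1. flow_coeff n \<circ> flow_coeff p = flow_coeff p \<circ> flow_coeff n"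
    by (simp add: flow_coeffs_commute)
  have "H_mu flow_coeff u_series = u_flow" "H_mu flow_coeff m_series = m_flow"
    using H_mu_flow_coeff[of u_series] H_mu_flow_coeff[of m_series]
    unfolding flow_series by (simp_all add: flows_nth_0)
  then show "H_mu flow_coeff u_series =
       div_diff ((lambda_inv * at_lambda u_series - mu_inv * at_mu u_series)
                   * at_mu v_series * at_lambda u_series)
       - div_diff (mu_inv * (at_lambda u_series - at_mu u_series)
                   * (1 + at_mu v_series * at_mu u_series))"
    "H_mu flow_coeff m_series =
       div_diff (mu_inv * (1 + at_mu m_series * at_mu w_series)
                   * (at_lambda m_series - at_mu m_series))
       - div_diff (at_lambda m_series * at_mu w_series
                   * (lambda_inv * at_lambda m_series - mu_inv * at_mu m_series))"
    unfolding u_flow_formula[symmetric] m_flow_formula[symmetric] .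
  show "\<forall>H'. (\<forall>n\<ge>1. derivation (H' n)) \<and>
        H_mu H' u_series = H_mu flow_coeff u_series \<and> H_mu H' m_series = H_mu flow_coeff m_series \<longrightarrow>
        (\<forall>n\<ge>1. H' n = flow_coeff n)"
    using H_mu_eq_derivations[of flow_coeff] derivation_flow_coeff by blast
  show "\<forall>k\<ge>1. \<forall>a. \<forall>x\<in>B_minus.
        value_at (\<lambda>c. c) (classical_limit ((-1) ^ k * flow_coeff k a)) x
          = 1 / 2 * left_action (h_elem k) (classical_limit a) x"
    by (blast intro: flow_is_left_action)
qed

end
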